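(* Let $X$ be a $k$-step compact nilspace, and let $G$ be a countable discrete abelian group acting on $X$ via a homomorphism $\varphi:G\to\Theta(X)$. If $X$ is sub-abelian of order $\le k$, then $(X,G)$ is topological Abramov of order $\le k$. Conversely, if $(X,G)$ is topological Abramov of order $\le k$ and fully ergodic, then $X$ is sub-abelian of order $\le k$.
   Context: Nilspaces. A nilspace is a (nonempty) set $X$ with sets $C^n(X)\subset X^{\{0,1\}^n}$, $n\ge0$ (the $n$-cubes; $C^0(X)=X$), such that: (composition) $c\circ\phi\in C^m(X)$ for every $c\in C^n(X)$ and every $\phi:\{0,1\}^m\to\{0,1\}^n$ that is the restriction of an affine homomorphism $\mathbb{Z}^m\to\mathbb{Z}^n$; (ergodicity) $C^1(X)=X^{\{0,1\}}$; (completion) every $n$-corner, i.e. every map $c':\{0,1\}^n\setminus\{1^n\}\to X$ whose restriction to each face $\{v:v_i=0\}$ is an $(n-1)$-cube, extends to an element of $C^n(X)$ ($1^n=(1,\dots,1)$). $X$ is $k$-step if every $(k+1)$-corner has a unique completion. A morphism is a map $f:X\to Y$ with $f\circ c\in C^n(Y)$ for all $n$ and $c\in C^n(X)$. A nilspace is compact if it has a compact second-countable Hausdorff topology with every $C^n(X)$ closed in $X^{\{0,1\}^n}$. Translations. A translation of $X$ is a bijection $\alpha:X\to X$ such that, for $\alpha$ and $\alpha^{-1}$, applying the map to the values of any cube $c\in C^n(X)$ at the vertices of any face of codimension $1$ (leaving other values unchanged) gives a cube; for compact $X$, $\Theta(X)$ is the group of translations that are homeomorphisms. Full ergodicity. Let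 $C^n(G)$ be the group of maps $\{0,1\}^n\to G$, $v\mapsto x+v_1h_1+\dots+v_nh_n$ with $x,h_i\in G$; it acts on $C^n(X)$ by $(c\cdot q)(v)=\varphi(c(v))(q(v))$. The system $(X,G)$ is fully ergodic if for every $n\ge0$ the action of $C^n(G)$ on $C^n(X)$ is uniquely ergodic (has a unique invariant Borel probability measure). Topological Abramov systems. Let $G$ act by homeomorphisms on the compact metric space $X$, and let $C(X,\mathbb{C})$ be the algebra of continuous functions with the uniform norm. For $g\in G$ let $\Delta_g\phi(x)=\phi(g\cdot x)\overline{\phi(x)}$. A continuous phase polynomial of degree $\le k$ is a function $\phi\in C(X,\mathbb{C})$ such that $\Delta_{g_1}\cdots\Delta_{g_{k+1}}\phi(x)=1$ for all $g_1,\dots,g_{k+1}\in G$, $x\in X$. $(X,G)$ is topological Abramov of order $\le k$ if the algebra generated by the continuous phase polynomials of degree $\le k$ is dense in $C(X,\mathbb{C})$. Sub-abelian nilspaces. A compact nilspace $X$ is sub-abelian of order $\le k$ if there is a compact (second-countable) abelian group nilspace $Y$ of step $\le k$ and an injective continuous morphism $X\to Y$. Here an abelian group nilspace of step $\le k$ is given by an abelian group $A$ with a filtration $A=A_0=A_1\ge A_2\ge\cdots$ of subgroups with $A_{k+1}=\{0\}$ (for a compact one: $A$ a compact abelian group and the $A_i$ closed), with $C^n$ being the subgroup of $A^{\{0,1\}^n}$ generated by the elements $g^F$, for $F$ a face of codimension $i$ and $g\in A_i$, with $g^F(v)=g$ on $F$ and $0$ elsewhere. *)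

theory Defs
  imports
    "HOL-Probability.Probability"
    "HOL-Algebra.Bij" "HOL-Algebra.FiniteProduct" "HOL-Algebra.Product_Groups"
begin

section \<open>Discrete cubes\<close>

text \<open>The vertex set of the discrete \<open>n\<close>-cube; vertices are integer-valued so that affine maps can
  be applied to them.\<close>

definition vertices :: "nat \<Rightarrow> (nat \<Rightarrow> int) set"
  where "vertices n = {..<n} \<rightarrow>\<^sub>E {0, 1}"

definition top_vertex :: "nat \<Rightarrow> nat \<Rightarrow> int"
  where "top_vertex n = (\<lambda>i\<in>{..<n}. 1)"

text \<open>Every affine homomorphism \<open>\<int>\<^sup>m \<rightarrow> \<int>\<^sup>n\<close> is given by an integer matrix \<open>a\<close> and a vector \<open>b\<close>.\<close>

definition affine_maps :: "nat \<Rightarrow> nat \<Rightarrow> ((nat \<Rightarrow> int) \<Rightarrow> nat \<Rightarrow> int) set"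
  where "affine_maps m n =
    {\<phi> \<in> vertices m \<rightarrow> vertices n.
      \<exists>(a :: nat \<Rightarrow> nat \<Rightarrow> int) (b :: nat \<Rightarrow> int).
        \<forall>v\<in>vertices m. \<forall>j<n. \<phi> v j = b j + (\<Sum>i<m. a j i * v i)}"

definition codim_faces :: "nat \<Rightarrow> nat \<Rightarrow> (nat \<Rightarrow> int) set set"
  where "codim_faces n i =
    {{v \<in> vertices n. \<forall>j\<in>J. v j = e j} | J e. J \<subseteq> {..<n} \<and> card J = i \<and> e \<in> J \<rightarrow> {0, 1}}"

text \<open>The bijection from the \<open>(n-1)\<close>-cube onto the face \<open>{v. v i = 0}\<close> of the \<open>n\<close>-cube that inserts
  a zero at coordinate \<open>i\<close>.\<close>

definition insert_zero :: "nat \<Rightarrow> nat \<Rightarrow> (nat \<Rightarrow> int) \<Rightarrow> nat \<Rightarrow> int"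
  where "insert_zero n i w = (\<lambda>j\<in>{..<n}. if j < i then w j else if j = i then 0 else w (j - 1))"

section \<open>Nilspaces\<close>

text \<open>Maps on the discrete \<open>n\<close>-cube are extensional functions on \<^term>\<open>vertices n\<close>.\<close>

type_synonym 'a cubes = "nat \<Rightarrow> ((nat \<Rightarrow> int) \<Rightarrow> 'a) set"

definition corners :: "'a set \<Rightarrow> 'a cubes \<Rightarrow> nat \<Rightarrow> ((nat \<Rightarrow> int) \<Rightarrow> 'a) set"
  where "corners X C n =
    {c' \<in> (vertices n - {top_vertex n}) \<rightarrow>\<^sub>E X.
      \<forall>i<n. (\<lambda>w\<in>vertices (n - 1). c' (insert_zero n i w)) \<in> C (n - 1)}"

definition completes :: "nat \<Rightarrow> ((nat \<Rightarrow> int) \<Rightarrow> 'a) \<Rightarrow> ((nat \<Rightarrow> int) \<Rightarrow> 'a) \<Rightarrow> bool"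
  where "completes n c c' \<longleftrightarrow> (\<forall>v\<in>vertices n - {top_vertex n}. c v = c' v)"

locale nilspace =
  fixes X :: "'a set" and C :: "'a cubes"
  assumes nonempty: "X \<noteq> {}"
    and cubes_subset: "C n \<subseteq> vertices n \<rightarrow>\<^sub>E X"
    and cubes_0: "C 0 = vertices 0 \<rightarrow>\<^sub>E X"
    and composition: "c \<in> C n \<Longrightarrow> \<phi> \<in> affine_maps m n \<Longrightarrow> compose (vertices m) c \<phi> \<in> C m"
    and ergodicity: "C 1 = vertices 1 \<rightarrow>\<^sub>E X"
    and completion: "c' \<in> corners X C n \<Longrightarrow> \<exists>c\<in>C n. completes n c c'"

definition k_step :: "nat \<Rightarrow> 'a set \<Rightarrow> 'a cubes \<Rightarrow> bool"
  where "k_step k X C \<longleftrightarrow>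
    (\<forall>c'\<in>corners X C (k + 1). \<exists>!c. c \<in> C (k + 1) \<and> completes (k + 1) c c')"

definition nilspace_morphism :: "'a set \<Rightarrow> 'a cubes \<Rightarrow> 'b set \<Rightarrow> 'b cubes \<Rightarrow> ('a \<Rightarrow> 'b) \<Rightarrow> bool"
  where "nilspace_morphism X C Y D f \<longleftrightarrow>
    f \<in> X \<rightarrow> Y \<and> (\<forall>n. \<forall>c\<in>C n. compose (vertices n) f c \<in> D n)"

abbreviation cube_topology :: "'a topology \<Rightarrow> nat \<Rightarrow> ((nat \<Rightarrow> int) \<Rightarrow> 'a) topology"
  where "cube_topology T n \<equiv> product_topology (\<lambda>_. T) (vertices n)"

locale compact_nilspace = nilspace "topspace T" C
  for T :: "'a topology" and C :: "'a cubes" +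
  assumes compact: "compact_space T"
    and second_countable: "second_countable T"
    and Hausdorff: "Hausdorff_space T"
    and closed_cubes: "closedin (cube_topology T n) (C n)"

section \<open>Translations\<close>

definition apply_on_face ::
    "nat \<Rightarrow> (nat \<Rightarrow> int) set \<Rightarrow> ('a \<Rightarrow> 'a) \<Rightarrow> ((nat \<Rightarrow> int) \<Rightarrow> 'a) \<Rightarrow> (nat \<Rightarrow> int) \<Rightarrow> 'a"
  where "apply_on_face n F \<alpha> c = (\<lambda>v\<in>vertices n. if v \<in> F then \<alpha> (c v) else c v)"

definition nilspace_translations :: "'a set \<Rightarrow> 'a cubes \<Rightarrow> ('a \<Rightarrow> 'a) set"
  where "nilspace_translations X C =
    {\<alpha> \<in> Bij X. \<forall>n. \<forall>c\<in>C n. \<forall>F\<in>codim_faces n 1.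
      apply_on_face n F \<alpha> c \<in> C n \<and> apply_on_face n F (inv_into X \<alpha>) c \<in> C n}"

definition Theta :: "'a topology \<Rightarrow> 'a cubes \<Rightarrow> ('a \<Rightarrow> 'a) monoid"
  where "Theta T C = BijGroup (topspace T)
    \<lparr>carrier := {\<alpha> \<in> nilspace_translations (topspace T) C. homeomorphic_map T T \<alpha>}\<rparr>"

section \<open>Full ergodicity\<close>

definition borel_of :: "'a topology \<Rightarrow> 'a measure"
  where "borel_of T = sigma (topspace T) {U. openin T U}"

text \<open>An action of a group \<open>G\<close> is a map \<open>\<phi>\<close> sending group elements to self-maps of the space.\<close>

definition action_cubes :: "('g, 'r) monoid_scheme \<Rightarrow> nat \<Rightarrow> ((nat \<Rightarrow> int) \<Rightarrow> 'g) set"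
  where "action_cubes G n =
    {(\<lambda>v\<in>vertices n. x \<otimes>\<^bsub>G\<^esub> (\<Otimes>\<^bsub>G\<^esub>i\<in>{..<n}. h i [^]\<^bsub>G\<^esub> v i)) | x h.
      x \<in> carrier G \<and> h \<in> {..<n} \<rightarrow> carrier G}"

definition cube_action ::
    "('g \<Rightarrow> 'a \<Rightarrow> 'a) \<Rightarrow> nat \<Rightarrow> ((nat \<Rightarrow> int) \<Rightarrow> 'g) \<Rightarrow> ((nat \<Rightarrow> int) \<Rightarrow> 'a) \<Rightarrow> (nat \<Rightarrow> int) \<Rightarrow> 'a"
  where "cube_action \<phi> n c q = (\<lambda>v\<in>vertices n. \<phi> (c v) (q v))"

definition uniquely_ergodic :: "'a topology \<Rightarrow> ('a \<Rightarrow> 'a) set \<Rightarrow> bool"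
  where "uniquely_ergodic T H \<longleftrightarrow>
    (\<exists>!\<mu>. prob_space \<mu> \<and> sets \<mu> = sets (borel_of T) \<and> (\<forall>h\<in>H. distr \<mu> \<mu> h = \<mu>))"

definition fully_ergodic ::
    "'a topology \<Rightarrow> 'a cubes \<Rightarrow> ('g, 'r) monoid_scheme \<Rightarrow> ('g \<Rightarrow> 'a \<Rightarrow> 'a) \<Rightarrow> bool"
  where "fully_ergodic T C G \<phi> \<longleftrightarrow>
    (\<forall>n. uniquely_ergodic (subtopology (cube_topology T n) (C n))
           (cube_action \<phi> n ` action_cubes G n))"

section \<open>Topological Abramov systems\<close>

text \<open>\<open>C(X, \<complex>)\<close> with the uniform metric. Its points are extensional functions; boundedness, which is
  part of the definition of \<^const>\<open>cfunspace\<close>, is automatic on compact spaces.\<close>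

abbreviation C_complex :: "'a topology \<Rightarrow> ('a \<Rightarrow> complex) metric"
  where "C_complex T \<equiv> cfunspace T euclidean_metric"

definition mult_derivative :: "('g \<Rightarrow> 'a \<Rightarrow> 'a) \<Rightarrow> 'g \<Rightarrow> ('a \<Rightarrow> complex) \<Rightarrow> 'a \<Rightarrow> complex"
  where "mult_derivative \<phi> g f = (\<lambda>x. f (\<phi> g x) * cnj (f x))"

definition phase_polynomials ::
    "'a topology \<Rightarrow> ('g, 'r) monoid_scheme \<Rightarrow> ('g \<Rightarrow> 'a \<Rightarrow> 'a) \<Rightarrow> nat \<Rightarrow> ('a \<Rightarrow> complex) set"
  where "phase_polynomials T G \<phi> k =
    {f \<in> mspace (C_complex T). \<forall>gs. set gs \<subseteq> carrier G \<and> length gs = k + 1 \<longrightarrow>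
      (\<forall>x\<in>topspace T. foldr (mult_derivative \<phi>) gs f x = 1)}"

inductive_set generated_algebra :: "'a set \<Rightarrow> ('a \<Rightarrow> complex) set \<Rightarrow> ('a \<Rightarrow> complex) set"
  for X :: "'a set" and S :: "('a \<Rightarrow> complex) set"
  where
    incl: "f \<in> S \<Longrightarrow> f \<in> generated_algebra X S"
  | add: "f \<in> generated_algebra X S \<Longrightarrow> g \<in> generated_algebra X S \<Longrightarrow>
      (\<lambda>x\<in>X. f x + g x) \<in> generated_algebra X S"
  | mult: "f \<in> generated_algebra X S \<Longrightarrow> g \<in> generated_algebra X S \<Longrightarrow>
      (\<lambda>x\<in>X. f x * g x) \<in> generated_algebra X S"
  | scale: "f \<in> generated_algebra X S \<Longrightarrow> (\<lambda>x\<in>X. a * f x) \<in> generated_algebra X S"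

definition topological_Abramov ::
    "nat \<Rightarrow> 'a topology \<Rightarrow> ('g, 'r) monoid_scheme \<Rightarrow> ('g \<Rightarrow> 'a \<Rightarrow> 'a) \<Rightarrow> bool"
  where "topological_Abramov k T G \<phi> \<longleftrightarrow>
    mtopology_of (C_complex T) closure_of
      generated_algebra (topspace T) (phase_polynomials T G \<phi> k) = mspace (C_complex T)"

section \<open>Sub-abelian nilspaces\<close>

locale compact_abelian_group = comm_group A
  for A :: "'b monoid" and S :: "'b topology" +
  assumes topspace_eq: "topspace S = carrier A"
    and compact: "compact_space S"
    and second_countable: "second_countable S"
    and Hausdorff: "Hausdorff_space S"
    and continuous_mult: "continuous_map (prod_topology S S) S (\<lambda>(x, y). x \<otimes>\<^bsub>A\<^esub> y)"
    and continuous_inv: "continuous_map S S (\<lambda>x. inv\<^bsub>A\<^esub> x)"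

definition closed_filtration :: "nat \<Rightarrow> 'b monoid \<Rightarrow> 'b topology \<Rightarrow> (nat \<Rightarrow> 'b set) \<Rightarrow> bool"
  where "closed_filtration k A S F \<longleftrightarrow>
    F 0 = carrier A \<and> F 1 = carrier A \<and> F (k + 1) = {\<one>\<^bsub>A\<^esub>} \<and>
    (\<forall>i. subgroup (F i) A \<and> closedin S (F i) \<and> F (i + 1) \<subseteq> F i)"

definition group_cubes :: "'b monoid \<Rightarrow> (nat \<Rightarrow> 'b set) \<Rightarrow> 'b cubes"
  where "group_cubes A F n =
    generate (product_group (vertices n) (\<lambda>_. A))
      {(\<lambda>v\<in>vertices n. if v \<in> P then g else \<one>\<^bsub>A\<^esub>) | P g i. P \<in> codim_faces n i \<and> g \<in> F i}"

text \<open>The type argument is the type in which the carrier of the abelian group nilspace is taken,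
  as an existential quantifier cannot range over types. A compact second-countable Hausdorff
  space has at most the cardinality of the continuum, so every type with that many elements,
  such as \<^typ>\<open>nat \<Rightarrow> complex\<close>, accommodates all of them.
  Being sub-abelian is assumed with an arbitrary type and concluded with such a concrete one.\<close>

definition sub_abelian :: "'b itself \<Rightarrow> nat \<Rightarrow> 'a topology \<Rightarrow> 'a cubes \<Rightarrow> bool"
  where "sub_abelian (_ :: 'b itself) k T C \<longleftrightarrow>
    (\<exists>(A :: 'b monoid) S F f.
      compact_abelian_group A S \<and> closed_filtration k A S F \<and>
      nilspace_morphism (topspace T) C (carrier A) (group_cubes A F) f \<and>
      continuous_map T S f \<and> inj_on f (topspace T))"

end

theory Submission
  imports Defs
begin

text \<open>
  The theorem compares two ways of saying that a function of modulus one is polynomial: iterated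
  derivatives along the group are trivial, or alternating products over cubes are trivial. Since the
  group acts by translations, the points \<open>\<Prod> g\<^sub>i\<^bsup>v i\<^esup> x\<close> form a cube, and the iterated derivative at \<open>x\<close> is
  the alternating product over that cube (\<open>iterated_derivative_on_cube\<close>). So triviality on cubes
  implies triviality of derivatives.

  If the nilspace embeds into a compact abelian group nilspace, alternating products of characters
  over cubes of that group are trivial (\<open>alternating_prod_group_cube\<close>), so characters composed with
  the embedding are phase polynomials. Characters separate points (\<open>characters_separate_points\<close>), and
  the Stone-Weierstrass theorem (\<open>complex_Stone_Weierstrass\<close>) gives density.

  Conversely, density implies that phase polynomials separate points. Under full ergodicity their
  alternating products over cubes are trivial (\<open>alternating_prod_of_phase_polynomial\<close>): derivatives have
  smaller degree, so by induction the alternating product is a continuous function on the space of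
  cubes that is invariant under cubes of the group; such a function is constant, and it is one on constant
  cubes. A countable separating family is then an embedding into the infinite torus. It is a morphism
  because a torus-valued map on a cube whose alternating products over cubes of dimension above \<open>k\<close> are
  trivial is a product of maps supported on faces of codimension at most \<open>k\<close>
  (\<open>generated_if_alternating_prods_trivial\<close>).

  Two analytic facts carry this. The first is that every nonempty invariant set of a commuting
  family of homeomorphisms of a compact Hausdorff space supports an invariant probability measure
  (\<open>invariant_measure_exists\<close>). It is needed because unique ergodicity says nothing about a point outside the
  support of the unique measure unless its level set carries a measure too. The same fact yields
  Haar measure. The second is the existence of enough characters. It is proved
  without spectral theory: among convolutions of a fixed kernel with the unit ball of L2, maximise the
  L2 norm of the autocorrelation. The maximum is attained by equicontinuity, and strict convexity of the
  norm forces the autocorrelation of a maximiser to be a multiple of a character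
  (\<open>extremal_autocorr_multiplicative\<close>).
\<close>

section \<open>Invariant measures for commuting homeomorphisms\<close>

text \<open>A mean is a finitely additive probability on all subsets of the type that only sees the part of a
  set inside \<open>Z\<close>. Allowing arbitrary sets as arguments makes invariance the plain equation
  \<open>m (h -` E) = m E\<close>, without intersecting preimages with \<open>Z\<close>.\<close>

definition mean_on :: "'a set \<Rightarrow> ('a set \<Rightarrow> real) \<Rightarrow> bool"
  where "mean_on Z m \<longleftrightarrow> (\<forall>E. 0 \<le> m E) \<and> m Z = 1 \<and> (\<forall>E. m (E \<inter> Z) = m E) \<and>
    (\<forall>E F. E \<inter> F = {} \<longrightarrow> m (E \<union> F) = m E + m F)"

lemma mean_on_cong:
  assumes "mean_on Z m" "E \<inter> Z = F \<inter> Z"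
  shows "m E = m F"
  using assms unfolding mean_on_def by metis

lemma mean_on_Un: "mean_on Z m \<Longrightarrow> E \<inter> F = {} \<Longrightarrow> m (E \<union> F) = m E + m F"
  by (simp add: mean_on_def)

lemma mean_on_mono:
  assumes "mean_on Z m" "E \<inter> Z \<subseteq> F"
  shows "m E \<le> m F"
proof -
  have "(E \<inter> Z) \<union> (F - E \<inter> Z) = F" using assms(2) by auto
  moreover have "m ((E \<inter> Z) \<union> (F - E \<inter> Z)) = m (E \<inter> Z) + m (F - E \<inter> Z)"
    by (rule mean_on_Un[OF assms(1)]) auto
  ultimately have "m F = m E + m (F - E \<inter> Z)" "0 \<le> m (F - E \<inter> Z)"
    using assms(1) unfolding mean_on_def by metis+
  then show ?thesis by linarith
qed

lemma mean_on_le_1: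
  assumes "mean_on Z m"
  shows "m E \<le> 1"
proof -
  have "m E \<le> m Z" using mean_on_mono[OF assms, of E Z] by auto
  then show ?thesis using assms by (simp add: mean_on_def)
qed

lemma mean_on_empty: "mean_on Z m \<Longrightarrow> m {} = 0"
  unfolding mean_on_def by (metis Un_empty_right add_cancel_right_right inf_bot_right)

lemma mean_on_point:
  assumes "z \<in> Z"
  shows "mean_on Z (\<lambda>E. of_bool (z \<in> E))"
  using assms unfolding mean_on_def by auto

lemma funpow_image_subset: "h ` Z \<subseteq> Z \<Longrightarrow> x \<in> Z \<Longrightarrow> (h ^^ i) x \<in> Z"
  by (induction i) auto

lemma funpow_commute_on:
  assumes "\<And>x. x \<in> Z \<Longrightarrow> g (h x) = h (g x)" "h ` Z \<subseteq> Z" "x \<in> Z"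
  shows "g ((h ^^ i) x) = (h ^^ i) (g x)"
  using assms by (induction i) (auto simp: funpow_image_subset)

text \<open>The average over the first \<open>N\<close> iterates of \<open>h\<close> telescopes under \<open>h\<close>, so it is invariant up to
  \<open>1 / N\<close>; and averaging does not spoil the almost invariance under maps that commute with \<open>h\<close>.\<close>

lemma mean_on_average:
  fixes N :: nat
  assumes m: "mean_on Z m" and h: "h ` Z \<subseteq> Z" and N: "N > 0"
  defines "m' \<equiv> \<lambda>E. (\<Sum>i<N. m ((h ^^ i) -` E)) / N"
  shows "mean_on Z m'"
    and "\<bar>m' (h -` E) - m' E\<bar> \<le> 1 / N"
    and "\<lbrakk>g ` Z \<subseteq> Z; \<And>x. x \<in> Z \<Longrightarrow> g (h x) = h (g x); \<And>E. \<bar>m (g -` E) - m E\<bar> \<le> \<delta>\<rbrakk>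
          \<Longrightarrow> \<bar>m' (g -` E) - m' E\<bar> \<le> \<delta>"
proof -
  have pos: "0 \<le> m E" for E using m by (simp add: mean_on_def)
  have hi: "(h ^^ i) x \<in> Z" if "x \<in> Z" for x i using funpow_image_subset[OF h that] .
  have 1: "m ((h ^^ i) -` Z) = 1" for i
    using mean_on_cong[OF m, of "(h ^^ i) -` Z" Z] hi m by (auto simp: mean_on_def)
  have 2: "m ((h ^^ i) -` (E \<inter> Z)) = m ((h ^^ i) -` E)" for i E
    by (rule mean_on_cong[OF m]) (use hi in auto)
  have 3: "m ((h ^^ i) -` (E \<union> F)) = m ((h ^^ i) -` E) + m ((h ^^ i) -` F)" if "E \<inter> F = {}" for i E F
    unfolding vimage_Un by (rule mean_on_Un[OF m]) (use that in auto)
  show "mean_on Z m'"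
    unfolding mean_on_def m'_def
    using N by (simp add: 1 2 3 pos sum_nonneg sum.distrib add_divide_distrib del: vimage_Int vimage_Un)
  have "(\<Sum>i<N. m ((h ^^ i) -` (h -` E))) = (\<Sum>i<N. m ((h ^^ Suc i) -` E))"
    by (simp add: vimage_def)
  also have "\<dots> = (\<Sum>i<N. m ((h ^^ i) -` E)) + m ((h ^^ N) -` E) - m E"
    using sum.lessThan_Suc_shift[of "\<lambda>i. m ((h ^^ i) -` E)" N] by simp
  finally have "m' (h -` E) - m' E = (m ((h ^^ N) -` E) - m E) / N"
    unfolding m'_def by (simp add: diff_divide_distrib add_divide_distrib)
  moreover have "\<bar>m ((h ^^ N) -` E) - m E\<bar> \<le> 1"
    using pos[of "(h ^^ N) -` E"] pos[of E] mean_on_le_1[OF m, of "(h ^^ N) -` E"]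
      mean_on_le_1[OF m, of E] by linarith
  ultimately show "\<bar>m' (h -` E) - m' E\<bar> \<le> 1 / N"
    using N by (simp add: divide_right_mono)
  assume g: "g ` Z \<subseteq> Z" "\<And>x. x \<in> Z \<Longrightarrow> g (h x) = h (g x)" "\<And>E. \<bar>m (g -` E) - m E\<bar> \<le> \<delta>"
  have "m ((h ^^ i) -` (g -` E)) = m (g -` ((h ^^ i) -` E))" for i
    by (rule mean_on_cong[OF m]) (use funpow_commute_on[where g=g and h=h, OF g(2) h] in auto)
  then have "m' (g -` E) - m' E = (\<Sum>i<N. m (g -` ((h ^^ i) -` E)) - m ((h ^^ i) -` E)) / N"
    unfolding m'_def by (simp add: diff_divide_distrib sum_subtractf)
  moreover have "\<bar>\<Sum>i<N. m (g -` ((h ^^ i) -` E)) - m ((h ^^ i) -` E)\<bar> \<le> (\<Sum>i<N. \<delta>)"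
    by (rule order_trans[OF sum_abs]) (intro sum_mono g(3))
  ultimately show "\<bar>m' (g -` E) - m' E\<bar> \<le> \<delta>"
    using N by (simp add: pos_divide_le_eq mult.commute)
qed

lemma almost_invariant_mean_exists:
  fixes N :: nat
  assumes "finite S" "Z \<noteq> {}" and N: "N > 0"
    and "\<And>h. h \<in> S \<Longrightarrow> h ` Z \<subseteq> Z"
    and "\<And>g h x. g \<in> S \<Longrightarrow> h \<in> S \<Longrightarrow> x \<in> Z \<Longrightarrow> g (h x) = h (g x)"
  shows "\<exists>m. mean_on Z m \<and> (\<forall>h\<in>S. \<forall>E. \<bar>m (h -` E) - m E\<bar> \<le> 1 / N)"
  using assms(1,4,5)
proof (induction S)
  case empty
  then show ?case using mean_on_point assms(2) by fastforce
next
  case (insert h S)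
  then obtain m where m: "mean_on Z m" "\<forall>g\<in>S. \<forall>E. \<bar>m (g -` E) - m E\<bar> \<le> 1 / N"
    by auto
  have h: "h ` Z \<subseteq> Z" using insert.prems by auto
  show ?case
  proof (rule exI, intro conjI ballI allI)
    show "mean_on Z (\<lambda>E. (\<Sum>i<N. m ((h ^^ i) -` E)) / N)" (is "mean_on Z ?m'")
      by (rule mean_on_average(1)[OF m(1) h N])
    fix g E assume "g \<in> insert h S"
    then consider "g = h" | "g \<in> S" by auto
    then show "\<bar>?m' (g -` E) - ?m' E\<bar> \<le> 1 / N"
    proof cases
      case 1 then show ?thesis using mean_on_average(2)[OF m(1) h N] by simp
    next
      case 2
      show ?thesis
        by (rule mean_on_average(3)[OF m(1) h N]) (use 2 insert.prems m(2) in auto)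
    qed
  qed
qed

lemma closed_mean_on: "closed {m. mean_on Z m}"
proof -
  have "continuous_on UNIV (\<lambda>m :: 'a set \<Rightarrow> real. m E)" for E
    by (simp add: continuous_on_product_coordinates)
  note c = this
  show ?thesis
    unfolding mean_on_def
    by (intro closed_Collect_conj closed_Collect_all closed_Collect_imp closed_Collect_le closed_Collect_eq
        open_Collect_const continuous_intros c)
qed

text \<open>Means form a closed subset of the compact product of copies of \<open>[0, 1]\<close> indexed by all sets, and
  almost invariance is a closed condition that can be met for finitely many maps at once.\<close>

lemma invariant_mean_exists:
  assumes "Z \<noteq> {}" and H: "\<And>h. h \<in> H \<Longrightarrow> h ` Z \<subseteq> Z"
    and comm: "\<And>g h x. g \<in> H \<Longrightarrow> h \<in> H \<Longrightarrow> x \<in> Z \<Longrightarrow> g (h x) = h (g x)"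
  shows "\<exists>m. mean_on Z m \<and> (\<forall>h\<in>H. \<forall>E. m (h -` E) = m E)"
proof -
  have c: "continuous_on UNIV (\<lambda>m :: 'a set \<Rightarrow> real. m E)" for E
    by (simp add: continuous_on_product_coordinates)
  let ?B = "PiE UNIV (\<lambda>_ :: 'a set. {0..1 :: real})"
  let ?I = "H \<times> (UNIV :: nat set)"
  let ?f = "\<lambda>(h, n). {m. mean_on Z m} \<inter> {m. \<forall>E. \<bar>m (h -` E) - m E\<bar> \<le> 1 / Suc n}"
  have "compact ?B"
    unfolding compactin_euclidean_iff[symmetric] euclidean_product_topology[symmetric] compactin_PiE
    by auto
  then have "?B \<inter> \<Inter> (?f ` ?I) \<noteq> {}"
  proof (rule compact_imp_fip_image)
    fix i assume "i \<in> ?I"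
    show "closed (?f i)"
      by (cases i, simp only: prod.case, intro closed_Int closed_mean_on closed_Collect_all
          closed_Collect_le continuous_intros c)
  next
    fix I' assume I': "finite I'" "I' \<subseteq> ?I"
    \<comment> \<open>A bound for all the precisions requested by \<open>I'\<close>.\<close>
    define N where "N = Suc (\<Sum>p\<in>I'. snd p)"
    have N: "Suc n \<le> N" if "(h, n) \<in> I'" for h n
      using member_le_sum[of "(h,n)" I' snd] that I' unfolding N_def by auto
    have "\<exists>m. mean_on Z m \<and> (\<forall>h\<in>fst ` I'. \<forall>E. \<bar>m (h -` E) - m E\<bar> \<le> 1 / N)"
    proof (rule almost_invariant_mean_exists)
      show "N > 0" by (simp add: N_def)
      have sub: "h \<in> H" if "h \<in> fst ` I'" for h using I' that by auto
      show "h ` Z \<subseteq> Z" if "h \<in> fst ` I'" for h by (rule H[OF sub[OF that]])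
      show "g (h x) = h (g x)" if "g \<in> fst ` I'" "h \<in> fst ` I'" "x \<in> Z" for g h x
        by (rule comm[OF sub[OF that(1)] sub[OF that(2)] that(3)])
    qed (use I' assms(1) in auto)
    then obtain m where m: "mean_on Z m" "\<And>h n E. (h, n) \<in> I' \<Longrightarrow> \<bar>m (h -` E) - m E\<bar> \<le> 1 / N"
      by force
    have "\<bar>m (h -` E) - m E\<bar> \<le> 1 / Suc n" if "(h, n) \<in> I'" for h n E
    proof -
      have "1 / real N \<le> 1 / Suc n" using N[OF that] by (simp add: field_simps del: of_nat_Suc)
      then show ?thesis using m(2)[OF that, of E] by linarith
    qed
    moreover have "m \<in> ?B" using mean_on_le_1[OF m(1)] m(1) by (auto simp: mean_on_def)
    ultimately have "m \<in> ?B \<inter> \<Inter> (?f ` I')" using m(1) by auto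
    then show "?B \<inter> \<Inter> (?f ` I') \<noteq> {}" by blast
  qed
  then obtain m0 where "m0 \<in> ?B \<inter> \<Inter> (?f ` ?I)" by blast
  \<comment> \<open>If \<open>H\<close> is empty, the intersection imposes nothing on \<open>m0\<close>, and a point mass serves.\<close>
  define m where "m = (if H = {} then (\<lambda>E. of_bool ((SOME z. z \<in> Z) \<in> E)) else m0)"
  have m: "mean_on Z m" "\<And>h n E. h \<in> H \<Longrightarrow> \<bar>m (h -` E) - m E\<bar> \<le> 1 / Suc n"
    using \<open>m0 \<in> _\<close> mean_on_point[OF some_in_eq[THEN iffD2, OF assms(1)]] unfolding m_def by auto
  have "m (h -` E) = m E" if "h \<in> H" for h E
  proof (rule ccontr)
    assume "m (h -` E) \<noteq> m E"
    then have "0 < \<bar>m (h -` E) - m E\<bar>" by simp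
    from reals_Archimedean[OF this] obtain n where "inverse (real (Suc n)) < \<bar>m (h -` E) - m E\<bar>" by blast
    then show False using m(2)[OF that, of E n] by (simp add: inverse_eq_divide)
  qed
  then show ?thesis using m(1) by blast
qed


text \<open>A mean need not be countably additive. Its regularisation is: approximate open sets by closed sets
  from inside, then arbitrary sets by open sets from outside.\<close>

definition mean_inner :: "'a topology \<Rightarrow> ('a set \<Rightarrow> real) \<Rightarrow> 'a set \<Rightarrow> ennreal"
  where "mean_inner T m U = (SUP C\<in>{C. closedin T C \<and> C \<subseteq> U}. ennreal (m C))"

definition mean_outer :: "'a topology \<Rightarrow> ('a set \<Rightarrow> real) \<Rightarrow> 'a set \<Rightarrow> ennreal"
  where "mean_outer T m E = (INF U\<in>{U. openin T U \<and> E \<subseteq> U}. mean_inner T m U)"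

lemma mean_inner_upper: "closedin T C \<Longrightarrow> C \<subseteq> U \<Longrightarrow> ennreal (m C) \<le> mean_inner T m U"
  unfolding mean_inner_def by (rule SUP_upper) auto

lemma mean_inner_mono: "U \<subseteq> V \<Longrightarrow> mean_inner T m U \<le> mean_inner T m V"
  unfolding mean_inner_def by (rule SUP_subset_mono) auto

lemma mean_outer_lower: "openin T U \<Longrightarrow> E \<subseteq> U \<Longrightarrow> mean_outer T m E \<le> mean_inner T m U"
  unfolding mean_outer_def by (rule INF_lower) auto

lemma mean_outer_mono: "E \<subseteq> F \<Longrightarrow> mean_outer T m E \<le> mean_outer T m F"
  unfolding mean_outer_def by (rule INF_superset_mono) auto

lemma mean_outer_open: "openin T U \<Longrightarrow> mean_outer T m U = mean_inner T m U"
  by (rule antisym[OF mean_outer_lower]) (auto simp: mean_outer_def intro!: INF_greatest mean_inner_mono)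

text \<open>In a normal space a closed set covered by finitely many open sets splits into closed pieces, one
  inside each of them.\<close>

lemma mean_inner_cover:
  assumes "normal_space T" and m: "mean_on Z m"
    and "finite I" "\<And>i. i \<in> I \<Longrightarrow> openin T (U i)" "closedin T C" "C \<subseteq> (\<Union>i\<in>I. U i)"
  shows "ennreal (m C) \<le> (\<Sum>i\<in>I. mean_inner T m (U i))"
  using assms(3-)
proof (induction I arbitrary: C)
  case empty
  then show ?case using mean_on_empty[OF m] by simp
next
  case (insert j I)
  let ?W = "\<Union>i\<in>I. U i"
  have W: "openin T ?W" using insert.prems by auto
  obtain V where V: "openin T V" "C - ?W \<subseteq> V" "T closure_of V \<subseteq> U j"
    using assms(1)[unfolded normal_space_alt, rule_format, of "C - ?W" "U j"] insert.prems W by auto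
  have Vc: "V \<subseteq> T closure_of V" using V(1) by (simp add: closure_of_subset openin_subset)
  have "m C \<le> m ((C \<inter> T closure_of V) \<union> ((C - V) - T closure_of V))"
    by (rule mean_on_mono[OF m]) (use Vc in auto)
  also have "\<dots> = m (C \<inter> T closure_of V) + m ((C - V) - T closure_of V)"
    by (rule mean_on_Un[OF m]) auto
  also have "\<dots> \<le> m (C \<inter> T closure_of V) + m (C - V)"
    by (intro add_left_mono mean_on_mono[OF m]) auto
  finally have "ennreal (m C) \<le> ennreal (m (C \<inter> T closure_of V)) + ennreal (m (C - V))"
    using m by (metis ennreal_leI ennreal_plus mean_on_def)
  also have "\<dots> \<le> mean_inner T m (U j) + (\<Sum>i\<in>I. mean_inner T m (U i))"
  proof (rule add_mono)
    show "ennreal (m (C \<inter> T closure_of V)) \<le> mean_inner T m (U j)"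
      using V insert.prems by (intro mean_inner_upper) auto
    show "ennreal (m (C - V)) \<le> (\<Sum>i\<in>I. mean_inner T m (U i))"
      using V insert.prems by (intro insert.IH) auto
  qed
  finally show ?case using insert.hyps by simp
qed

text \<open>By compactness only finitely many of the open sets matter for a given closed set, so finite
  additivity of the mean is enough for countable subadditivity.\<close>

lemma mean_inner_UN:
  fixes U :: "nat \<Rightarrow> 'a set"
  assumes "compact_space T" "normal_space T" and m: "mean_on Z m"
    and U: "\<And>i. openin T (U i)"
  shows "mean_inner T m (\<Union>i. U i) \<le> (\<Sum>i. mean_inner T m (U i))"
  unfolding mean_inner_def[of T m "\<Union>i. U i"]
proof (rule SUP_least)
  fix C assume "C \<in> {C. closedin T C \<and> C \<subseteq> (\<Union>i. U i)}"
  then have C: "closedin T C" "C \<subseteq> (\<Union>i. U i)" by auto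
  have "compactin T C" using C(1) assms(1) by (simp add: closedin_compact_space)
  then obtain \<F> where F: "finite \<F>" "\<F> \<subseteq> range U" "C \<subseteq> \<Union>\<F>"
    using C(2) U unfolding compactin_def by (metis (no_types, lifting) imageE)
  then obtain I where I: "finite I" "\<F> = U ` I" by (meson finite_subset_image)
  have "ennreal (m C) \<le> (\<Sum>i\<in>I. mean_inner T m (U i))"
    by (rule mean_inner_cover[OF assms(2) m]) (use I F C U in auto)
  also have "\<dots> \<le> (\<Sum>i. mean_inner T m (U i))"
    by (rule sum_le_suminf) (use I in auto)
  finally show "ennreal (m C) \<le> (\<Sum>i. mean_inner T m (U i))" .
qed

lemma mean_outer_empty:
  assumes "mean_on Z m"
  shows "mean_outer T m {} = 0"
  unfolding mean_outer_open[OF openin_empty] mean_inner_def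
  using mean_on_empty[OF assms] by (auto intro!: antisym SUP_least)

lemma outer_measure_space_mean_outer:
  assumes "compact_space T" "normal_space T" and m: "mean_on Z m"
  shows "outer_measure_space (Pow (topspace T)) (mean_outer T m)"
  unfolding outer_measure_space_def
proof (intro conjI)
  show "positive (Pow (topspace T)) (mean_outer T m)"
    by (simp add: positive_def mean_outer_empty[OF m])
  show "increasing (Pow (topspace T)) (mean_outer T m)"
    by (simp add: increasing_def mean_outer_mono)
  show "countably_subadditive (Pow (topspace T)) (mean_outer T m)"
    unfolding countably_subadditive_def
  proof (intro allI impI)
    fix A :: "nat \<Rightarrow> 'a set" assume A: "range A \<subseteq> Pow (topspace T)"
    show "mean_outer T m (\<Union>i. A i) \<le> (\<Sum>i. mean_outer T m (A i))"
    proof (rule ennreal_le_epsilon)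
      fix e :: real assume "0 < e" and fin: "(\<Sum>i. mean_outer T m (A i)) < top_class.top"
      have "\<exists>U. openin T U \<and> A i \<subseteq> U \<and> mean_inner T m U \<le> mean_outer T m (A i) + e * (1/2)^Suc i" for i
      proof -
        have "mean_outer T m (A i) < top_class.top"
          by (rule ennreal_suminf_lessD[OF fin])
        then have "mean_outer T m (A i) < mean_outer T m (A i) + e * (1/2)^Suc i"
          using \<open>0 < e\<close> by (auto simp: less_top)
        then show ?thesis unfolding mean_outer_def INF_less_iff by (auto intro: less_imp_le)
      qed
      then obtain U where U: "\<And>i. openin T (U i)" "\<And>i. A i \<subseteq> U i"
        "\<And>i. mean_inner T m (U i) \<le> mean_outer T m (A i) + e * (1/2)^Suc i" by metis
      have "mean_outer T m (\<Union>i. A i) \<le> mean_inner T m (\<Union>i. U i)"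
        by (rule mean_outer_lower) (use U in auto)
      also have "\<dots> \<le> (\<Sum>i. mean_inner T m (U i))"
        by (rule mean_inner_UN[OF assms U(1)])
      also have "\<dots> \<le> (\<Sum>i. mean_outer T m (A i) + e * (1/2)^Suc i)"
        by (intro suminf_le U) auto
      also have "\<dots> = (\<Sum>i. mean_outer T m (A i)) + (\<Sum>i. ennreal e * ennreal ((1/2)^Suc i))"
        using \<open>0 < e\<close> by (subst suminf_add[symmetric])
          (auto simp del: ennreal_suminf_cmult simp add: ennreal_mult[symmetric])
      also have "\<dots> = (\<Sum>i. mean_outer T m (A i)) + e"
        unfolding ennreal_suminf_cmult
        by (subst suminf_ennreal_eq[OF zero_le_power power_half_series]) auto
      finally show "mean_outer T m (\<Union>i. A i) \<le> (\<Sum>i. mean_outer T m (A i)) + ennreal e" .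
    qed
  qed
qed

text \<open>A closed \<open>C \<subseteq> W \<inter> U\<close> and a closed \<open>D \<subseteq> W - C\<close> are disjoint, so the mean adds up on them.
  This is the inequality that Caratheodory's criterion asks of an open set \<open>U\<close>.\<close>

lemma mean_inner_split:
  assumes m: "mean_on Z m" and U: "openin T U" and W: "openin T W"
  shows "mean_inner T m (W \<inter> U) + mean_outer T m (W - U) \<le> mean_inner T m W"
proof -
  have "ennreal (m C) + mean_outer T m (W - U) \<le> mean_inner T m W" if C: "closedin T C" "C \<subseteq> W \<inter> U" for C
  proof -
    have "ennreal (m C) + ennreal (m D) \<le> mean_inner T m W" if D: "closedin T D" "D \<subseteq> W - C" for D
    proof -
      have "m (C \<union> D) = m C + m D" using D C by (intro mean_on_Un[OF m]) auto
      then have "ennreal (m C) + ennreal (m D) = ennreal (m (C \<union> D))"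
        using m by (simp add: mean_on_def ennreal_plus)
      also have "\<dots> \<le> mean_inner T m W" using C D by (intro mean_inner_upper) auto
      finally show ?thesis .
    qed
    then have "ennreal (m C) + mean_inner T m (W - C) \<le> mean_inner T m W"
      unfolding mean_inner_def[of T m "W - C"]
      by (subst ennreal_SUP_add_right) (auto intro!: SUP_least exI[of _ "{}"])
    moreover have "mean_outer T m (W - U) \<le> mean_inner T m (W - C)"
      using C W by (intro mean_outer_lower) auto
    ultimately show ?thesis by (meson add_left_mono order_trans)
  qed
  then show ?thesis
    unfolding mean_inner_def[of T m "W \<inter> U"]
    by (subst ennreal_SUP_add_left[symmetric]) (auto intro!: SUP_least exI[of _ "{}"])
qed

lemma open_in_lambda_system:
  assumes "compact_space T" "normal_space T" and m: "mean_on Z m" and U: "openin T U"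
  shows "U \<in> lambda_system (topspace T) (Pow (topspace T)) (mean_outer T m)"
proof -
  interpret sigma_algebra "topspace T" "Pow (topspace T)" by (rule sigma_algebra_Pow)
  have oms: "outer_measure_space (Pow (topspace T)) (mean_outer T m)"
    by (rule outer_measure_space_mean_outer[OF assms(1-3)])
  have "mean_outer T m (E \<inter> U) + mean_outer T m (E - U) = mean_outer T m E"
    if E: "E \<subseteq> topspace T" for E
  proof (rule antisym)
    have "mean_outer T m (E \<inter> U) + mean_outer T m (E - U) \<le> mean_inner T m W"
      if W: "openin T W" "E \<subseteq> W" for W
    proof -
      have "mean_outer T m (E \<inter> U) + mean_outer T m (E - U) \<le> mean_inner T m (W \<inter> U) + mean_outer T m (W - U)"
        using W U by (intro add_mono mean_outer_lower mean_outer_mono) auto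
      also have "\<dots> \<le> mean_inner T m W" by (rule mean_inner_split[OF m U W(1)])
      finally show ?thesis .
    qed
    then show "mean_outer T m (E \<inter> U) + mean_outer T m (E - U) \<le> mean_outer T m E"
      unfolding mean_outer_def[of T m E] by (auto intro!: INF_greatest)
    have "subadditive (Pow (topspace T)) (mean_outer T m)"
      using oms countably_subadditive_subadditive unfolding outer_measure_space_def by blast
    from subadditiveD[OF this, of "E \<inter> U" "E - U"] E
    show "mean_outer T m E \<le> mean_outer T m (E \<inter> U) + mean_outer T m (E - U)"
      by (auto simp: Int_Diff_Un)
  qed
  then show ?thesis using U openin_subset[OF U] by (auto simp: lambda_system_eq)
qed

lemma mean_outer_homeomorphic_image:
  assumes m: "mean_on Z m" "Z \<subseteq> topspace T" and h: "homeomorphic_map T T h"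
    and inv: "\<And>E. m (h -` E) = m E" and E: "E \<subseteq> topspace T"
  shows "mean_outer T m (h -` E \<inter> topspace T) = mean_outer T m E"
proof (rule antisym)
  have inj: "inj_on h (topspace T)" and im: "h ` topspace T = topspace T"
    and op: "open_map T T h" and cl: "closed_map T T h" and cont: "continuous_map T T h"
    using h unfolding homeomorphic_eq_everything_map by simp_all
  show "mean_outer T m (h -` E \<inter> topspace T) \<le> mean_outer T m E"
    unfolding mean_outer_def[of T m E]
  proof (rule INF_greatest)
    fix U assume U: "U \<in> {U. openin T U \<and> E \<subseteq> U}"
    have "mean_outer T m (h -` E \<inter> topspace T) \<le> mean_inner T m {x \<in> topspace T. h x \<in> U}"
      using U openin_continuous_map_preimage[OF cont] by (intro mean_outer_lower) auto
    also have "\<dots> \<le> mean_inner T m U"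
      unfolding mean_inner_def[of T m "{x \<in> topspace T. h x \<in> U}"]
    proof (rule SUP_least)
      fix C assume C: "C \<in> {C. closedin T C \<and> C \<subseteq> {x \<in> topspace T. h x \<in> U}}"
      have "m C = m (h -` (h ` C))"
        by (rule mean_on_cong[OF m(1)]) (use C m(2) inj in \<open>auto simp: inj_on_def\<close>)
      then have "m C = m (h ` C)" using inv by simp
      then show "ennreal (m C) \<le> mean_inner T m U"
        using C cl by (auto simp: closed_map_def intro!: mean_inner_upper)
    qed
    finally show "mean_outer T m (h -` E \<inter> topspace T) \<le> mean_inner T m U" .
  qed
  show "mean_outer T m E \<le> mean_outer T m (h -` E \<inter> topspace T)"
    unfolding mean_outer_def[of T m "h -` E \<inter> topspace T"]
  proof (rule INF_greatest)
    fix V assume V: "V \<in> {V. openin T V \<and> h -` E \<inter> topspace T \<subseteq> V}"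
    have "E \<subseteq> h ` V"
    proof
      fix y assume "y \<in> E"
      then obtain x where "x \<in> topspace T" "y = h x" using E im by blast
      then show "y \<in> h ` V" using V \<open>y \<in> E\<close> by blast
    qed
    then have "mean_outer T m E \<le> mean_inner T m (h ` V)"
      using V op by (intro mean_outer_lower) (auto simp: open_map_def)
    also have "\<dots> \<le> mean_inner T m V"
      unfolding mean_inner_def[of T m "h ` V"]
    proof (rule SUP_least)
      fix D assume D: "D \<in> {C. closedin T C \<and> C \<subseteq> h ` V}"
      have "V \<subseteq> topspace T" using V openin_subset by auto
      have "m {x \<in> topspace T. h x \<in> D} = m (h -` D)"
        by (rule mean_on_cong[OF m(1)]) (use m(2) in auto)
      then have "m D = m {x \<in> topspace T. h x \<in> D}" using inv by simp
      moreover have "{x \<in> topspace T. h x \<in> D} \<subseteq> V"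
      proof
        fix x assume x: "x \<in> {x \<in> topspace T. h x \<in> D}"
        then obtain y where "y \<in> V" "h x = h y" using D by auto
        then show "x \<in> V" using inj_onD[OF inj] x \<open>V \<subseteq> topspace T\<close> by (metis (lifting) mem_Collect_eq subsetD)
      qed
      moreover have "closedin T {x \<in> topspace T. h x \<in> D}"
        by (rule closedin_continuous_map_preimage[OF cont]) (use D in simp)
      ultimately show "ennreal (m D) \<le> mean_inner T m V"
        using mean_inner_upper[of T "{x \<in> topspace T. h x \<in> D}" V m] by simp
    qed
    finally show "mean_outer T m E \<le> mean_inner T m V" .
  qed
qed

lemma space_borel_of [simp]: "space (borel_of T) = topspace T"
  and sets_borel_of: "sets (borel_of T) = sigma_sets (topspace T) {U. openin T U}"
  unfolding borel_of_def by (auto simp: space_measure_of_conv sets_measure_of_conv dest: openin_subset)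

lemma sets_borel_of_openin: "openin T U \<Longrightarrow> U \<in> sets (borel_of T)"
  by (auto simp: sets_borel_of)

lemma measurable_borel_of:
  assumes "sets M = sets (borel_of T)" "sets N = sets (borel_of T')" "continuous_map T T' h"
  shows "h \<in> measurable M N"
proof (rule measurable_sigma_sets[where \<Omega>="topspace T'" and A="{U. openin T' U}"])
  have sp: "space M = topspace T" using sets_eq_imp_space_eq[OF assms(1)] by simp
  show "sets N = sigma_sets (topspace T') {U. openin T' U}" using assms(2) by (simp add: sets_borel_of)
  show "{U. openin T' U} \<subseteq> Pow (topspace T')" by (auto dest: openin_subset)
  show "h \<in> space M \<rightarrow> topspace T'" using assms(3) sp by (auto simp: continuous_map_def)
  fix U assume "U \<in> {U. openin T' U}"
  then have "openin T {x \<in> topspace T. h x \<in> U}"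
    using assms(3) by (auto intro: openin_continuous_map_preimage)
  moreover have "h -` U \<inter> space M = {x \<in> topspace T. h x \<in> U}" using sp by auto
  ultimately show "h -` U \<inter> space M \<in> sets M" using assms(1) by (simp add: sets_borel_of_openin)
qed

text \<open>This is amenability of abelian groups in topological form: regularise an invariant mean on the
  invariant set \<open>Z\<close>. The last conclusion says that the measure lives on the closure of \<open>Z\<close>.\<close>

theorem invariant_measure_exists:
  assumes "compact_space T" "Hausdorff_space T"
    and H: "\<And>h. h \<in> H \<Longrightarrow> homeomorphic_map T T h"
    and comm: "\<And>g h x. g \<in> H \<Longrightarrow> h \<in> H \<Longrightarrow> x \<in> topspace T \<Longrightarrow> g (h x) = h (g x)"
    and Z: "Z \<subseteq> topspace T" "Z \<noteq> {}" "\<And>h. h \<in> H \<Longrightarrow> h ` Z \<subseteq> Z"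
  obtains \<mu> where "prob_space \<mu>" "sets \<mu> = sets (borel_of T)" "\<And>h. h \<in> H \<Longrightarrow> distr \<mu> \<mu> h = \<mu>"
    "\<And>W. openin T W \<Longrightarrow> W \<inter> Z = {} \<Longrightarrow> emeasure \<mu> W = 0"
proof -
  obtain m where m: "mean_on Z m" "\<And>h E. h \<in> H \<Longrightarrow> m (h -` E) = m E"
    using invariant_mean_exists[OF Z(2,3), of H] comm Z(1) by (meson subsetD)
  have normal: "normal_space T" using assms(1,2) compact_Hausdorff_or_regular_imp_normal_space by blast
  let ?L = "lambda_system (topspace T) (Pow (topspace T)) (mean_outer T m)"
  interpret sigma_algebra "topspace T" "Pow (topspace T)" by (rule sigma_algebra_Pow)
  have L: "measure_space (topspace T) ?L (mean_outer T m)"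
    by (rule caratheodory_lemma[OF outer_measure_space_mean_outer[OF assms(1) normal m(1)]])
  have sa: "sigma_algebra (topspace T) (sets (borel_of T))"
    using sets.sigma_algebra_axioms[of "borel_of T"] by simp
  have sub: "sets (borel_of T) \<subseteq> ?L"
    unfolding sets_borel_of
    by (rule sigma_algebra.sigma_sets_subset)
       (use L open_in_lambda_system[OF assms(1) normal m(1)] in \<open>auto simp: measure_space_def\<close>)
  have ms: "measure_space (topspace T) (sets (borel_of T)) (mean_outer T m)"
    by (rule measure_down[OF L sa sub])
  define \<mu> where "\<mu> = measure_of (topspace T) (sets (borel_of T)) (mean_outer T m)"
  have sets: "sets \<mu> = sets (borel_of T)"
    unfolding \<mu>_def by (metis sets.sets_measure_of_eq space_borel_of)
  have sp: "space \<mu> = topspace T" using sets_eq_imp_space_eq[OF sets] by simp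
  have em: "emeasure \<mu> E = mean_outer T m E" if "E \<in> sets (borel_of T)" for E
    unfolding \<mu>_def by (rule emeasure_measure_of_sigma) (use ms that in \<open>auto simp: measure_space_def\<close>)
  show thesis
  proof
    have "m (topspace T) = 1"
      using mean_on_cong[OF m(1), of "topspace T" Z] Z(1) m(1) by (auto simp: mean_on_def)
    then have "mean_inner T m (topspace T) = 1"
      unfolding mean_inner_def
      by (intro antisym SUP_least SUP_upper2[of "topspace T"]) (auto simp: mean_on_le_1[OF m(1)])
    then show "prob_space \<mu>"
      using em[of "topspace T"] sp by (intro prob_spaceI) (simp add: sets_borel_of_openin mean_outer_open)
    show "sets \<mu> = sets (borel_of T)" by (rule sets)
    show "emeasure \<mu> W = 0" if "openin T W" "W \<inter> Z = {}" for W
    proof -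
      have "m C = 0" if "C \<subseteq> W" for C
        using mean_on_cong[OF m(1), of C "{}"] mean_on_empty[OF m(1)] that \<open>W \<inter> Z = {}\<close> by auto
      then have "mean_inner T m W = 0" unfolding mean_inner_def by (auto intro!: antisym SUP_least)
      then show ?thesis using that em by (simp add: sets_borel_of_openin mean_outer_open)
    qed
    fix h assume h: "h \<in> H"
    have meas: "h \<in> measurable \<mu> \<mu>"
      using measurable_borel_of[OF sets sets] H[OF h] homeomorphic_imp_continuous_map by blast
    show "distr \<mu> \<mu> h = \<mu>"
    proof (rule measure_eqI)
      fix E assume "E \<in> sets (distr \<mu> \<mu> h)"
      then have E: "E \<in> sets \<mu>" by simp
      then have "h -` E \<inter> space \<mu> \<in> sets \<mu>" by (rule measurable_sets[OF meas])
      then have "emeasure \<mu> (h -` E \<inter> space \<mu>) = mean_outer T m (h -` E \<inter> topspace T)"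
        using em sets sp by auto
      also have "\<dots> = mean_outer T m E"
        using mean_outer_homeomorphic_image[OF m(1) Z(1) H[OF h] m(2)[OF h]] sets.sets_into_space[OF E] sp by auto
      finally show "emeasure (distr \<mu> \<mu> h) E = emeasure \<mu> E"
        using E em sets by (simp add: emeasure_distr[OF meas E])
    qed simp
  qed
qed

section \<open>Haar measure, convolution and autocorrelation\<close>

lemma continuous_map_euclidean_iff:
  "continuous_map X euclidean f \<longleftrightarrow> (\<forall>x\<in>topspace X. (f \<longlongrightarrow> f x) (atin X x))"
  by (simp add: continuous_map_atin)

locale haar_group = compact_abelian_group A S + prob_space \<mu>
  for A :: "'b monoid" and S :: "'b topology" and \<mu> :: "'b measure" +
  assumes sets_haar: "sets \<mu> = sets (borel_of S)"
    and haar_invariant: "a \<in> carrier A \<Longrightarrow> distr \<mu> \<mu> (\<lambda>x. a \<otimes>\<^bsub>A\<^esub> x) = \<mu>"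

context compact_abelian_group
begin

abbreviation mul :: "'b \<Rightarrow> 'b \<Rightarrow> 'b" (infixl "\<cdot>" 70) where "x \<cdot> y \<equiv> x \<otimes>\<^bsub>A\<^esub> y"
abbreviation iv :: "'b \<Rightarrow> 'b" where "iv x \<equiv> inv\<^bsub>A\<^esub> x"
abbreviation cont :: "('b \<Rightarrow> 'c::topological_space) \<Rightarrow> bool" where "cont f \<equiv> continuous_map S euclidean f"

lemma inv_mult_cancel [simp]:
  assumes "a \<in> carrier A" "x \<in> carrier A"
  shows "iv a \<cdot> (a \<cdot> x) = x" "a \<cdot> (iv a \<cdot> x) = x"
  using assms by (simp_all flip: m_assoc)

lemma continuous_translation:
  assumes "a \<in> carrier A"
  shows "continuous_map S S (\<lambda>x. a \<cdot> x)"
proof -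
  have "continuous_map S (prod_topology S S) (\<lambda>x. (a, x))"
    using assms topspace_eq by (auto simp: continuous_map_pairwise comp_def)
  from continuous_map_compose[OF this continuous_mult] show ?thesis by (simp add: comp_def)
qed

lemma homeomorphic_translation:
  assumes "a \<in> carrier A"
  shows "homeomorphic_map S S (\<lambda>x. a \<cdot> x)"
  unfolding homeomorphic_map_maps homeomorphic_maps_def
  using assms continuous_translation topspace_eq by (intro exI[of _ "\<lambda>x. iv a \<cdot> x"]) auto

text \<open>Left translations commute because the group is abelian, so Haar measure is an instance of the
  existence of invariant measures.\<close>

lemma haar_measure_exists: "\<exists>\<mu>. haar_group A S \<mu>"
proof -
  have "\<exists>\<mu>. prob_space \<mu> \<and> sets \<mu> = sets (borel_of S) \<and> (\<forall>h\<in>(\<lambda>a x. a \<cdot> x) ` carrier A. distr \<mu> \<mu> h = \<mu>)"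
  proof (rule invariant_measure_exists[OF compact Hausdorff, of "(\<lambda>a x. a \<cdot> x) ` carrier A" "carrier A"])
    show "carrier A \<noteq> {}" by blast
  qed (auto simp: homeomorphic_translation topspace_eq m_lcomm)
  then show ?thesis
    using compact_abelian_group_axioms by (auto simp: haar_group_def haar_group_axioms_def)
qed

lemma cont_translate: "cont f \<Longrightarrow> a \<in> carrier A \<Longrightarrow> cont (\<lambda>x. f (a \<cdot> x))"
  using continuous_map_compose[OF continuous_translation, of a euclidean f] by (simp add: comp_def)

lemma cont_algebra:
  fixes f g :: "'b \<Rightarrow> complex"
  assumes "cont f" "cont g"
  shows "cont (\<lambda>x. f x + g x)" "cont (\<lambda>x. f x - g x)" "cont (\<lambda>x. f x * g x)"
  using assms unfolding continuous_map_euclidean_iff by (auto intro: tendsto_intros)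

lemma cont_cnj: "cont f \<Longrightarrow> cont (\<lambda>x. cnj (f x))"
  unfolding continuous_map_euclidean_iff by (auto intro: tendsto_intros)

lemma cont_const: "cont (\<lambda>x. c)"
  by simp

lemma cont_cmod2: "cont f \<Longrightarrow> cont (\<lambda>x. (cmod (f x))\<^sup>2)"
  unfolding continuous_map_euclidean_iff by (auto intro!: tendsto_intros)

lemma cont_cmod: "cont f \<Longrightarrow> cont (\<lambda>x. cmod (f x))"
  unfolding continuous_map_euclidean_iff by (auto intro!: tendsto_intros)

lemmas cont_intros = cont_algebra cont_cnj cont_const cont_cmod2 cont_cmod
  cont_translate cont_cnj[OF cont_translate] cont_algebra(3)[OF cont_translate]

lemma cont_bounded:
  fixes f :: "'b \<Rightarrow> 'c::real_normed_vector"
  assumes "cont f"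
  obtains B where "B > 0" "\<And>x. x \<in> carrier A \<Longrightarrow> norm (f x) \<le> B"
proof -
  have "compactin euclidean (f ` carrier A)"
    using image_compactin[OF _ assms] compact by (simp add: compact_space_def topspace_eq)
  then have "bounded (f ` carrier A)" by (simp add: compact_imp_bounded)
  then show thesis using that by (auto simp: bounded_pos)
qed

text \<open>The set of pairs \<open>(t, x)\<close> with \<open>f (t x)\<close> close to \<open>f x\<close> is open and contains the slice over the unit;
  the tube lemma provides the neighbourhood.\<close>

lemma uniformly_continuous:
  fixes f :: "'b \<Rightarrow> 'c::real_normed_vector"
  assumes f: "cont f" and e: "e > 0"
  obtains U where "openin S U" "\<one>\<^bsub>A\<^esub> \<in> U"
    "\<And>t x. t \<in> U \<Longrightarrow> x \<in> carrier A \<Longrightarrow> norm (f (t \<cdot> x) - f x) < e"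
proof -
  let ?P = "prod_topology S S"
  have "continuous_map ?P euclidean (\<lambda>p. f (fst p \<cdot> snd p))"
    using continuous_map_compose[OF continuous_mult f] by (simp add: comp_def case_prod_unfold)
  moreover have "continuous_map ?P euclidean (\<lambda>p. f (snd p))"
    using continuous_map_compose[OF continuous_map_snd f] by (simp add: comp_def)
  ultimately have "continuous_map ?P euclidean (\<lambda>p. f (fst p \<cdot> snd p) - f (snd p))"
    by (rule continuous_map_diff)
  from openin_continuous_map_preimage[OF this, of "ball 0 e"]
  have W: "openin ?P {p \<in> topspace ?P. f (fst p \<cdot> snd p) - f (snd p) \<in> ball 0 e}" (is "openin ?P ?W")
    by simp
  have "{\<one>\<^bsub>A\<^esub>} \<times> carrier A \<subseteq> ?W" using e by (auto simp: topspace_eq)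
  then obtain U V where UV: "openin S U" "\<one>\<^bsub>A\<^esub> \<in> U" "carrier A \<subseteq> V" "U \<times> V \<subseteq> ?W"
    using tube_lemma_right[OF W, of "carrier A" "\<one>\<^bsub>A\<^esub>"] compact topspace_eq
    by (auto simp: compact_space_def)
  have "norm (f (t \<cdot> x) - f x) < e" if "t \<in> U" "x \<in> carrier A" for t x
  proof -
    have "(t, x) \<in> ?W" using that UV(3,4) by (meson SigmaI subsetD)
    then show ?thesis by simp
  qed
  then show thesis using that UV by blast
qed

lemma translate_nbhd:
  assumes "openin S U" "a \<in> carrier A"
  shows "openin S {x \<in> carrier A. x \<cdot> iv a \<in> U}"
proof -
  have "{x \<in> carrier A. x \<cdot> iv a \<in> U} = {x \<in> topspace S. iv a \<cdot> x \<in> U}"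
    using assms(2) by (auto simp: topspace_eq m_comm)
  then show ?thesis
    using openin_continuous_map_preimage[OF continuous_translation assms(1), of "iv a"] assms(2) by simp
qed

lemma continuous_if_uniformly:
  fixes g :: "'b \<Rightarrow> 'c::real_normed_vector"
  assumes "\<And>e. e > 0 \<Longrightarrow> \<exists>U. openin S U \<and> \<one>\<^bsub>A\<^esub> \<in> U \<and> (\<forall>t\<in>U. \<forall>x\<in>carrier A. norm (g (t \<cdot> x) - g x) \<le> e)"
  shows "cont g"
proof -
  have "(g \<longlongrightarrow> g x) (atin S x)" if x: "x \<in> carrier A" for x
  proof (rule tendstoI)
    fix e :: real assume "e > 0"
    then obtain U where U: "openin S U" "\<one>\<^bsub>A\<^esub> \<in> U" "\<forall>t\<in>U. \<forall>x\<in>carrier A. norm (g (t \<cdot> x) - g x) \<le> e / 2"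
      using assms[of "e/2"] by auto
    let ?V = "{y \<in> carrier A. y \<cdot> iv x \<in> U}"
    have "dist (g y) (g x) < e" if "y \<in> ?V" for y
    proof -
      have "norm (g ((y \<cdot> iv x) \<cdot> x) - g x) \<le> e / 2" using U(3) that x by blast
      moreover have "(y \<cdot> iv x) \<cdot> x = y" using that x by (simp add: m_assoc)
      ultimately show ?thesis using \<open>e > 0\<close> by (simp add: dist_norm)
    qed
    moreover have "openin S ?V" "x \<in> ?V" using translate_nbhd[OF U(1) x] U(2) x by auto
    ultimately show "\<forall>\<^sub>F y in atin S x. dist (g y) (g x) < e"
      unfolding eventually_atin by blast
  qed
  then show ?thesis by (simp add: continuous_map_euclidean_iff topspace_eq)
qed

end

context haar_group
begin

lemma space_haar: "space \<mu> = carrier A"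
  using sets_eq_imp_space_eq[OF sets_haar] topspace_eq by simp

lemma cont_measurable:
  fixes f :: "'b \<Rightarrow> 'c::topological_space"
  assumes "cont f"
  shows "f \<in> borel_measurable \<mu>"
proof (rule borel_measurableI)
  fix U :: "'c set" assume "open U"
  then have "openin S {x \<in> topspace S. f x \<in> U}"
    by (intro openin_continuous_map_preimage[OF assms]) simp
  moreover have "f -` U \<inter> space \<mu> = {x \<in> topspace S. f x \<in> U}"
    using space_haar topspace_eq by auto
  ultimately show "f -` U \<inter> space \<mu> \<in> sets \<mu>" by (simp add: sets_haar sets_borel_of_openin)
qed

lemma cont_integrable:
  fixes f :: "'b \<Rightarrow> 'c::{banach, second_countable_topology}"
  assumes "cont f"
  shows "integrable \<mu> f"
proof -
  obtain B where "\<And>x. x \<in> carrier A \<Longrightarrow> norm (f x) \<le> B" using cont_bounded[OF assms] by blast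
  then show ?thesis
    by (intro integrable_const_bound[of _ B] cont_measurable assms AE_I2) (simp add: space_haar)
qed

lemma integral_translate:
  fixes f :: "'b \<Rightarrow> 'c::{banach, second_countable_topology}"
  assumes "cont f" "a \<in> carrier A"
  shows "(\<integral>x. f (a \<cdot> x) \<partial>\<mu>) = (\<integral>x. f x \<partial>\<mu>)"
proof -
  have "(\<lambda>x. a \<cdot> x) \<in> measurable \<mu> \<mu>"
    by (rule measurable_borel_of[OF sets_haar sets_haar continuous_translation[OF assms(2)]])
  from integral_distr[OF this cont_measurable[OF assms(1)]] show ?thesis
    using haar_invariant[OF assms(2)] by simp
qed

lemma integral_cong_carrier:
  "(\<And>x. x \<in> carrier A \<Longrightarrow> f x = g x) \<Longrightarrow> (\<integral>x. f x \<partial>\<mu>) = (\<integral>x. g x \<partial>\<mu>)"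
  by (rule Bochner_Integration.integral_cong) (auto simp: space_haar)

text \<open>Haar measure has full support: finitely many translates of \<open>f\<close> have a sum that is positive
  everywhere as soon as \<open>f\<close> is positive somewhere.\<close>

lemma integral_zero_imp_zero:
  fixes f :: "'b \<Rightarrow> real"
  assumes f: "cont f" and nonneg: "\<And>x. x \<in> carrier A \<Longrightarrow> f x \<ge> 0"
    and zero: "(\<integral>x. f x \<partial>\<mu>) = 0" and x0: "x0 \<in> carrier A"
  shows "f x0 = 0"
proof (rule ccontr)
  assume "f x0 \<noteq> 0"
  then have pos: "f x0 > 0" using nonneg[OF x0] by simp
  have op: "openin S {x \<in> topspace S. f (a \<cdot> x) \<in> {0<..}}" if "a \<in> carrier A" for a
    by (rule openin_continuous_map_preimage[OF cont_translate[OF f that]]) simp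
  have cover: "topspace S \<subseteq> (\<Union>a\<in>carrier A. {x \<in> topspace S. f (a \<cdot> x) \<in> {0<..}})"
  proof
    fix x assume "x \<in> topspace S"
    then have "x \<in> carrier A" by (simp add: topspace_eq)
    then have "(x0 \<cdot> iv x) \<cdot> x = x0" using x0 by (simp add: m_assoc)
    then show "x \<in> (\<Union>a\<in>carrier A. {x \<in> topspace S. f (a \<cdot> x) \<in> {0<..}})"
      using pos x0 \<open>x \<in> carrier A\<close> by (intro UN_I[of "x0 \<cdot> iv x"]) (auto simp: topspace_eq)
  qed
  have "compactin S (topspace S)" using compact by (simp add: compact_space_def)
  then obtain F where F: "finite F" "F \<subseteq> (\<lambda>a. {x \<in> topspace S. f (a \<cdot> x) \<in> {0<..}}) ` carrier A" "topspace S \<subseteq> \<Union>F"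
    using cover op unfolding compactin_def by (metis (no_types, lifting) imageE)
  then obtain I where I: "finite I" "I \<subseteq> carrier A" "F = (\<lambda>a. {x \<in> topspace S. f (a \<cdot> x) \<in> {0<..}}) ` I"
    by (meson finite_subset_image)
  have fa: "integrable \<mu> (\<lambda>x. f (a \<cdot> x))" if "a \<in> I" for a
    using cont_integrable cont_translate f that I by blast
  have "(\<integral>x. (\<Sum>a\<in>I. f (a \<cdot> x)) \<partial>\<mu>) = (\<Sum>a\<in>I. \<integral>x. f (a \<cdot> x) \<partial>\<mu>)"
    by (rule Bochner_Integration.integral_sum) (rule fa)
  also have "\<dots> = 0" using integral_translate[OF f] I zero by (auto intro!: sum.neutral)
  finally have "(\<integral>x. (\<Sum>a\<in>I. f (a \<cdot> x)) \<partial>\<mu>) = 0" .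
  moreover have "integrable \<mu> (\<lambda>x. \<Sum>a\<in>I. f (a \<cdot> x))" using fa by simp
  moreover have "AE x in \<mu>. 0 \<le> (\<Sum>a\<in>I. f (a \<cdot> x))"
    using nonneg I by (intro AE_I2 sum_nonneg) (auto simp: space_haar)
  ultimately have "AE x in \<mu>. (\<Sum>a\<in>I. f (a \<cdot> x)) = 0"
    using integral_nonneg_eq_0_iff_AE by blast
  moreover have "AE x in \<mu>. (\<Sum>a\<in>I. f (a \<cdot> x)) > 0"
  proof (rule AE_I2)
    fix x assume "x \<in> space \<mu>"
    then have x: "x \<in> carrier A" by (simp add: space_haar)
    then obtain a where "a \<in> I" "f (a \<cdot> x) > 0" using F(3) I(3) by (auto simp: topspace_eq)
    then show "(\<Sum>a\<in>I. f (a \<cdot> x)) > 0"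
      using nonneg I x by (intro sum_pos2[of _ a]) auto
  qed
  ultimately have "AE x in \<mu>. False" by eventually_elim simp
  then show False by simp
qed

text \<open>Writing \<open>x \<cdot> y\<close> instead of \<open>x \<cdot> y\<^sup>-\<^sup>1\<close> avoids inverses and is just as good, since only the compactness of
  \<open>f \<mapsto> conv k f\<close> and its behaviour under translations matter.\<close>

definition conv :: "('b \<Rightarrow> complex) \<Rightarrow> ('b \<Rightarrow> complex) \<Rightarrow> 'b \<Rightarrow> complex"
  where "conv k f x = (\<integral>y. k (x \<cdot> y) * f y \<partial>\<mu>)"

text \<open>In terms of Fourier coefficients, \<open>autocorr g\<close> is the sum of \<open>|g^(\<psi>)|^2 \<psi>\<close> over the characters \<open>\<psi>\<close>.\<close>

definition autocorr :: "('b \<Rightarrow> complex) \<Rightarrow> 'b \<Rightarrow> complex"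
  where "autocorr g = conv g (\<lambda>y. cnj (g y))"

definition sqnorm :: "('b \<Rightarrow> complex) \<Rightarrow> real"
  where "sqnorm f = (\<integral>x. (cmod (f x))\<^sup>2 \<partial>\<mu>)"

lemma integrable_cmod2: "cont f \<Longrightarrow> integrable \<mu> (\<lambda>x. (cmod (f x))\<^sup>2)"
  by (intro cont_integrable cont_intros)

lemma sqnorm_nonneg: "sqnorm f \<ge> 0"
  by (simp add: sqnorm_def)

lemma sqnorm_zero: "cont f \<Longrightarrow> sqnorm f = 0 \<Longrightarrow> x \<in> carrier A \<Longrightarrow> f x = 0"
  using integral_zero_imp_zero[OF cont_cmod2, of f x] by (simp add: sqnorm_def)

lemma sqnorm_cong: "(\<And>x. x \<in> carrier A \<Longrightarrow> f x = g x) \<Longrightarrow> sqnorm f = sqnorm g"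
  unfolding sqnorm_def by (rule integral_cong_carrier) simp

lemma sqnorm_scale: "sqnorm (\<lambda>x. c * f x) = (cmod c)\<^sup>2 * sqnorm f"
  unfolding sqnorm_def by (simp add: norm_mult power_mult_distrib)

lemma sqnorm_bound:
  assumes "cont f" "\<And>x. x \<in> carrier A \<Longrightarrow> cmod (f x) \<le> B"
  shows "sqnorm f \<le> B\<^sup>2"
  unfolding sqnorm_def
  using assms by (intro integral_le_const integrable_cmod2 AE_I2 power_mono) (auto simp: space_haar)

lemma sqnorm_translate: "cont f \<Longrightarrow> a \<in> carrier A \<Longrightarrow> sqnorm (\<lambda>x. f (a \<cdot> x)) = sqnorm f"
  unfolding sqnorm_def using integral_translate[OF cont_cmod2] by simp

lemma sqnorm_parallelogram:
  assumes "cont f" "cont g"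
  shows "sqnorm (\<lambda>x. f x + g x) + sqnorm (\<lambda>x. f x - g x) = 2 * sqnorm f + 2 * sqnorm g"
proof -
  have *: "(cmod (u + v))\<^sup>2 + (cmod (u - v))\<^sup>2 = 2 * (cmod u)\<^sup>2 + 2 * (cmod v)\<^sup>2" for u v :: complex
    unfolding cmod_power2 by (simp add: power2_eq_square algebra_simps)
  have "sqnorm (\<lambda>x. f x + g x) + sqnorm (\<lambda>x. f x - g x)
      = (\<integral>x. (cmod (f x + g x))\<^sup>2 + (cmod (f x - g x))\<^sup>2 \<partial>\<mu>)"
    unfolding sqnorm_def
    by (intro Bochner_Integration.integral_add[symmetric] integrable_cmod2 cont_intros assms)
  also have "\<dots> = (\<integral>x. 2 * (cmod (f x))\<^sup>2 + 2 * (cmod (g x))\<^sup>2 \<partial>\<mu>)" by (simp add: *)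
  also have "\<dots> = 2 * sqnorm f + 2 * sqnorm g"
    unfolding sqnorm_def using integrable_cmod2[OF assms(1)] integrable_cmod2[OF assms(2)] by simp
  finally show ?thesis .
qed

lemma conv_integrable:
  fixes k f :: "'b \<Rightarrow> complex"
  shows "cont k \<Longrightarrow> cont f \<Longrightarrow> x \<in> carrier A \<Longrightarrow> integrable \<mu> (\<lambda>y. k (x \<cdot> y) * f y)"
  by (rule cont_integrable) (rule cont_algebra(3)[OF cont_translate])

lemma conv_bound:
  assumes k: "cont k" and f: "cont f" and x: "x \<in> carrier A"
    and B: "\<And>z. z \<in> carrier A \<Longrightarrow> cmod (k z) \<le> B"
  shows "cmod (conv k f x) \<le> B * (\<integral>y. cmod (f y) \<partial>\<mu>)"
proof -
  have "cmod (conv k f x) \<le> (\<integral>y. cmod (k (x \<cdot> y) * f y) \<partial>\<mu>)"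
    unfolding conv_def by (rule integral_norm_bound)
  also have "\<dots> \<le> (\<integral>y. B * cmod (f y) \<partial>\<mu>)"
    using x B by (intro integral_mono conv_integrable integrable_norm k f integrable_mult_right cont_integrable)
      (auto simp: space_haar norm_mult intro!: mult_right_mono)
  finally show ?thesis by simp
qed

lemma conv_diff_bound:
  assumes k: "cont k" and f: "cont f" and t: "t \<in> carrier A" and x: "x \<in> carrier A"
    and e: "\<And>z. z \<in> carrier A \<Longrightarrow> cmod (k (t \<cdot> z) - k z) \<le> e"
  shows "cmod (conv k f (t \<cdot> x) - conv k f x) \<le> e * (\<integral>y. cmod (f y) \<partial>\<mu>)"
proof -
  have "conv k f (t \<cdot> x) - conv k f x = (\<integral>y. k ((t \<cdot> x) \<cdot> y) * f y - k (x \<cdot> y) * f y \<partial>\<mu>)"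
    unfolding conv_def using t x
    by (intro Bochner_Integration.integral_diff[symmetric] conv_integrable k f) auto
  also have "\<dots> = conv (\<lambda>z. k (t \<cdot> z) - k z) f x"
    unfolding conv_def
    by (rule integral_cong_carrier) (use t x in \<open>simp add: m_assoc algebra_simps\<close>)
  finally show ?thesis
    using conv_bound[of "\<lambda>z. k (t \<cdot> z) - k z" f x e] k f t x e by (simp add: cont_intros)
qed

lemma cont_conv:
  assumes k: "cont k" and f: "cont f"
  shows "cont (conv k f)"
proof (rule continuous_if_uniformly)
  fix e :: real assume "e > 0"
  define I where "I = (\<integral>y. cmod (f y) \<partial>\<mu>)"
  \<comment> \<open>The integral may vanish, hence the denominator \<open>I + 1\<close>.\<close>
  have I: "I \<ge> 0" by (simp add: I_def)
  then have "e / (I + 1) > 0" using \<open>e > 0\<close> by simp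
  from uniformly_continuous[OF k this] obtain U where U: "openin S U" "\<one>\<^bsub>A\<^esub> \<in> U"
    "\<And>t x. t \<in> U \<Longrightarrow> x \<in> carrier A \<Longrightarrow> cmod (k (t \<cdot> x) - k x) < e / (I + 1)" by blast
  have "cmod (conv k f (t \<cdot> x) - conv k f x) \<le> e" if "t \<in> U" "x \<in> carrier A" for t x
  proof -
    have "t \<in> carrier A" using that U(1) openin_subset topspace_eq by blast
    then have "cmod (conv k f (t \<cdot> x) - conv k f x) \<le> e / (I + 1) * I"
      unfolding I_def[symmetric]
      using conv_diff_bound[OF k f _ that(2), of t "e / (I + 1)"] U(3)[OF that(1)] by (force simp: I_def)
    also have "\<dots> \<le> e" using I \<open>e > 0\<close> by (simp add: field_simps)
    finally show ?thesis .
  qed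
  then show "\<exists>U. openin S U \<and> \<one>\<^bsub>A\<^esub> \<in> U \<and> (\<forall>t\<in>U. \<forall>x\<in>carrier A. cmod (conv k f (t \<cdot> x) - conv k f x) \<le> e)"
    using U by blast
qed

lemma cont_autocorr: "cont g \<Longrightarrow> cont (autocorr g)"
  unfolding autocorr_def by (intro cont_conv cont_intros)

lemma conv_translate:
  assumes "cont k" "cont f" "s \<in> carrier A" "x \<in> carrier A"
  shows "conv k f (s \<cdot> x) = conv k (\<lambda>y. f (iv s \<cdot> y)) x"
proof -
  have "conv k f (s \<cdot> x) = (\<integral>y. k ((s \<cdot> x) \<cdot> (iv s \<cdot> y)) * f (iv s \<cdot> y) \<partial>\<mu>)"
    unfolding conv_def using assms
    by (intro integral_translate[symmetric, of "\<lambda>y. k ((s \<cdot> x) \<cdot> y) * f y"] cont_intros) auto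
  also have "\<dots> = conv k (\<lambda>y. f (iv s \<cdot> y)) x"
    unfolding conv_def
  proof (rule integral_cong_carrier)
    fix y assume "y \<in> carrier A"
    then have "(s \<cdot> x) \<cdot> (iv s \<cdot> y) = x \<cdot> y"
      using assms by (metis inv_mult_cancel(2) inv_closed m_assoc m_closed m_comm)
    then show "k ((s \<cdot> x) \<cdot> (iv s \<cdot> y)) * f (iv s \<cdot> y) = k (x \<cdot> y) * f (iv s \<cdot> y)" by simp
  qed
  finally show ?thesis .
qed

lemma conv_add_scaled:
  assumes "cont k" "cont f" "cont g" "x \<in> carrier A"
  shows "conv k (\<lambda>y. f y + c * g y) x = conv k f x + c * conv k g x"
proof -
  have "conv k (\<lambda>y. f y + c * g y) x = (\<integral>y. k (x \<cdot> y) * f y + c * (k (x \<cdot> y) * g y) \<partial>\<mu>)"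
    unfolding conv_def by (simp add: algebra_simps)
  also have "\<dots> = conv k f x + c * conv k g x"
    unfolding conv_def using conv_integrable[OF assms(1,2,4)] conv_integrable[OF assms(1,3,4)] by simp
  finally show ?thesis .
qed

lemma autocorr_one: "cont g \<Longrightarrow> autocorr g \<one>\<^bsub>A\<^esub> = of_real (sqnorm g)"
proof -
  assume "cont g"
  have "autocorr g \<one>\<^bsub>A\<^esub> = (\<integral>y. of_real ((cmod (g y))\<^sup>2) \<partial>\<mu>)"
    unfolding autocorr_def conv_def by (rule integral_cong_carrier) (simp add: complex_norm_square del: of_real_power)
  then show ?thesis unfolding sqnorm_def by (simp del: of_real_power)
qed

lemma autocorr_bound:
  assumes "cont g" "x \<in> carrier A"
  shows "cmod (autocorr g x) \<le> sqnorm g"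
proof -
  have "cmod (autocorr g x) \<le> (\<integral>y. cmod (g (x \<cdot> y) * cnj (g y)) \<partial>\<mu>)"
    unfolding autocorr_def conv_def by (rule integral_norm_bound)
  also have "\<dots> \<le> (\<integral>y. ((cmod (g (x \<cdot> y)))\<^sup>2 + (cmod (g y))\<^sup>2) / 2 \<partial>\<mu>)"
  proof (rule integral_mono)
    show "integrable \<mu> (\<lambda>y. cmod (g (x \<cdot> y) * cnj (g y)))"
      by (intro cont_integrable cont_intros assms)
    show "integrable \<mu> (\<lambda>y. ((cmod (g (x \<cdot> y)))\<^sup>2 + (cmod (g y))\<^sup>2) / 2)"
      by (intro integrable_divide Bochner_Integration.integrable_add integrable_cmod2 cont_intros assms)
    show "cmod (g (x \<cdot> y) * cnj (g y)) \<le> ((cmod (g (x \<cdot> y)))\<^sup>2 + (cmod (g y))\<^sup>2) / 2" for y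
      using sum_squares_bound[of "cmod (g (x \<cdot> y))" "cmod (g y)"] by (simp add: norm_mult)
  qed
  also have "\<dots> = (sqnorm (\<lambda>y. g (x \<cdot> y)) + sqnorm g) / 2"
    unfolding sqnorm_def
    using integrable_cmod2[OF cont_translate[OF assms]] integrable_cmod2[OF assms(1)] by simp
  also have "\<dots> = sqnorm g" using sqnorm_translate[OF assms] by simp
  finally show ?thesis .
qed

text \<open>Translating \<open>g\<close> moves its autocorrelation only through the two cross terms, which are themselves
  translates of the autocorrelation.\<close>

lemma autocorr_twist:
  assumes g: "cont g" and s: "s \<in> carrier A" and x: "x \<in> carrier A" and c: "cmod c = 1"
  shows "autocorr (\<lambda>y. g y + c * g (s \<cdot> y)) x
    = 2 * autocorr g x + c * autocorr g (s \<cdot> x) + cnj c * autocorr g (iv s \<cdot> x)"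
proof -
  have cc: "c * cnj c = 1" using c by (simp add: complex_norm_square[symmetric])
  let ?a = "\<lambda>y. g (x \<cdot> y) * cnj (g y)" and ?b = "\<lambda>y. g (x \<cdot> (s \<cdot> y)) * cnj (g (s \<cdot> y))"
  let ?d = "\<lambda>y. g ((s \<cdot> x) \<cdot> y) * cnj (g y)" and ?e = "\<lambda>y. g (x \<cdot> y) * cnj (g (s \<cdot> y))"
  have int: "integrable \<mu> ?a" "integrable \<mu> ?b" "integrable \<mu> ?d" "integrable \<mu> ?e"
  proof -
    have "cont (\<lambda>y. g (x \<cdot> (s \<cdot> y)))"
      by (rule cont_translate[where f="\<lambda>y. g (x \<cdot> y)"]) (intro cont_intros g x s)+
    then show "integrable \<mu> ?a" "integrable \<mu> ?b" "integrable \<mu> ?d" "integrable \<mu> ?e"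
      by (intro cont_integrable cont_intros g x s m_closed; assumption?)+
  qed
  have "autocorr (\<lambda>y. g y + c * g (s \<cdot> y)) x = (\<integral>y. ?a y + ?b y + c * ?d y + cnj c * ?e y \<partial>\<mu>)"
    unfolding autocorr_def conv_def
  proof (rule integral_cong_carrier)
    fix y assume y: "y \<in> carrier A"
    have "s \<cdot> (x \<cdot> y) = x \<cdot> (s \<cdot> y)" "(s \<cdot> x) \<cdot> y = x \<cdot> (s \<cdot> y)"
      using s x y m_lcomm m_assoc m_comm by metis+
    then have "(g (x \<cdot> y) + c * g (s \<cdot> (x \<cdot> y))) * cnj (g y + c * g (s \<cdot> y))
      = ?a y + (c * cnj c) * ?b y + c * ?d y + cnj c * ?e y"
      by (simp add: algebra_simps)
    then show "(g (x \<cdot> y) + c * g (s \<cdot> (x \<cdot> y))) * cnj (g y + c * g (s \<cdot> y))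
      = ?a y + ?b y + c * ?d y + cnj c * ?e y" by (simp add: cc)
  qed
  also have "\<dots> = (\<integral>y. ?a y \<partial>\<mu>) + (\<integral>y. ?b y \<partial>\<mu>) + c * (\<integral>y. ?d y \<partial>\<mu>) + cnj c * (\<integral>y. ?e y \<partial>\<mu>)"
    using int by simp
  finally have *: "autocorr (\<lambda>y. g y + c * g (s \<cdot> y)) x = \<dots>" .
  have "(\<integral>y. ?a y \<partial>\<mu>) = autocorr g x" "(\<integral>y. ?d y \<partial>\<mu>) = autocorr g (s \<cdot> x)"
    by (simp_all add: autocorr_def conv_def)
  moreover have "(\<integral>y. ?b y \<partial>\<mu>) = autocorr g x"
    unfolding autocorr_def conv_def
    by (rule integral_translate[of "\<lambda>y. g (x \<cdot> y) * cnj (g y)"]) (intro cont_intros g x s)+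
  moreover have "(\<integral>y. ?e y \<partial>\<mu>) = autocorr g (iv s \<cdot> x)"
    unfolding autocorr_def
    by (subst conv_translate) (use g s x in \<open>simp_all add: cont_intros conv_def\<close>)
  ultimately show ?thesis unfolding * by simp
qed

lemma autocorr_twist_sum:
  assumes g: "cont g" and s: "s \<in> carrier A" and x: "x \<in> carrier A" and c: "cmod c = 1"
  shows "autocorr (\<lambda>y. g y + c * g (s \<cdot> y)) x + autocorr (\<lambda>y. g y - c * g (s \<cdot> y)) x = 4 * autocorr g x"
  using autocorr_twist[OF g s x c] autocorr_twist[OF g s x, of "-c"] c by simp

text \<open>In terms of Fourier coefficients, this is the sum of \<open>|g^(\<psi>)|^4\<close>. For a fixed L2 norm it is largest
  when \<open>g\<close> is concentrated on a single character.\<close>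

definition energy :: "('b \<Rightarrow> complex) \<Rightarrow> real"
  where "energy g = sqnorm (autocorr g)"

lemma energy_cong: "(\<And>x. x \<in> carrier A \<Longrightarrow> f x = g x) \<Longrightarrow> energy f = energy g"
  unfolding energy_def autocorr_def conv_def
  by (intro sqnorm_cong integral_cong_carrier) simp

lemma energy_scale: "energy (\<lambda>x. of_real r * g x) = r ^ 4 * energy g"
proof -
  have "autocorr (\<lambda>x. of_real r * g x) = (\<lambda>x. of_real (r\<^sup>2) * autocorr g x)"
    unfolding autocorr_def conv_def
    by (rule ext, subst integral_mult_right_zero[symmetric]) (simp add: power2_eq_square algebra_simps)
  then show ?thesis unfolding energy_def by (simp only: sqnorm_scale norm_of_real) simp
qed

lemma energy_bound:
  assumes "cont g" "\<And>x. x \<in> carrier A \<Longrightarrow> cmod (g x) \<le> B"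
  shows "energy g \<le> B ^ 4"
proof -
  have "sqnorm g \<le> B\<^sup>2" by (rule sqnorm_bound[OF assms])
  then have "energy g \<le> (B\<^sup>2)\<^sup>2"
    unfolding energy_def using autocorr_bound[OF assms(1)]
    by (intro sqnorm_bound cont_autocorr assms) (meson order_trans)
  then show ?thesis by simp
qed

end

section \<open>Characters separate the points of a compact abelian group\<close>

context haar_group
begin

text \<open>Equality in the triangle inequality of L2 forces the two functions to be nonnegative multiples of
  one another, hence real multiples of their sum.\<close>

lemma parallel_if_triangle_equality:
  assumes P: "cont P" and Q: "cont Q"
    and tri: "sqrt (sqnorm P) + sqrt (sqnorm Q) \<le> sqrt (sqnorm (\<lambda>x. P x + Q x))"
    and pos: "sqnorm (\<lambda>x. P x + Q x) > 0"
  obtains \<beta> :: real where "\<And>x. x \<in> carrier A \<Longrightarrow> P x = of_real \<beta> * (P x + Q x)"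
proof -
  define p q where "p = sqrt (sqnorm P)" and "q = sqrt (sqnorm Q)"
  have pq: "p \<ge> 0" "q \<ge> 0" "p\<^sup>2 = sqnorm P" "q\<^sup>2 = sqnorm Q"
    by (simp_all add: p_def q_def sqnorm_nonneg)
  define R where "R = (\<integral>x. Re (P x * cnj (Q x)) \<partial>\<mu>)"
  have intR: "integrable \<mu> (\<lambda>x. Re (P x * cnj (Q x)))"
    by (intro integrable_Re cont_integrable cont_intros P Q)
  have ex: "sqnorm (\<lambda>x. of_real a * P x + of_real b * Q x) = a\<^sup>2 * p\<^sup>2 + b\<^sup>2 * q\<^sup>2 + 2 * a * b * R" for a b :: real
  proof -
    have "(cmod (of_real a * u + of_real b * v))\<^sup>2
        = a\<^sup>2 * (cmod u)\<^sup>2 + b\<^sup>2 * (cmod v)\<^sup>2 + 2 * a * b * Re (u * cnj v)" for u v :: complex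
      unfolding cmod_power2 by (simp add: power2_eq_square algebra_simps)
    then show ?thesis
      unfolding pq R_def unfolding sqnorm_def
      using integrable_cmod2[OF P] integrable_cmod2[OF Q] intR by simp
  qed
  have "p + q \<le> sqrt (p\<^sup>2 + q\<^sup>2 + 2 * R)"
    using tri ex[of 1 1] by (simp add: p_def q_def)
  then have "(p + q)\<^sup>2 \<le> (sqrt (p\<^sup>2 + q\<^sup>2 + 2 * R))\<^sup>2"
    using pq by (intro power_mono) auto
  also have "\<dots> = p\<^sup>2 + q\<^sup>2 + 2 * R" using ex[of 1 1] sqnorm_nonneg[of "\<lambda>x. P x + Q x"] by simp
  finally have "p * q \<le> R" by (simp add: power2_eq_square algebra_simps)
  then have "(p * q) * (p * q) \<le> (p * q) * R" using pq by (intro mult_left_mono) auto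
  then have "sqnorm (\<lambda>x. of_real q * P x + of_real (-p) * Q x) \<le> 0"
    unfolding ex by (simp add: power2_eq_square algebra_simps)
  then have "sqnorm (\<lambda>x. of_real q * P x + of_real (-p) * Q x) = 0"
    using sqnorm_nonneg by (metis order_antisym)
  moreover have "cont (\<lambda>x. of_real q * P x + of_real (-p) * Q x)" by (intro cont_intros P Q)
  ultimately have eq: "of_real q * P x = of_real p * Q x" if "x \<in> carrier A" for x
    using sqnorm_zero[of "\<lambda>x. of_real q * P x + of_real (-p) * Q x" x] that by simp
  have "p + q \<noteq> 0"
  proof
    assume "p + q = 0"
    then have pq0: "p = 0" "q = 0" using pq(1,2) by auto
    have "0 \<le> - 2 * R"
      using ex[of 1 "-1"] sqnorm_nonneg[of "\<lambda>x. of_real 1 * P x + of_real (-1) * Q x"] by (simp add: pq0)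
    moreover have "0 < 2 * R" using ex[of 1 1] pos by (simp add: pq0)
    ultimately show False by simp
  qed
  then have nz: "complex_of_real (p + q) \<noteq> 0" by (simp del: of_real_add)
  have "P x = of_real (p / (p + q)) * (P x + Q x)" if "x \<in> carrier A" for x
  proof -
    have "of_real (p + q) * P x = of_real p * (P x + Q x)"
      using eq[OF that] by (simp add: algebra_simps)
    then have "P x = (of_real p * (P x + Q x)) / of_real (p + q)"
      unfolding nonzero_eq_divide_eq[OF nz] by (subst mult.commute)
    then show ?thesis by (simp only: of_real_divide times_divide_eq_left)
  qed
  then show thesis using that by blast
qed

lemma integral_cmod_le_1:
  assumes "cont f" "sqnorm f \<le> 1"
  shows "(\<integral>y. cmod (f y) \<partial>\<mu>) \<le> 1"
proof -
  have "(\<integral>y. cmod (f y) \<partial>\<mu>) \<le> (\<integral>y. (1 + (cmod (f y))\<^sup>2) / 2 \<partial>\<mu>)"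
  proof (rule integral_mono)
    show "integrable \<mu> (\<lambda>y. cmod (f y))" by (intro cont_integrable cont_intros assms)
    show "integrable \<mu> (\<lambda>y. (1 + (cmod (f y))\<^sup>2) / 2)" using integrable_cmod2[OF assms(1)] by simp
    show "cmod (f y) \<le> (1 + (cmod (f y))\<^sup>2) / 2" for y
      using sum_squares_bound[of 1 "cmod (f y)"] by simp
  qed
  also have "\<dots> = (1 + sqnorm f) / 2"
    unfolding sqnorm_def using integrable_cmod2[OF assms(1)] by (simp add: prob_space)
  finally show ?thesis using assms(2) by simp
qed

definition l2_ball :: "('b \<Rightarrow> complex) set"
  where "l2_ball = {f. cont f \<and> sqnorm f \<le> 1}"

lemma conv_bound_l2_ball:
  assumes "cont k" "f \<in> l2_ball" "x \<in> carrier A" "\<And>z. z \<in> carrier A \<Longrightarrow> cmod (k z) \<le> B"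
  shows "cmod (conv k f x) \<le> B"
proof -
  have f: "cont f" "sqnorm f \<le> 1" using assms(2) by (auto simp: l2_ball_def)
  have "B \<ge> 0" using assms(3,4) norm_ge_zero order_trans by blast
  have "cmod (conv k f x) \<le> B * (\<integral>y. cmod (f y) \<partial>\<mu>)"
    by (rule conv_bound[OF assms(1) f(1) assms(3,4)])
  also have "\<dots> \<le> B * 1" by (intro mult_left_mono integral_cmod_le_1 f \<open>B \<ge> 0\<close>)
  finally show ?thesis by simp
qed

definition max_energy :: "('b \<Rightarrow> complex) \<Rightarrow> real"
  where "max_energy k = (SUP f\<in>l2_ball. energy (conv k f))"

lemma zero_in_l2_ball: "(\<lambda>x. 0) \<in> l2_ball"
  by (simp add: l2_ball_def sqnorm_def)

lemma bdd_above_energy: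
  assumes "cont k"
  shows "bdd_above ((\<lambda>f. energy (conv k f)) ` l2_ball)"
proof -
  obtain B where "\<And>x. x \<in> carrier A \<Longrightarrow> cmod (k x) \<le> B" using cont_bounded[OF assms] by blast
  then show ?thesis
    using assms by (intro bdd_aboveI2[of _ _ "B ^ 4"] energy_bound cont_conv conv_bound_l2_ball)
      (auto simp: l2_ball_def)
qed

lemma energy_le_max: "cont k \<Longrightarrow> f \<in> l2_ball \<Longrightarrow> energy (conv k f) \<le> max_energy k"
  unfolding max_energy_def by (rule cSUP_upper[OF _ bdd_above_energy])

text \<open>Energy is homogeneous of degree four, so the bound on the unit ball of L2 scales.\<close>

lemma energy_conv_le:
  assumes k: "cont k" and f: "cont f"
  shows "energy (conv k f) \<le> (sqnorm f)\<^sup>2 * max_energy k"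
proof (cases "sqnorm f = 0")
  case True
  have "conv k f x = 0" for x
    unfolding conv_def
    using integral_cong_carrier[of "\<lambda>y. k (x \<cdot> y) * f y" "\<lambda>y. 0"] sqnorm_zero[OF f True] by simp
  then have "energy (conv k f) = 0" using energy_scale[of 0 "\<lambda>x. 0"] by (simp add: energy_cong[of "conv k f" "\<lambda>x. 0"])
  then show ?thesis using True by simp
next
  case False
  define r where "r = sqrt (sqnorm f)"
  have r: "r > 0" "r\<^sup>2 = sqnorm f" using False sqnorm_nonneg[of f] by (auto simp: r_def)
  define h where "h = (\<lambda>y. of_real (1 / r) * f y)"
  have "sqnorm h = (1 / r)\<^sup>2 * r\<^sup>2" unfolding h_def by (subst sqnorm_scale) (use r in \<open>simp add: norm_divide\<close>)
  then have "sqnorm h \<le> 1" using r by (simp add: power_divide)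
  moreover have "cont h" unfolding h_def by (rule cont_algebra(3)[OF cont_const f])
  ultimately have h: "h \<in> l2_ball" by (simp add: l2_ball_def)
  have "conv k f x = of_real r * conv k h x" for x
    unfolding conv_def h_def integral_mult_right_zero[symmetric] using r by (simp add: algebra_simps)
  then have "energy (conv k f) = r ^ 4 * energy (conv k h)"
    using energy_scale[of r "conv k h"] energy_cong[of "conv k f" "\<lambda>x. of_real r * conv k h x"] by simp
  also have "\<dots> \<le> r ^ 4 * max_energy k"
    using r energy_le_max[OF k h] by (intro mult_left_mono) auto
  also have "r ^ 4 = (sqnorm f)\<^sup>2" using r(2) by (simp flip: r(2))
  finally show ?thesis .
qed

lemma max_energy_pos:
  assumes k: "cont k" and x0: "x0 \<in> carrier A" "k x0 \<noteq> 0"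
  shows "max_energy k > 0"
proof -
  have "sqnorm k > 0" using sqnorm_zero[OF k _ x0(1)] x0(2) sqnorm_nonneg[of k] by force
  let ?f = "\<lambda>y. cnj (k y)"
  have f: "cont ?f" by (intro cont_intros k)
  have "conv k ?f \<one>\<^bsub>A\<^esub> = of_real (sqnorm k)"
    using autocorr_one[OF k] unfolding autocorr_def .
  then have nz: "conv k ?f \<one>\<^bsub>A\<^esub> \<noteq> 0" using \<open>sqnorm k > 0\<close> by simp
  have c: "cont (conv k ?f)" by (rule cont_conv[OF k f])
  have "sqnorm (conv k ?f) \<noteq> 0" using sqnorm_zero[OF c _ one_closed] nz by blast
  then have "autocorr (conv k ?f) \<one>\<^bsub>A\<^esub> \<noteq> 0" using autocorr_one[OF c] by simp
  then have "energy (conv k ?f) \<noteq> 0"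
    using sqnorm_zero[OF cont_autocorr[OF c] _ one_closed] unfolding energy_def by blast
  then have "energy (conv k ?f) > 0"
    using sqnorm_nonneg[of "autocorr (conv k ?f)"] unfolding energy_def by linarith
  then have "0 < (sqnorm ?f)\<^sup>2 * max_energy k" using energy_conv_le[OF k f] by linarith
  then show ?thesis by (simp add: zero_less_mult_iff)
qed

text \<open>The functions \<open>conv k (f n)\<close> inherit the modulus of continuity of \<open>k\<close>. A diagonal subsequence that
  converges on a countable dense set therefore converges everywhere, to a continuous limit.\<close>

lemma conv_convergent_subsequence:
  fixes f :: "nat \<Rightarrow> 'b \<Rightarrow> complex"
  assumes k: "cont k" and f: "\<And>n. f n \<in> l2_ball"
  obtains r g where "strict_mono r" "cont g"
    "\<And>x. x \<in> carrier A \<Longrightarrow> (\<lambda>n. conv k (f (r n)) x) \<longlonglongrightarrow> g x"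
proof -
  have fc: "cont (f n)" and fs: "sqnorm (f n) \<le> 1" for n using f[of n] by (auto simp: l2_ball_def)
  obtain B where B: "\<And>x. x \<in> carrier A \<Longrightarrow> cmod (k x) \<le> B" using cont_bounded[OF k] by blast
  have equi: "\<exists>U. openin S U \<and> \<one>\<^bsub>A\<^esub> \<in> U \<and>
      (\<forall>t\<in>U. \<forall>x\<in>carrier A. \<forall>n. cmod (conv k (f n) (t \<cdot> x) - conv k (f n) x) \<le> e)" if "e > 0" for e
  proof -
    from uniformly_continuous[OF k that] obtain U where U: "openin S U" "\<one>\<^bsub>A\<^esub> \<in> U"
      "\<And>t x. t \<in> U \<Longrightarrow> x \<in> carrier A \<Longrightarrow> cmod (k (t \<cdot> x) - k x) < e" by blast
    have "cmod (conv k (f n) (t \<cdot> x) - conv k (f n) x) \<le> e" if t: "t \<in> U" and x: "x \<in> carrier A" for t x n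
    proof -
      have "t \<in> carrier A" using t U(1) openin_subset topspace_eq by blast
      then have "cmod (conv k (f n) (t \<cdot> x) - conv k (f n) x) \<le> e * (\<integral>y. cmod (f n y) \<partial>\<mu>)"
        using U(3)[OF t] by (intro conv_diff_bound k fc x) (auto intro: less_imp_le)
      also have "\<dots> \<le> e * 1" using \<open>e > 0\<close> by (intro mult_left_mono integral_cmod_le_1 fc fs) auto
      finally show ?thesis by simp
    qed
    then show ?thesis using U by blast
  qed
  obtain D where D: "countable D" "D \<subseteq> carrier A" "S closure_of D = carrier A"
    using second_countable_imp_separable_space[OF second_countable] topspace_eq by (auto simp: separable_space_def)
  have "D \<noteq> {}" using D(3) one_closed by auto
  define d where "d = from_nat_into D"
  have d: "range d = D" unfolding d_def by (rule range_from_nat_into[OF \<open>D \<noteq> {}\<close> D(1)])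
  then have dA: "d i \<in> carrier A" for i using D(2) by blast
  let ?K = "PiE UNIV (\<lambda>_ :: nat. cball (0 :: complex) B)"
  have "compact ?K"
    unfolding compactin_euclidean_iff[symmetric] euclidean_product_topology[symmetric] compactin_PiE by auto
  then have "seq_compact ?K" by (simp add: compact_eq_seq_compact_metric)
  moreover have "(\<lambda>i. conv k (f n) (d i)) \<in> ?K" for n
    using conv_bound_l2_ball[OF k f dA B] by auto
  ultimately obtain l r where r: "strict_mono r"
    and lim: "((\<lambda>n i. conv k (f n) (d i)) \<circ> r) \<longlonglongrightarrow> l"
    using seq_compactE[of ?K "\<lambda>n i. conv k (f n) (d i)"] by blast
  have lim: "(\<lambda>n i. conv k (f (r n)) (d i)) \<longlonglongrightarrow> l" using lim by (simp add: comp_def)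
  have limd: "(\<lambda>n. conv k (f (r n)) (d i)) \<longlonglongrightarrow> l i" for i
  proof (rule isCont_tendsto_compose[OF _ lim])
    have "continuous_on UNIV (\<lambda>x :: nat \<Rightarrow> complex. x i)" by (rule continuous_on_product_coordinates)
    then show "isCont (\<lambda>x :: nat \<Rightarrow> complex. x i) l"
      unfolding continuous_on_eq_continuous_at[OF open_UNIV] by (rule bspec) (rule UNIV_I)
  qed
  have "Cauchy (\<lambda>n. conv k (f (r n)) x)" if x: "x \<in> carrier A" for x
  proof (rule metric_CauchyI)
    fix e :: real assume "e > 0"
    then obtain U where U: "openin S U" "\<one>\<^bsub>A\<^esub> \<in> U"
      "\<And>t x n. t \<in> U \<Longrightarrow> x \<in> carrier A \<Longrightarrow> cmod (conv k (f n) (t \<cdot> x) - conv k (f n) x) \<le> e / 4"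
      using equi[of "e / 4"] by auto
    have "x \<in> S closure_of D" using D(3) x by simp
    then have "\<forall>V. x \<in> V \<and> openin S V \<longrightarrow> (\<exists>y. y \<in> D \<and> y \<in> V)"
      unfolding in_closure_of by (rule conjunct2)
    moreover have "x \<in> {y \<in> carrier A. y \<cdot> iv x \<in> U}" using U(2) x by simp
    ultimately have "\<exists>y. y \<in> D \<and> y \<in> {y \<in> carrier A. y \<cdot> iv x \<in> U}"
      using translate_nbhd[OF U(1) x] by (simp only: simp_thms)
    then obtain y where y: "y \<in> D" "y \<in> carrier A" "y \<cdot> iv x \<in> U" by auto
    then obtain i where i: "y = d i" unfolding d[symmetric] by auto
    have "(y \<cdot> iv x) \<cdot> x = y" using y(2) x by (simp add: m_assoc)
    then have close: "cmod (conv k (f n) (d i) - conv k (f n) x) \<le> e / 4" for n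
      using U(3)[OF y(3) x, of n] i by simp
    have "Cauchy (\<lambda>n. conv k (f (r n)) (d i))" using limd LIMSEQ_imp_Cauchy by blast
    then obtain N where N: "\<And>m n. m \<ge> N \<Longrightarrow> n \<ge> N \<Longrightarrow> dist (conv k (f (r m)) (d i)) (conv k (f (r n)) (d i)) < e / 4"
      using metric_CauchyD[of _ "e/4"] \<open>e > 0\<close> by (metis zero_less_divide_iff zero_less_numeral)
    have "dist (conv k (f (r m)) x) (conv k (f (r n)) x) < e" if "m \<ge> N" "n \<ge> N" for m n
    proof -
      have "dist (conv k (f (r m)) x) (conv k (f (r n)) x)
        \<le> dist (conv k (f (r m)) (d i)) (conv k (f (r m)) x) + dist (conv k (f (r m)) (d i)) (conv k (f (r n)) (d i))
          + dist (conv k (f (r n)) (d i)) (conv k (f (r n)) x)"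
        by metric
      then show ?thesis using close[of "r m"] close[of "r n"] N[OF that] \<open>e > 0\<close> by (simp add: dist_norm)
    qed
    then show "\<exists>M. \<forall>m\<ge>M. \<forall>n\<ge>M. dist (conv k (f (r m)) x) (conv k (f (r n)) x) < e" by blast
  qed
  then have "\<forall>x. \<exists>l. x \<in> carrier A \<longrightarrow> (\<lambda>n. conv k (f (r n)) x) \<longlonglongrightarrow> l"
    using Cauchy_convergent convergent_def by blast
  then obtain g where g: "\<And>x. x \<in> carrier A \<Longrightarrow> (\<lambda>n. conv k (f (r n)) x) \<longlonglongrightarrow> g x" by metis
  have "cont g"
  proof (rule continuous_if_uniformly)
    fix e :: real assume "e > 0"
    then obtain U where U: "openin S U" "\<one>\<^bsub>A\<^esub> \<in> U"
      "\<And>t x n. t \<in> U \<Longrightarrow> x \<in> carrier A \<Longrightarrow> cmod (conv k (f n) (t \<cdot> x) - conv k (f n) x) \<le> e"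
      using equi[of e] by auto
    have "cmod (g (t \<cdot> x) - g x) \<le> e" if "t \<in> U" "x \<in> carrier A" for t x
    proof -
      have "t \<in> carrier A" using that U(1) openin_subset topspace_eq by blast
      then have "(\<lambda>n. cmod (conv k (f (r n)) (t \<cdot> x) - conv k (f (r n)) x)) \<longlonglongrightarrow> cmod (g (t \<cdot> x) - g x)"
        using that by (intro tendsto_intros g) auto
      then show ?thesis by (rule LIMSEQ_le_const2) (use U(3) that in auto)
    qed
    then show "\<exists>U. openin S U \<and> \<one>\<^bsub>A\<^esub> \<in> U \<and> (\<forall>t\<in>U. \<forall>x\<in>carrier A. cmod (g (t \<cdot> x) - g x) \<le> e)"
      using U by blast
  qed
  then show thesis using that r g by blast
qed

lemma conv_tendsto:
  fixes g h :: "nat \<Rightarrow> 'b \<Rightarrow> complex"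
  assumes "\<And>n. cont (g n)" "cont g'" "\<And>n. cont (h n)" "cont h'"
    and "\<And>n x. x \<in> carrier A \<Longrightarrow> cmod (g n x) \<le> B" "\<And>n x. x \<in> carrier A \<Longrightarrow> cmod (h n x) \<le> B"
    and g: "\<And>x. x \<in> carrier A \<Longrightarrow> (\<lambda>n. g n x) \<longlonglongrightarrow> g' x"
    and h: "\<And>x. x \<in> carrier A \<Longrightarrow> (\<lambda>n. h n x) \<longlonglongrightarrow> h' x"
    and x: "x \<in> carrier A"
  shows "(\<lambda>n. conv (g n) (h n) x) \<longlonglongrightarrow> conv g' h' x"
  unfolding conv_def
proof (rule integral_dominated_convergence[where w="\<lambda>_. B * B"])
  show "(\<lambda>y. g' (x \<cdot> y) * h' y) \<in> borel_measurable \<mu>" "(\<lambda>y. g n (x \<cdot> y) * h n y) \<in> borel_measurable \<mu>" for n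
    by (intro cont_measurable cont_algebra(3)[OF cont_translate] assms)+
  show "AE y in \<mu>. (\<lambda>n. g n (x \<cdot> y) * h n y) \<longlonglongrightarrow> g' (x \<cdot> y) * h' y"
    using x by (intro AE_I2 tendsto_mult g h) (auto simp: space_haar)
  show "AE y in \<mu>. cmod (g n (x \<cdot> y) * h n y) \<le> B * B" for n
  proof (rule AE_I2)
    fix y assume "y \<in> space \<mu>"
    then have "y \<in> carrier A" by (simp add: space_haar)
    moreover have "B \<ge> 0" using assms(5)[OF x] norm_ge_zero order_trans by blast
    ultimately show "cmod (g n (x \<cdot> y) * h n y) \<le> B * B"
      using assms(5,6) x unfolding norm_mult by (intro mult_mono) auto
  qed
qed simp

lemma autocorr_tendsto:
  fixes g :: "nat \<Rightarrow> 'b \<Rightarrow> complex"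
  assumes "\<And>n. cont (g n)" "cont g'" "\<And>n x. x \<in> carrier A \<Longrightarrow> cmod (g n x) \<le> B"
    and "\<And>x. x \<in> carrier A \<Longrightarrow> (\<lambda>n. g n x) \<longlonglongrightarrow> g' x" "x \<in> carrier A"
  shows "(\<lambda>n. autocorr (g n) x) \<longlonglongrightarrow> autocorr g' x"
  unfolding autocorr_def
  by (rule conv_tendsto[where B=B]) (use assms in \<open>auto intro!: cont_cnj tendsto_cnj\<close>)

lemma sqnorm_tendsto:
  fixes g :: "nat \<Rightarrow> 'b \<Rightarrow> complex"
  assumes "\<And>n. cont (g n)" "cont g'" "\<And>n x. x \<in> carrier A \<Longrightarrow> cmod (g n x) \<le> B"
    and "\<And>x. x \<in> carrier A \<Longrightarrow> (\<lambda>n. g n x) \<longlonglongrightarrow> g' x"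
  shows "(\<lambda>n. sqnorm (g n)) \<longlonglongrightarrow> sqnorm g'"
  unfolding sqnorm_def
proof (rule integral_dominated_convergence[where w="\<lambda>_. B\<^sup>2"])
  show "AE y in \<mu>. (\<lambda>n. (cmod (g n y))\<^sup>2) \<longlonglongrightarrow> (cmod (g' y))\<^sup>2"
    using assms(4) by (intro AE_I2 tendsto_intros) (auto simp: space_haar)
  show "AE y in \<mu>. norm ((cmod (g n y))\<^sup>2) \<le> B\<^sup>2" for n
    using assms(3) by (intro AE_I2) (auto simp: space_haar intro!: power_mono)
qed (use assms in \<open>auto intro!: cont_measurable cont_cmod2\<close>)

lemma energy_tendsto:
  fixes g :: "nat \<Rightarrow> 'b \<Rightarrow> complex"
  assumes "\<And>n. cont (g n)" "cont g'" "\<And>n x. x \<in> carrier A \<Longrightarrow> cmod (g n x) \<le> B"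
    and "\<And>x. x \<in> carrier A \<Longrightarrow> (\<lambda>n. g n x) \<longlonglongrightarrow> g' x"
  shows "(\<lambda>n. energy (g n)) \<longlonglongrightarrow> energy g'"
  unfolding energy_def
proof (rule sqnorm_tendsto[where B="B\<^sup>2"])
  show "cmod (autocorr (g n) x) \<le> B\<^sup>2" if "x \<in> carrier A" for n x
    using autocorr_bound[OF assms(1) that] sqnorm_bound[OF assms(1,3)] order_trans by blast
  show "(\<lambda>n. autocorr (g n) x) \<longlonglongrightarrow> autocorr g' x" if "x \<in> carrier A" for x
    by (rule autocorr_tendsto[OF assms that])
qed (use assms in \<open>auto intro!: cont_autocorr\<close>)

text \<open>The functions \<open>g \<plusminus> c g(s \<cdot> _)\<close> are again convolutions with \<open>k\<close>, of \<open>f \<plusminus> c f(s\<^sup>-\<^sup>1 \<cdot> _)\<close>, whose squared norms add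
  up to at most four by the parallelogram law.\<close>

lemma energy_twisted_conv_le:
  assumes k: "cont k" and f: "f \<in> l2_ball" and s: "s \<in> carrier A" and c: "cmod c = 1"
  defines "g \<equiv> conv k f"
  shows "sqrt (energy (\<lambda>y. g y + c * g (s \<cdot> y))) + sqrt (energy (\<lambda>y. g y - c * g (s \<cdot> y)))
    \<le> 4 * sqrt (max_energy k)"
proof -
  have fc: "cont f" and fs: "sqnorm f \<le> 1" using f by (auto simp: l2_ball_def)
  let ?f' = "\<lambda>y. c * f (iv s \<cdot> y)"
  have ft: "cont (\<lambda>y. f (iv s \<cdot> y))" by (rule cont_translate[OF fc]) (use s in auto)
  have f': "cont ?f'" by (rule cont_algebra(3)[OF cont_const ft])
  have "sqnorm ?f' = sqnorm f" using sqnorm_translate[OF fc, of "iv s"] s c by (simp add: sqnorm_scale)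
  then have par: "sqnorm (\<lambda>y. f y + ?f' y) + sqnorm (\<lambda>y. f y - ?f' y) \<le> 4"
    using sqnorm_parallelogram[OF fc f'] fs by simp
  have "g y + c' * g (s \<cdot> y) = conv k (\<lambda>y. f y + c' * f (iv s \<cdot> y)) y" if "y \<in> carrier A" for y c'
    unfolding g_def using conv_add_scaled[OF k fc ft that] conv_translate[OF k fc s that] by simp
  from this[of _ c] this[of _ "-c"]
  have e: "energy (\<lambda>y. g y + c * g (s \<cdot> y)) = energy (conv k (\<lambda>y. f y + ?f' y))"
    "energy (\<lambda>y. g y - c * g (s \<cdot> y)) = energy (conv k (\<lambda>y. f y - ?f' y))"
    by (auto intro!: energy_cong)
  have M: "max_energy k \<ge> 0"
    using energy_le_max[OF k f] sqnorm_nonneg unfolding energy_def by (metis order_trans)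
  have sq: "sqrt (energy (conv k h)) \<le> sqnorm h * sqrt (max_energy k)" if "cont h" for h
    using real_sqrt_le_mono[OF energy_conv_le[OF k that]] sqnorm_nonneg[of h] by (simp add: real_sqrt_mult)
  have "sqrt (energy (\<lambda>y. g y + c * g (s \<cdot> y))) + sqrt (energy (\<lambda>y. g y - c * g (s \<cdot> y)))
    \<le> sqnorm (\<lambda>y. f y + ?f' y) * sqrt (max_energy k) + sqnorm (\<lambda>y. f y - ?f' y) * sqrt (max_energy k)"
    unfolding e by (intro add_mono sq cont_algebra fc f')
  also have "\<dots> = (sqnorm (\<lambda>y. f y + ?f' y) + sqnorm (\<lambda>y. f y - ?f' y)) * sqrt (max_energy k)"
    by (simp add: distrib_right)
  also have "\<dots> \<le> 4 * sqrt (max_energy k)" by (rule mult_right_mono[OF par]) (use M in simp)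
  finally show ?thesis .
qed

text \<open>Let \<open>g\<close> maximise the energy. The autocorrelations of \<open>g + c g(s \<cdot> _)\<close> and \<open>g - c g(s \<cdot> _)\<close> sum to four times that
  of \<open>g\<close>, while by maximality their norms sum to at most four times its norm. So the triangle
  inequality is sharp and both are real multiples of the autocorrelation of \<open>g\<close>.\<close>

lemma extremal_autocorr_eigen:
  assumes k: "cont k" and f: "\<And>n. f n \<in> l2_ball" and g: "cont g"
    and lim: "\<And>x. x \<in> carrier A \<Longrightarrow> (\<lambda>n. conv k (f n) x) \<longlonglongrightarrow> g x"
    and M: "energy g = max_energy k" "max_energy k > 0"
    and s: "s \<in> carrier A" and c: "cmod c = 1"
  obtains \<beta> :: real where "\<And>x. x \<in> carrier A \<Longrightarrow>
    c * autocorr g (s \<cdot> x) + cnj c * autocorr g (iv s \<cdot> x) = of_real \<beta> * autocorr g x"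
proof -
  obtain B where B: "\<And>x. x \<in> carrier A \<Longrightarrow> cmod (k x) \<le> B" using cont_bounded[OF k] by blast
  have fc: "cont (f n)" for n using f[of n] by (auto simp: l2_ball_def)
  have gc: "cont (conv k (f n))" for n by (rule cont_conv[OF k fc])
  have gB: "cmod (conv k (f n) x) \<le> B" if "x \<in> carrier A" for n x
    by (rule conv_bound_l2_ball[OF k f that B])
  let ?t = "\<lambda>g c y. g y + c * g (s \<cdot> y)"
  have tc: "cont (?t h c')" if "cont h" for h :: "'b \<Rightarrow> complex" and c'
    by (rule cont_algebra(1)[OF that cont_algebra(3)[OF cont_const cont_translate[OF that s]]])
  have en: "(\<lambda>n. energy (?t (conv k (f n)) c')) \<longlonglongrightarrow> energy (?t g c')" if c': "cmod c' = 1" for c'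
  proof (rule energy_tendsto[where B="2 * B"])
    show "cmod (?t (conv k (f n)) c' x) \<le> 2 * B" if "x \<in> carrier A" for n x
    proof -
      have "cmod (?t (conv k (f n)) c' x) \<le> cmod (conv k (f n) x) + cmod (conv k (f n) (s \<cdot> x))"
        using norm_triangle_ineq[of "conv k (f n) x" "c' * conv k (f n) (s \<cdot> x)"] c' by (simp add: norm_mult)
      then show ?thesis using gB[OF that, of n] gB[of "s \<cdot> x" n] s that by simp
    qed
    show "(\<lambda>n. ?t (conv k (f n)) c' x) \<longlonglongrightarrow> ?t g c' x" if "x \<in> carrier A" for x
      using that s by (intro tendsto_intros lim) auto
  qed (intro tc gc g)+
  have "(\<lambda>n. sqrt (energy (?t (conv k (f n)) c)) + sqrt (energy (?t (conv k (f n)) (- c))))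
      \<longlonglongrightarrow> sqrt (energy (?t g c)) + sqrt (energy (?t g (- c)))"
    using c by (intro tendsto_intros en) auto
  moreover have "sqrt (energy (?t (conv k (f n)) c)) + sqrt (energy (?t (conv k (f n)) (- c)))
      \<le> 4 * sqrt (max_energy k)" for n
    using energy_twisted_conv_le[OF k f s c, of n] by simp
  ultimately have le: "sqrt (energy (?t g c)) + sqrt (energy (?t g (- c))) \<le> 4 * sqrt (max_energy k)"
    by (intro LIMSEQ_le_const2) auto
  let ?P = "autocorr (?t g c)" and ?Q = "autocorr (?t g (- c))"
  have sum: "?P x + ?Q x = 4 * autocorr g x" if "x \<in> carrier A" for x
    using autocorr_twist_sum[OF g s that c] by simp
  then have "sqnorm (\<lambda>x. ?P x + ?Q x) = sqnorm (\<lambda>x. 4 * autocorr g x)" by (rule sqnorm_cong)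
  also have "\<dots> = 16 * max_energy k" using sqnorm_scale[of 4 "autocorr g"] M(1) by (simp add: energy_def)
  finally have sq: "sqnorm (\<lambda>x. ?P x + ?Q x) = 16 * max_energy k" .
  have "sqrt (16 * max_energy k) = 4 * sqrt (max_energy k)"
    unfolding real_sqrt_mult using real_sqrt_abs[of 4] by simp
  then have tri: "sqrt (sqnorm ?P) + sqrt (sqnorm ?Q) \<le> sqrt (sqnorm (\<lambda>x. ?P x + ?Q x))"
    using le unfolding sq energy_def by simp
  have pos: "sqnorm (\<lambda>x. ?P x + ?Q x) > 0" using sq M(2) by simp
  obtain \<beta> :: real where \<beta>: "\<And>x. x \<in> carrier A \<Longrightarrow> ?P x = of_real \<beta> * (?P x + ?Q x)"
    using parallel_if_triangle_equality[OF cont_autocorr[OF tc[OF g]] cont_autocorr[OF tc[OF g]] tri pos] by blast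
  have "c * autocorr g (s \<cdot> x) + cnj c * autocorr g (iv s \<cdot> x) = of_real (4 * \<beta> - 2) * autocorr g x"
    if x: "x \<in> carrier A" for x
  proof -
    have "2 * autocorr g x + c * autocorr g (s \<cdot> x) + cnj c * autocorr g (iv s \<cdot> x) = of_real \<beta> * (4 * autocorr g x)"
      using \<beta>[OF x] unfolding sum[OF x] unfolding autocorr_twist[OF g s x c] .
    then show ?thesis by (simp add: algebra_simps)
  qed
  then show thesis by (rule that)
qed

text \<open>The cases \<open>c = 1\<close> and \<open>c = \<i>\<close> together determine both translates, so translating the
  autocorrelation by \<open>s\<close> multiplies it by a scalar; that scalar is found by evaluating at the unit.\<close>

lemma extremal_autocorr_multiplicative:
  assumes k: "cont k" and f: "\<And>n. f n \<in> l2_ball" and g: "cont g"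
    and lim: "\<And>x. x \<in> carrier A \<Longrightarrow> (\<lambda>n. conv k (f n) x) \<longlonglongrightarrow> g x"
    and M: "energy g = max_energy k" "max_energy k > 0"
    and s: "s \<in> carrier A" and x: "x \<in> carrier A"
  shows "autocorr g (s \<cdot> x) * autocorr g \<one>\<^bsub>A\<^esub> = autocorr g s * autocorr g x"
proof -
  obtain b1 :: real where b1: "\<And>x. x \<in> carrier A \<Longrightarrow>
    1 * autocorr g (s \<cdot> x) + cnj 1 * autocorr g (iv s \<cdot> x) = of_real b1 * autocorr g x"
    using extremal_autocorr_eigen[OF k f g lim M s, of 1] by auto
  obtain b2 :: real where b2: "\<And>x. x \<in> carrier A \<Longrightarrow>
    \<i> * autocorr g (s \<cdot> x) + cnj \<i> * autocorr g (iv s \<cdot> x) = of_real b2 * autocorr g x"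
    using extremal_autocorr_eigen[OF k f g lim M s, of \<i>] by auto
  \<comment> \<open>Half of the first equation minus \<open>\<i> / 2\<close> times the second one isolates the translate by \<open>s\<close>.\<close>
  define \<gamma> where "\<gamma> = (of_real b1 - \<i> * of_real b2) / 2"
  have \<gamma>: "autocorr g (s \<cdot> x) = \<gamma> * autocorr g x" if "x \<in> carrier A" for x
  proof -
    have "2 * autocorr g (s \<cdot> x) = (autocorr g (s \<cdot> x) + autocorr g (iv s \<cdot> x))
        - \<i> * (\<i> * autocorr g (s \<cdot> x) - \<i> * autocorr g (iv s \<cdot> x))"
      by (simp add: algebra_simps)
    also have "\<dots> = 2 * (\<gamma> * autocorr g x)"
      using b1[OF that] b2[OF that] by (simp add: \<gamma>_def algebra_simps)
    finally show ?thesis by simp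
  qed
  show ?thesis using \<gamma>[OF x] \<gamma>[of "\<one>\<^bsub>A\<^esub>"] s by simp
qed

text \<open>In L2 the functions fixed by a unitary operator are orthogonal to the range of that operator minus
  the identity.\<close>

lemma integral_conj_difference_zero:
  assumes g: "cont g" and u: "cont u" and a: "a \<in> carrier A"
    and inv: "\<And>x. x \<in> carrier A \<Longrightarrow> g (a \<cdot> x) = g x"
  shows "(\<integral>x. g x * cnj (u (a \<cdot> x) - u x) \<partial>\<mu>) = 0"
proof -
  have "(\<integral>x. g x * cnj (u (a \<cdot> x)) \<partial>\<mu>) = (\<integral>x. g (a \<cdot> x) * cnj (u (a \<cdot> x)) \<partial>\<mu>)"
    by (rule integral_cong_carrier) (simp add: inv)
  also have "\<dots> = (\<integral>x. g x * cnj (u x) \<partial>\<mu>)"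
    by (rule integral_translate[of "\<lambda>x. g x * cnj (u x)", OF cont_algebra(3)[OF g cont_cnj[OF u]] a])
  finally have "(\<integral>x. g x * cnj (u (a \<cdot> x)) \<partial>\<mu>) = (\<integral>x. g x * cnj (u x) \<partial>\<mu>)" .
  moreover have "integrable \<mu> (\<lambda>x. g x * cnj (u (a \<cdot> x)))" "integrable \<mu> (\<lambda>x. g x * cnj (u x))"
    by (rule cont_integrable cont_algebra(3)[OF g cont_cnj[OF u]]
        cont_algebra(3)[OF g cont_cnj[OF cont_translate[OF u a]]])+
  ultimately show ?thesis by (simp add: right_diff_distrib)
qed

text \<open>The kernel \<open>k x = g0 (a x) - g0 x\<close> is chosen so that convolutions with it are differences
  \<open>u (a x) - u x\<close>. If the character \<open>\<psi>\<close> obtained from the energy maximiser \<open>g\<close> had \<open>\<psi> a = 1\<close>, then \<open>g\<close>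
  would be invariant under \<open>a\<close>, hence orthogonal to all these differences and, being a limit of
  them, to itself.\<close>

lemma character_separating_one:
  assumes a: "a \<in> carrier A" "a \<noteq> \<one>\<^bsub>A\<^esub>"
  obtains \<psi> where "cont \<psi>" "\<And>x y. x \<in> carrier A \<Longrightarrow> y \<in> carrier A \<Longrightarrow> \<psi> (x \<cdot> y) = \<psi> x * \<psi> y"
    "\<And>x. x \<in> carrier A \<Longrightarrow> cmod (\<psi> x) = 1" "\<psi> a \<noteq> 1"
proof -
  have normal: "normal_space S" using compact Hausdorff compact_Hausdorff_or_regular_imp_normal_space by blast
  have t1: "closedin S {x}" if "x \<in> carrier A" for x
    using Hausdorff that by (simp add: Hausdorff_imp_t1_space closedin_t1_singleton topspace_eq)
  \<comment> \<open>A function with different values at the unit and at \<open>a\<close> makes the kernel nonzero at the unit.\<close>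
  obtain u0 :: "'b \<Rightarrow> real" where u0: "continuous_map S (top_of_set {0..1}) u0" "u0 ` {\<one>\<^bsub>A\<^esub>} \<subseteq> {0}" "u0 ` {a} \<subseteq> {1}"
    using Urysohn_lemma[OF normal t1[OF one_closed] t1[OF a(1)], of 0 1] a(2) by (auto simp: disjnt_def)
  define g0 where "g0 = (\<lambda>x. complex_of_real (u0 x))"
  have "cont u0" using u0(1) by (simp add: continuous_map_in_subtopology)
  then have g0: "cont g0"
    unfolding g0_def continuous_map_euclidean_iff by (auto intro: tendsto_intros)
  define k where "k = (\<lambda>x. g0 (a \<cdot> x) - g0 x)"
  have k: "cont k" unfolding k_def by (rule cont_algebra(2)[OF cont_translate[OF g0 a(1)] g0])
  have "k \<one>\<^bsub>A\<^esub> \<noteq> 0" using u0 a(1) by (simp add: k_def g0_def)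
  then have Mpos: "max_energy k > 0" by (rule max_energy_pos[OF k one_closed])
  have "\<exists>f. f \<in> l2_ball \<and> max_energy k - 1 / Suc n < energy (conv k f)" for n
  proof -
    have "max_energy k - 1 / Suc n < (SUP f\<in>l2_ball. energy (conv k f))"
      unfolding max_energy_def[symmetric] by simp
    moreover have "l2_ball \<noteq> {}" using zero_in_l2_ball by blast
    ultimately show ?thesis using less_cSUP_iff[OF _ bdd_above_energy[OF k]] by blast
  qed
  then obtain f where f: "\<And>n. f n \<in> l2_ball" "\<And>n. max_energy k - 1 / Suc n < energy (conv k (f n))"
    by metis
  obtain r g where r: "strict_mono r" and g: "cont g"
    and lim: "\<And>x. x \<in> carrier A \<Longrightarrow> (\<lambda>n. conv k (f (r n)) x) \<longlonglongrightarrow> g x"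
    by (rule conv_convergent_subsequence[where f=f, OF k f(1)]) (rule that)
  obtain B where B: "\<And>x. x \<in> carrier A \<Longrightarrow> cmod (k x) \<le> B" using cont_bounded[OF k] by blast
  have fc: "cont (f n)" for n using f(1)[of n] by (auto simp: l2_ball_def)
  have gc: "cont (conv k (f n))" for n by (rule cont_conv[OF k fc])
  have gB: "cmod (conv k (f n) x) \<le> B" if "x \<in> carrier A" for n x
    by (rule conv_bound_l2_ball[OF k f(1) that B])
  have M: "energy g = max_energy k"
  proof (rule LIMSEQ_unique)
    show "(\<lambda>n. energy (conv k (f (r n)))) \<longlonglongrightarrow> energy g"
      by (rule energy_tendsto[OF gc g gB lim])
    have "(\<lambda>n. energy (conv k (f n))) \<longlonglongrightarrow> max_energy k"
    proof (rule real_tendsto_sandwich)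
      show "(\<lambda>n. max_energy k - 1 / Suc n) \<longlonglongrightarrow> max_energy k"
        using tendsto_diff[OF tendsto_const LIMSEQ_inverse_real_of_nat, of "max_energy k"]
        by (simp add: inverse_eq_divide)
      show "(\<lambda>n. max_energy k) \<longlonglongrightarrow> max_energy k" by simp
    qed (use f energy_le_max[OF k f(1)] in \<open>auto intro!: always_eventually less_imp_le\<close>)
    then show "(\<lambda>n. energy (conv k (f (r n)))) \<longlonglongrightarrow> max_energy k"
      using LIMSEQ_subseq_LIMSEQ[OF _ r] by (force simp: comp_def)
  qed
  have mult: "autocorr g (s \<cdot> x) * autocorr g \<one>\<^bsub>A\<^esub> = autocorr g s * autocorr g x"
    if "s \<in> carrier A" "x \<in> carrier A" for s x
    by (rule extremal_autocorr_multiplicative[OF k f(1) g lim M Mpos that])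
  define N where "N = sqnorm g"
  have "N \<noteq> 0"
  proof
    assume "N = 0"
    then have "autocorr g x = 0" if "x \<in> carrier A" for x
      using autocorr_bound[OF g that] by (simp add: N_def)
    then have "energy g = 0" unfolding energy_def using sqnorm_cong[of "autocorr g" "\<lambda>x. 0"] by (simp add: sqnorm_def)
    then show False using M Mpos by simp
  qed
  then have N: "N > 0" using sqnorm_nonneg[of g] by (simp add: N_def)
  have one: "autocorr g \<one>\<^bsub>A\<^esub> = of_real N" using autocorr_one[OF g] by (simp add: N_def)
  define \<psi> where "\<psi> = (\<lambda>x. autocorr g x * of_real (1 / N))"
  show thesis
  proof
    show "cont \<psi>" unfolding \<psi>_def by (intro cont_algebra cont_autocorr g cont_const)
    show hom: "\<psi> (x \<cdot> y) = \<psi> x * \<psi> y" if "x \<in> carrier A" "y \<in> carrier A" for x y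
      using mult[OF that] N unfolding one \<psi>_def by (simp add: field_simps)
    have le: "cmod (\<psi> x) \<le> 1" if "x \<in> carrier A" for x
      using autocorr_bound[OF g that] N unfolding \<psi>_def by (simp add: norm_divide N_def)
    show "cmod (\<psi> x) = 1" if "x \<in> carrier A" for x
    proof -
      have "\<psi> x * \<psi> (iv x) = 1" using hom[of x "iv x"] that N one by (simp add: \<psi>_def)
      then have "cmod (\<psi> x) * cmod (\<psi> (iv x)) = 1" by (metis norm_mult norm_one)
      then show ?thesis
        using le[OF that] le[of "iv x"] that
        by (smt (verit) inv_closed mult_left_le norm_ge_zero)
    qed
    show "\<psi> a \<noteq> 1"
    proof
      assume "\<psi> a = 1"
      then have aN: "autocorr g a = of_real N" using N by (simp add: \<psi>_def field_simps)
      \<comment> \<open>Equality in the Cauchy-Schwarz inequality: the translate of \<open>g\<close> by \<open>a\<close> is \<open>g\<close> itself.\<close>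
      have "sqnorm (\<lambda>y. g (a \<cdot> y) - g y) = 0"
      proof -
        have "(cmod (u - v))\<^sup>2 = (cmod u)\<^sup>2 + (cmod v)\<^sup>2 - 2 * Re (u * cnj v)" for u v :: complex
          unfolding cmod_power2 by (simp add: power2_eq_square algebra_simps)
        then have "sqnorm (\<lambda>y. g (a \<cdot> y) - g y)
          = (\<integral>y. (cmod (g (a \<cdot> y)))\<^sup>2 + (cmod (g y))\<^sup>2 - 2 * Re (g (a \<cdot> y) * cnj (g y)) \<partial>\<mu>)"
          unfolding sqnorm_def by simp
        also have "\<dots> = sqnorm (\<lambda>y. g (a \<cdot> y)) + N - 2 * Re (autocorr g a)"
        proof -
          have i: "integrable \<mu> (\<lambda>y. g (a \<cdot> y) * cnj (g y))"
            by (rule conv_integrable[OF g cont_cnj[OF g] a(1)])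
          have "(\<integral>y. Re (g (a \<cdot> y) * cnj (g y)) \<partial>\<mu>) = Re (autocorr g a)"
            unfolding autocorr_def conv_def by (rule integral_Re[OF i])
          then show ?thesis
            unfolding N_def sqnorm_def
            using i integrable_cmod2[OF cont_translate[OF g a(1)]] integrable_cmod2[OF g] integrable_Re[OF i]
            by (simp del: Re_complex_div_eq_0 times_complex.sel)
        qed
        also have "\<dots> = 0" using sqnorm_translate[OF g a(1)] aN by (simp add: N_def)
        finally show ?thesis .
      qed
      moreover have "cont (\<lambda>y. g (a \<cdot> y) - g y)" by (rule cont_algebra(2)[OF cont_translate[OF g a(1)] g])
      ultimately have inv: "g (a \<cdot> y) = g y" if "y \<in> carrier A" for y
        using sqnorm_zero[of "\<lambda>y. g (a \<cdot> y) - g y" y] that by simp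
      have diff: "conv k (f n) x = conv g0 (f n) (a \<cdot> x) - conv g0 (f n) x" if "x \<in> carrier A" for n x
      proof -
        have "conv k (f n) x = (\<integral>y. g0 ((a \<cdot> x) \<cdot> y) * f n y - g0 (x \<cdot> y) * f n y \<partial>\<mu>)"
          unfolding conv_def k_def
          by (rule integral_cong_carrier) (use a that in \<open>simp add: m_assoc algebra_simps\<close>)
        also have "\<dots> = conv g0 (f n) (a \<cdot> x) - conv g0 (f n) x"
          unfolding conv_def using a that
          by (intro Bochner_Integration.integral_diff conv_integrable g0 fc) auto
        finally show ?thesis .
      qed
      have zero: "(\<integral>x. g x * cnj (conv k (f n) x) \<partial>\<mu>) = 0" for n
        using integral_conj_difference_zero[OF g cont_conv[OF g0 fc] a(1) inv, of n]
          integral_cong_carrier[of "\<lambda>x. g x * cnj (conv k (f n) x)"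
            "\<lambda>x. g x * cnj (conv g0 (f n) (a \<cdot> x) - conv g0 (f n) x)"] diff by simp
      \<comment> \<open>Passing to the limit in \<open>zero\<close> turns the inner product into the squared norm of \<open>g\<close>.\<close>
      obtain B' where B': "\<And>x. x \<in> carrier A \<Longrightarrow> cmod (g x) \<le> B'" using cont_bounded[OF g] by blast
      define B2 where "B2 = max B B'"
      have "(\<lambda>n. conv g (\<lambda>y. cnj (conv k (f (r n)) y)) \<one>\<^bsub>A\<^esub>) \<longlonglongrightarrow> conv g (\<lambda>y. cnj (g y)) \<one>\<^bsub>A\<^esub>"
        by (rule conv_tendsto[where B=B2])
          (use g gc gB lim B' in \<open>auto simp: B2_def le_max_iff_disj intro!: cont_cnj tendsto_cnj\<close>)
      moreover have "conv g (\<lambda>y. cnj (conv k (f n) y)) \<one>\<^bsub>A\<^esub> = 0" for n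
      proof -
        have "conv g (\<lambda>y. cnj (conv k (f n) y)) \<one>\<^bsub>A\<^esub> = (\<integral>x. g x * cnj (conv k (f n) x) \<partial>\<mu>)"
          unfolding conv_def[of g] by (rule integral_cong_carrier) simp
        then show ?thesis using zero by simp
      qed
      ultimately have "(\<lambda>n. 0) \<longlonglongrightarrow> autocorr g \<one>\<^bsub>A\<^esub>" unfolding autocorr_def by simp
      then have "autocorr g \<one>\<^bsub>A\<^esub> = 0" using LIMSEQ_unique tendsto_const by metis
      then show False using one N by simp
    qed
  qed
qed

end

text \<open>The part of the Peter-Weyl theorem (for abelian groups) that is needed.\<close>

theorem (in compact_abelian_group) characters_separate_points:
  assumes x: "x \<in> carrier A" and y: "y \<in> carrier A" and "x \<noteq> y"
  obtains \<psi> where "continuous_map S euclidean \<psi>"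
    "\<And>x y. x \<in> carrier A \<Longrightarrow> y \<in> carrier A \<Longrightarrow> \<psi> (x \<otimes>\<^bsub>A\<^esub> y) = \<psi> x * \<psi> y"
    "\<And>x. x \<in> carrier A \<Longrightarrow> cmod (\<psi> x) = 1" "\<psi> x \<noteq> \<psi> y"
proof -
  obtain \<mu> where "haar_group A S \<mu>" using haar_measure_exists by blast
  then interpret haar_group A S \<mu> .
  have xy: "x \<otimes>\<^bsub>A\<^esub> inv\<^bsub>A\<^esub> y \<in> carrier A" "x \<otimes>\<^bsub>A\<^esub> inv\<^bsub>A\<^esub> y \<noteq> \<one>\<^bsub>A\<^esub>"
    using x y \<open>x \<noteq> y\<close> inv_equality inv_inv by fastforce+
  obtain \<psi> where \<psi>: "continuous_map S euclidean \<psi>"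
    "\<And>x y. x \<in> carrier A \<Longrightarrow> y \<in> carrier A \<Longrightarrow> \<psi> (x \<otimes>\<^bsub>A\<^esub> y) = \<psi> x * \<psi> y"
    "\<And>x. x \<in> carrier A \<Longrightarrow> cmod (\<psi> x) = 1" "\<psi> (x \<otimes>\<^bsub>A\<^esub> inv\<^bsub>A\<^esub> y) \<noteq> 1"
    using character_separating_one[OF xy] by blast
  have "\<psi> x = \<psi> (x \<otimes>\<^bsub>A\<^esub> inv\<^bsub>A\<^esub> y) * \<psi> y"
    using \<psi>(2)[of "x \<otimes>\<^bsub>A\<^esub> inv\<^bsub>A\<^esub> y" y] x y xy by (simp add: m_assoc)
  moreover have "\<psi> y \<noteq> 0" using \<psi>(3)[OF y] by auto
  ultimately have "\<psi> x \<noteq> \<psi> y" using \<psi>(4) by simp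
  then show thesis using that \<psi> by blast
qed

section \<open>Coordinate faces and alternating products\<close>

lemma finite_vertices [simp]: "finite (vertices n)"
  unfolding vertices_def by (intro finite_PiE) auto

lemma vertices_0: "vertices 0 = {\<lambda>_. undefined}"
  by (simp add: vertices_def)

lemma vertices_D: "v \<in> vertices n \<Longrightarrow> i < n \<Longrightarrow> v i = 0 \<or> v i = 1"
  unfolding vertices_def by (auto dest: PiE_mem)

lemma vertices_eqI: "v \<in> vertices n \<Longrightarrow> w \<in> vertices n \<Longrightarrow> (\<And>i. i < n \<Longrightarrow> v i = w i) \<Longrightarrow> v = w"
  unfolding vertices_def by (rule PiE_ext) auto

text \<open>The face \<open>v j = b\<close> of the cube of dimension \<open>n + 1\<close>, parametrised by the cube of dimension \<open>n\<close>. The old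
  value at \<open>j\<close> is moved to the new last coordinate instead of shifting all coordinates after \<open>j\<close>; for
  \<open>j = n\<close> it simply appends \<open>b\<close>.\<close>

definition insert_coord :: "nat \<Rightarrow> nat \<Rightarrow> int \<Rightarrow> (nat \<Rightarrow> int) \<Rightarrow> nat \<Rightarrow> int"
  where "insert_coord n j b w = (\<lambda>i\<in>{..<Suc n}. if i = j then b else if i = n then w j else w i)"

lemma insert_coord_vertices:
  assumes "j \<le> n" "b = 0 \<or> b = 1" "w \<in> vertices n"
  shows "insert_coord n j b w \<in> vertices (Suc n)"
  using assms vertices_D[OF assms(3)] unfolding vertices_def insert_coord_def
  by (auto simp: PiE_iff extensional_def)

lemma insert_coord_affine:
  assumes "j \<le> n" "b = 0 \<or> b = 1"
  shows "insert_coord n j b \<in> affine_maps n (Suc n)"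
proof -
  \<comment> \<open>Row \<open>i\<close> of the matrix selects the source coordinate of \<open>i\<close>; row \<open>j\<close> is zero.\<close>
  define a :: "nat \<Rightarrow> nat \<Rightarrow> int" where
    "a i m = (if i \<noteq> j \<and> (if i = n then m = j else m = i) then 1 else 0)" for i m
  define b' where "b' i = (if i = j then b else 0)" for i
  have "insert_coord n j b v i = b' i + (\<Sum>m<n. a i m * v m)" if "i < Suc n" for v i
  proof (cases "i = j")
    case True
    then show ?thesis using that by (simp add: insert_coord_def a_def b'_def)
  next
    case False
    define l where "l = (if i = n then j else i)"
    have "l < n" using False that assms(1) by (auto simp: l_def)
    have "(\<Sum>m<n. a i m * v m) = (\<Sum>m<n. if m = l then v m else 0)"
      using False by (intro sum.cong) (auto simp: a_def l_def)
    also have "\<dots> = v l" using \<open>l < n\<close> by simp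
    finally show ?thesis using False that by (simp add: insert_coord_def b'_def l_def)
  qed
  then show ?thesis
    unfolding affine_maps_def using insert_coord_vertices[OF assms] by blast
qed

lemma insert_coord_inj:
  assumes "j \<le> n"
  shows "inj_on (insert_coord n j b) (vertices n)"
proof (rule inj_onI)
  fix v w assume v: "v \<in> vertices n" and w: "w \<in> vertices n" and eq: "insert_coord n j b v = insert_coord n j b w"
  show "v = w"
  proof (rule vertices_eqI[OF v w])
    fix i assume "i < n"
    show "v i = w i"
      using fun_cong[OF eq, of "if i = j then n else i"] \<open>i < n\<close> assms
      by (auto simp: insert_coord_def split: if_splits)
  qed
qed

lemma vertices_Suc_split:
  assumes "j \<le> n"
  shows "vertices (Suc n) = insert_coord n j 1 ` vertices n \<union> insert_coord n j 0 ` vertices n"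
proof (intro equalityI subsetI)
  fix v assume v: "v \<in> vertices (Suc n)"
  define w where "w = (\<lambda>i\<in>{..<n}. if i = j then v n else v i)"
  have w: "w \<in> vertices n"
    using vertices_D[OF v] unfolding w_def vertices_def by (auto simp: PiE_iff)
  have "v = insert_coord n j (v j) w"
  proof (rule vertices_eqI[OF v])
    show "insert_coord n j (v j) w \<in> vertices (Suc n)"
      using insert_coord_vertices[OF assms vertices_D[OF v] w] assms by simp
    show "v i = insert_coord n j (v j) w i" if "i < Suc n" for i
      using that assms by (auto simp: insert_coord_def w_def)
  qed
  moreover have "v j = 0 \<or> v j = 1" using vertices_D[OF v] assms by simp
  ultimately show "v \<in> insert_coord n j 1 ` vertices n \<union> insert_coord n j 0 ` vertices n"
    using w by (metis UnCI imageI)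
qed (use insert_coord_vertices[OF assms] in auto)

lemma insert_coord_at [simp]: "j \<le> n \<Longrightarrow> insert_coord n j b w j = b"
  by (simp add: insert_coord_def)

lemma sum_insert_coord:
  assumes "j \<le> n"
  shows "(\<Sum>i<Suc n. insert_coord n j b w i) = b + (\<Sum>i<n. w i)"
proof (cases "j = n")
  case True
  have "(\<Sum>i<n. insert_coord n j b w i) = (\<Sum>i<n. w i)"
    using True by (intro sum.cong) (auto simp: insert_coord_def)
  then show ?thesis using True by simp
next
  case False
  then have j: "j \<in> {..<n}" using assms by simp
  have "(\<Sum>i<n. insert_coord n j b w i) = b + (\<Sum>i\<in>{..<n} - {j}. w i)"
    by (subst sum.remove[OF _ j]) (use assms in \<open>auto simp: insert_coord_def intro!: sum.cong\<close>)
  moreover have "(\<Sum>i<n. w i) = w j + (\<Sum>i\<in>{..<n} - {j}. w i)"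
    by (rule sum.remove[OF _ j]) simp
  moreover have "insert_coord n j b w n = w j" using False by (simp add: insert_coord_def)
  ultimately show ?thesis by simp
qed

text \<open>For \<open>f\<close> of modulus one this is the multiplicative analogue of the alternating sum over a cube:
  complex conjugation is inversion, and the top vertex occurs with exponent one.\<close>

definition alternating_prod :: "nat \<Rightarrow> ('a \<Rightarrow> complex) \<Rightarrow> ((nat \<Rightarrow> int) \<Rightarrow> 'a) \<Rightarrow> complex"
  where "alternating_prod n f c =
    (\<Prod>v\<in>vertices n. if even (int n - (\<Sum>i<n. v i)) then f (c v) else cnj (f (c v)))"

lemma alternating_prod_0: "alternating_prod 0 f c = f (c (\<lambda>_. undefined))"
  by (simp add: alternating_prod_def vertices_0)

lemma alternating_prod_cong:
  assumes "\<And>v. v \<in> vertices n \<Longrightarrow> f (c v) = g (d v)"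
  shows "alternating_prod n f c = alternating_prod n g d"
  unfolding alternating_prod_def using assms by (intro prod.cong) auto

lemma alternating_prod_split:
  assumes "j \<le> n"
  shows "alternating_prod (Suc n) f c =
    alternating_prod n f (\<lambda>w. c (insert_coord n j 1 w)) * cnj (alternating_prod n f (\<lambda>w. c (insert_coord n j 0 w)))"
proof -
  let ?t = "\<lambda>n v. if even (int n - (\<Sum>i<n. v i)) then f (c v) else cnj (f (c v))"
  have disj: "insert_coord n j 1 ` vertices n \<inter> insert_coord n j 0 ` vertices n = {}"
  proof -
    have "insert_coord n j 1 v \<noteq> insert_coord n j 0 w" for v w
      using insert_coord_at[OF assms] by (metis zero_neq_one)
    then show ?thesis by auto
  qed
  have "alternating_prod (Suc n) f c
      = (\<Prod>v\<in>insert_coord n j 1 ` vertices n. ?t (Suc n) v) * (\<Prod>v\<in>insert_coord n j 0 ` vertices n. ?t (Suc n) v)"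
    unfolding alternating_prod_def vertices_Suc_split[OF assms]
    by (rule prod.union_disjoint) (use disj in auto)
  also have "(\<Prod>v\<in>insert_coord n j 1 ` vertices n. ?t (Suc n) v) = alternating_prod n f (\<lambda>w. c (insert_coord n j 1 w))"
    unfolding alternating_prod_def prod.reindex[OF insert_coord_inj[OF assms]] comp_def sum_insert_coord[OF assms]
    by simp
  also have "(\<Prod>v\<in>insert_coord n j 0 ` vertices n. ?t (Suc n) v) = cnj (alternating_prod n f (\<lambda>w. c (insert_coord n j 0 w)))"
    unfolding alternating_prod_def prod.reindex[OF insert_coord_inj[OF assms]] comp_def sum_insert_coord[OF assms] cnj_prod
    by (intro prod.cong) auto
  finally show ?thesis .
qed

lemma alternating_prod_mult:
  "alternating_prod n (\<lambda>x. f x * g x) c = alternating_prod n f c * alternating_prod n g c"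
  unfolding alternating_prod_def by (simp add: prod.distrib[symmetric] if_distrib cong: if_cong)

lemma alternating_prod_cnj: "alternating_prod n (\<lambda>x. cnj (f x)) c = cnj (alternating_prod n f c)"
  unfolding alternating_prod_def cnj_prod by (intro prod.cong) auto

lemma alternating_prod_one: "(\<And>v. v \<in> vertices n \<Longrightarrow> f (c v) = 1) \<Longrightarrow> alternating_prod n f c = 1"
  unfolding alternating_prod_def by (intro prod.neutral) auto

lemma norm_alternating_prod:
  "(\<And>v. v \<in> vertices n \<Longrightarrow> cmod (f (c v)) = 1) \<Longrightarrow> cmod (alternating_prod n f c) = 1"
  unfolding alternating_prod_def prod_norm[symmetric] by (intro prod.neutral) auto

lemma drop_last_coord_affine: "(\<lambda>v. restrict v {..<n}) \<in> affine_maps (Suc n) n"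
proof -
  have "(\<lambda>v. restrict v {..<n}) \<in> vertices (Suc n) \<rightarrow> vertices n"
    using vertices_D by (fastforce simp: vertices_def PiE_iff)
  moreover have "restrict v {..<n} j = 0 + (\<Sum>i<Suc n. of_bool (i = j) * v i)" if "j < n" for v :: "nat \<Rightarrow> int" and j
  proof -
    have "(\<Sum>i<Suc n. of_bool (i = j) * v i) = (\<Sum>i<Suc n. if i = j then v i else 0)"
      by (intro sum.cong) auto
    then show ?thesis using that by simp
  qed
  ultimately show ?thesis
    unfolding affine_maps_def
    by (intro CollectI conjI exI[of _ "\<lambda>j i. of_bool (i = j)"] exI[of _ "\<lambda>_. 0"]) simp_all
qed

lemma insert_last_coord: "w \<in> vertices n \<Longrightarrow> restrict (insert_coord n n b w) {..<n} = w"
  unfolding vertices_def insert_coord_def by (auto simp: fun_eq_iff PiE_iff extensional_def)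

lemma coord_face_codim_1:
  assumes "j < n" "b = 0 \<or> b = 1"
  shows "{v \<in> vertices n. v j = b} \<in> codim_faces n 1"
  unfolding codim_faces_def
  by (rule CollectI, rule exI[of _ "{j}"], rule exI[of _ "\<lambda>_. b"]) (use assms in auto)

section \<open>Abelian groups of translations and iterated derivatives\<close>

locale nilspace_action = compact_nilspace T C + G: comm_group G
  for T :: "'a topology" and C :: "'a cubes" and G :: "('g, 'r) monoid_scheme" and \<phi> :: "'g \<Rightarrow> 'a \<Rightarrow> 'a" +
  assumes action_hom: "\<phi> \<in> hom G (Theta T C)"
begin

lemma action_translation: "g \<in> carrier G \<Longrightarrow> \<phi> g \<in> nilspace_translations (topspace T) C"
  and action_homeomorphic: "g \<in> carrier G \<Longrightarrow> homeomorphic_map T T (\<phi> g)"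
  using action_hom unfolding hom_def Theta_def by auto

lemma action_Bij: "g \<in> carrier G \<Longrightarrow> \<phi> g \<in> Bij (topspace T)"
  using action_translation unfolding nilspace_translations_def by auto

lemma action_closed: "g \<in> carrier G \<Longrightarrow> x \<in> topspace T \<Longrightarrow> \<phi> g x \<in> topspace T"
  using action_Bij unfolding Bij_def bij_betw_def by auto

lemma action_mult:
  assumes "g \<in> carrier G" "h \<in> carrier G" "x \<in> topspace T"
  shows "\<phi> (g \<otimes>\<^bsub>G\<^esub> h) x = \<phi> g (\<phi> h x)"
proof -
  have "\<phi> (g \<otimes>\<^bsub>G\<^esub> h) = compose (topspace T) (\<phi> g) (\<phi> h)"
    using hom_mult[OF action_hom assms(1,2)] action_Bij assms(1,2) by (simp add: Theta_def BijGroup_def)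
  then show ?thesis using assms(3) by (simp add: compose_eq)
qed

lemma action_one: "x \<in> topspace T \<Longrightarrow> \<phi> \<one>\<^bsub>G\<^esub> x = x"
proof -
  assume x: "x \<in> topspace T"
  have "\<phi> \<one>\<^bsub>G\<^esub> (\<phi> \<one>\<^bsub>G\<^esub> x) = \<phi> \<one>\<^bsub>G\<^esub> x" using action_mult[of "\<one>\<^bsub>G\<^esub>" "\<one>\<^bsub>G\<^esub>" x] x by simp
  moreover have "inj_on (\<phi> \<one>\<^bsub>G\<^esub>) (topspace T)" using action_Bij[of "\<one>\<^bsub>G\<^esub>"] by (auto simp: Bij_def bij_betw_def)
  ultimately show ?thesis using x action_closed[of "\<one>\<^bsub>G\<^esub>" x] by (auto dest: inj_onD)
qed

lemma action_commute:
  "g \<in> carrier G \<Longrightarrow> h \<in> carrier G \<Longrightarrow> x \<in> topspace T \<Longrightarrow> \<phi> g (\<phi> h x) = \<phi> h (\<phi> g x)"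
  using action_mult[of g h x] action_mult[of h g x] G.m_comm[of g h] by simp

lemma cube_in_space: "c \<in> C n \<Longrightarrow> v \<in> vertices n \<Longrightarrow> c v \<in> topspace T"
  by (rule PiE_mem[OF subsetD[OF cubes_subset]])

lemma translated_face_cube:
  assumes "c \<in> C n" "g \<in> carrier G" "j < n" "b = 0 \<or> b = 1"
  shows "apply_on_face n {v \<in> vertices n. v j = b} (\<phi> g) c \<in> C n"
proof -
  have "\<forall>n. \<forall>c\<in>C n. \<forall>F\<in>codim_faces n 1. apply_on_face n F (\<phi> g) c \<in> C n"
    using action_translation[OF assms(2)] unfolding nilspace_translations_def by simp
  then show ?thesis using assms(1) coord_face_codim_1[OF assms(3,4)] by simp
qed

lemma translated_cube:
  assumes "c \<in> C n" "g \<in> carrier G"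
  shows "(\<lambda>v\<in>vertices n. \<phi> g (c v)) \<in> C n"
proof (cases n)
  case 0
  then show ?thesis using assms action_closed cube_in_space by (auto simp: cubes_0)
next
  case (Suc m)
  let ?F = "\<lambda>b. {v \<in> vertices n. v 0 = b}"
  have "apply_on_face n (?F 1) (\<phi> g) (apply_on_face n (?F 0) (\<phi> g) c) \<in> C n"
    by (intro translated_face_cube assms) (use Suc in auto)
  moreover have "apply_on_face n (?F 1) (\<phi> g) (apply_on_face n (?F 0) (\<phi> g) c) = (\<lambda>v\<in>vertices n. \<phi> g (c v))"
    unfolding apply_on_face_def
    by (rule restrict_ext) (use vertices_D[of _ n 0] Suc in auto)
  ultimately show ?thesis by simp
qed

lemma face_cube:
  assumes "c \<in> C (Suc n)" "j \<le> n" "b = 0 \<or> b = 1"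
  shows "compose (vertices n) c (insert_coord n j b) \<in> C n"
  by (rule composition[OF assms(1) insert_coord_affine[OF assms(2,3)]])

text \<open>The vertices of the cube are the points \<open>\<Prod> g\<^sub>i\<^bsup>v i\<^esup> x\<close>. It is built one dimension at a time: extend
  the cube constantly in a new direction and translate the new upper face. The extra translation by \<open>h\<close>
  is what makes the induction go through.\<close>

lemma iterated_derivative_on_cube:
  assumes "x \<in> topspace T" "set gs \<subseteq> carrier G"
  shows "\<exists>c\<in>C (length gs). \<forall>h\<in>carrier G. \<forall>f.
    foldr (mult_derivative \<phi>) gs f (\<phi> h x) = alternating_prod (length gs) f (\<lambda>v. \<phi> h (c v))"
  using assms(2)
proof (induction gs)
  case Nil
  have "(\<lambda>v\<in>vertices 0. x) \<in> C 0" using assms(1) by (simp add: cubes_0)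
  then show ?case by (intro bexI[of _ "\<lambda>v\<in>vertices 0. x"]) (auto simp: alternating_prod_0 vertices_0)
next
  case (Cons g gs)
  define n where "n = length gs"
  obtain c where c: "c \<in> C n"
    "\<And>h f. h \<in> carrier G \<Longrightarrow> foldr (mult_derivative \<phi>) gs f (\<phi> h x) = alternating_prod n f (\<lambda>v. \<phi> h (c v))"
    using Cons unfolding n_def by auto
  have g: "g \<in> carrier G" using Cons.prems by simp
  define c0 where "c0 = compose (vertices (Suc n)) c (\<lambda>v. restrict v {..<n})"
  define c' where "c' = apply_on_face (Suc n) {v \<in> vertices (Suc n). v n = 1} (\<phi> g) c0"
  have "c0 \<in> C (Suc n)" unfolding c0_def by (rule composition[OF c(1) drop_last_coord_affine])
  then have c': "c' \<in> C (Suc n)" unfolding c'_def by (intro translated_face_cube g) auto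
  have ins: "c' (insert_coord n n 1 w) = \<phi> g (c w)" "c' (insert_coord n n 0 w) = c w" if "w \<in> vertices n" for w
    using that insert_coord_vertices[of n n 1 w] insert_coord_vertices[of n n 0 w]
    by (simp_all add: c'_def c0_def apply_on_face_def compose_def insert_last_coord)
  have "foldr (mult_derivative \<phi>) (g # gs) f (\<phi> h x) = alternating_prod (Suc n) f (\<lambda>v. \<phi> h (c' v))"
    if h: "h \<in> carrier G" for h f
  proof -
    have "foldr (mult_derivative \<phi>) (g # gs) f (\<phi> h x)
      = foldr (mult_derivative \<phi>) gs f (\<phi> (g \<otimes>\<^bsub>G\<^esub> h) x) * cnj (foldr (mult_derivative \<phi>) gs f (\<phi> h x))"
      using g h assms(1) by (simp add: mult_derivative_def action_mult)
    also have "\<dots> = alternating_prod n f (\<lambda>v. \<phi> (g \<otimes>\<^bsub>G\<^esub> h) (c v)) * cnj (alternating_prod n f (\<lambda>v. \<phi> h (c v)))"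
      using g h c(2) by simp
    also have "alternating_prod n f (\<lambda>v. \<phi> (g \<otimes>\<^bsub>G\<^esub> h) (c v)) = alternating_prod n f (\<lambda>w. \<phi> h (c' (insert_coord n n 1 w)))"
      by (rule alternating_prod_cong) (use ins g h cube_in_space[OF c(1)] in \<open>simp add: action_mult action_commute\<close>)
    also have "alternating_prod n f (\<lambda>v. \<phi> h (c v)) = alternating_prod n f (\<lambda>w. \<phi> h (c' (insert_coord n n 0 w)))"
      by (rule alternating_prod_cong) (use ins in simp)
    finally show ?thesis by (simp add: alternating_prod_split[of n n])
  qed
  then show ?case using c' unfolding n_def by auto
qed

text \<open>Phase polynomials of degree at most \<open>k\<close> are the case \<open>d = k + 1\<close>. Counting derivatives instead of
  degrees lets inductions start with the functions that are constantly one.\<close>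

definition derivatives_trivial :: "nat \<Rightarrow> ('a \<Rightarrow> complex) \<Rightarrow> bool"
  where "derivatives_trivial d f \<longleftrightarrow> (\<forall>gs. set gs \<subseteq> carrier G \<and> length gs = d \<longrightarrow>
    (\<forall>x\<in>topspace T. foldr (mult_derivative \<phi>) gs f x = 1))"

lemma derivatives_trivial_if_cubes:
  assumes "\<And>c. c \<in> C d \<Longrightarrow> alternating_prod d f c = 1"
  shows "derivatives_trivial d f"
  unfolding derivatives_trivial_def
proof (intro allI impI ballI)
  fix gs x assume gs: "set gs \<subseteq> carrier G \<and> length gs = d" and x: "x \<in> topspace T"
  from iterated_derivative_on_cube[OF x, of gs] gs obtain c where c: "c \<in> C d"
    "\<And>h f. h \<in> carrier G \<Longrightarrow> foldr (mult_derivative \<phi>) gs f (\<phi> h x) = alternating_prod d f (\<lambda>v. \<phi> h (c v))"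
    by auto
  have "foldr (mult_derivative \<phi>) gs f x = alternating_prod d f (\<lambda>v. \<phi> \<one>\<^bsub>G\<^esub> (c v))"
    using c(2)[of "\<one>\<^bsub>G\<^esub>" f] action_one[OF x] by simp
  also have "\<dots> = alternating_prod d f c"
    by (rule alternating_prod_cong) (simp add: action_one cube_in_space[OF c(1)])
  finally show "foldr (mult_derivative \<phi>) gs f x = 1" using assms[OF c(1)] by simp
qed

lemma derivatives_trivial_0: "derivatives_trivial 0 f \<longleftrightarrow> (\<forall>x\<in>topspace T. f x = 1)"
  by (simp add: derivatives_trivial_def)

lemma derivatives_trivial_Suc:
  "derivatives_trivial (Suc d) f \<longleftrightarrow> (\<forall>g\<in>carrier G. derivatives_trivial d (mult_derivative \<phi> g f))"
proof (intro iffI ballI)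
  fix g assume d: "derivatives_trivial (Suc d) f" and g: "g \<in> carrier G"
  show "derivatives_trivial d (mult_derivative \<phi> g f)"
    unfolding derivatives_trivial_def
  proof (intro allI impI ballI)
    fix gs x assume "set gs \<subseteq> carrier G \<and> length gs = d" "x \<in> topspace T"
    then have "foldr (mult_derivative \<phi>) (gs @ [g]) f x = 1"
      using d g unfolding derivatives_trivial_def by (intro d[unfolded derivatives_trivial_def, rule_format]) auto
    then show "foldr (mult_derivative \<phi>) gs (mult_derivative \<phi> g f) x = 1" by simp
  qed
next
  assume *: "\<forall>g\<in>carrier G. derivatives_trivial d (mult_derivative \<phi> g f)"
  show "derivatives_trivial (Suc d) f"
    unfolding derivatives_trivial_def
  proof (intro allI impI ballI)
    fix gs x assume gs: "set gs \<subseteq> carrier G \<and> length gs = Suc d" and x: "x \<in> topspace T"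
    then obtain hs g where hs: "gs = hs @ [g]" by (metis length_0_conv nat.distinct(1) rev_exhaust)
    then have "derivatives_trivial d (mult_derivative \<phi> g f)" using * gs by auto
    then show "foldr (mult_derivative \<phi>) gs f x = 1"
      using gs x hs unfolding derivatives_trivial_def by simp
  qed
qed

text \<open>Differentiating along the unit turns \<open>f\<close> into \<open>|f|^2\<close>.\<close>

lemma derivatives_trivial_norm:
  assumes "derivatives_trivial d f" "x \<in> topspace T"
  shows "cmod (f x) = 1"
  using assms
proof (induction d arbitrary: f)
  case 0
  then show ?case by (simp add: derivatives_trivial_0)
next
  case (Suc d)
  then have "cmod (mult_derivative \<phi> \<one>\<^bsub>G\<^esub> f x) = 1" by (auto simp: derivatives_trivial_Suc)
  then have "(cmod (f x))\<^sup>2 = 1" using action_one[OF Suc.prems(2)] by (simp add: mult_derivative_def norm_mult power2_eq_square)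
  then show ?case by (simp add: power2_eq_1_iff) (smt (verit) norm_ge_zero)
qed

lemma derivatives_trivial_cnj:
  "derivatives_trivial d f \<Longrightarrow> derivatives_trivial d (\<lambda>x. cnj (f x))"
proof (induction d arbitrary: f)
  case 0
  then show ?case by (simp add: derivatives_trivial_0)
next
  case (Suc d)
  have "mult_derivative \<phi> g (\<lambda>x. cnj (f x)) = (\<lambda>x. cnj (mult_derivative \<phi> g f x))" for g
    by (simp add: mult_derivative_def)
  then show ?case using Suc by (simp add: derivatives_trivial_Suc)
qed

lemma derivatives_trivial_cong:
  "(\<And>x. x \<in> topspace T \<Longrightarrow> f x = f' x) \<Longrightarrow> derivatives_trivial d f \<Longrightarrow> derivatives_trivial d f'"
proof (induction d arbitrary: f f')
  case 0
  then show ?case by (simp add: derivatives_trivial_0)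
next
  case (Suc d)
  have "mult_derivative \<phi> g f x = mult_derivative \<phi> g f' x" if "g \<in> carrier G" "x \<in> topspace T" for g x
    using Suc.prems(1) that action_closed by (simp add: mult_derivative_def)
  then show ?case using Suc.IH Suc.prems(2) unfolding derivatives_trivial_Suc by metis
qed

lemma alternating_prod_translate:
  assumes f: "\<And>x. x \<in> topspace T \<Longrightarrow> cmod (f x) = 1"
    and d: "\<And>c. c \<in> C n \<Longrightarrow> alternating_prod n (mult_derivative \<phi> g f) c = 1" and c: "c \<in> C n"
  shows "alternating_prod n f (\<lambda>v. \<phi> g (c v)) = alternating_prod n f c"
proof -
  have "alternating_prod n f (\<lambda>v. \<phi> g (c v)) * cnj (alternating_prod n f c) = alternating_prod n (mult_derivative \<phi> g f) c"
  proof -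
    have "alternating_prod n (mult_derivative \<phi> g f) c
      = alternating_prod n (\<lambda>x. f (\<phi> g x)) c * alternating_prod n (\<lambda>x. cnj (f x)) c"
      unfolding mult_derivative_def by (rule alternating_prod_mult)
    then show ?thesis
      by (simp add: alternating_prod_cnj) (simp add: alternating_prod_def)
  qed
  also have "\<dots> = 1" by (rule d[OF c])
  finally have "alternating_prod n f (\<lambda>v. \<phi> g (c v)) * cnj (alternating_prod n f c) = 1" .
  moreover have "alternating_prod n f c * cnj (alternating_prod n f c) = 1"
    using norm_alternating_prod[of n f c] f cube_in_space[OF c] by (simp add: complex_norm_square[symmetric])
  ultimately show ?thesis by (metis mult.assoc mult.commute mult.right_neutral)
qed

text \<open>Translating one face changes the alternating product by the alternating product of the derivative
  over that face, which is one.\<close>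

lemma alternating_prod_translate_face:
  assumes f: "\<And>x. x \<in> topspace T \<Longrightarrow> cmod (f x) = 1"
    and d: "\<And>c. c \<in> C n \<Longrightarrow> alternating_prod n (mult_derivative \<phi> g f) c = 1"
    and c: "c \<in> C (Suc n)" and j: "j \<le> n"
  shows "alternating_prod (Suc n) f (apply_on_face (Suc n) {v \<in> vertices (Suc n). v j = 1} (\<phi> g) c)
    = alternating_prod (Suc n) f c"
proof -
  let ?c = "apply_on_face (Suc n) {v \<in> vertices (Suc n). v j = 1} (\<phi> g) c"
  let ?top = "compose (vertices n) c (insert_coord n j 1)"
  have top: "?top \<in> C n" by (rule face_cube[OF c j]) simp
  have "alternating_prod n f (\<lambda>w. ?c (insert_coord n j 1 w)) = alternating_prod n f (\<lambda>v. \<phi> g (?top v))"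
    by (rule alternating_prod_cong)
      (use j insert_coord_vertices[OF j, of 1] in \<open>simp add: apply_on_face_def compose_def\<close>)
  also have "\<dots> = alternating_prod n f ?top" by (rule alternating_prod_translate[OF f d top])
  also have "\<dots> = alternating_prod n f (\<lambda>w. c (insert_coord n j 1 w))"
    by (rule alternating_prod_cong) (simp add: compose_def)
  finally have 1: "alternating_prod n f (\<lambda>w. ?c (insert_coord n j 1 w)) = \<dots>" .
  have 0: "alternating_prod n f (\<lambda>w. ?c (insert_coord n j 0 w)) = alternating_prod n f (\<lambda>w. c (insert_coord n j 0 w))"
    by (rule alternating_prod_cong)
      (use j insert_coord_vertices[OF j, of 0] in \<open>simp add: apply_on_face_def\<close>)
  show ?thesis unfolding alternating_prod_split[OF j] 1 0 ..
qed

end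

section \<open>Phase polynomials on cubes of a fully ergodic system\<close>

text \<open>Each level set of \<open>F\<close> is invariant and so carries an invariant probability measure; two different
  level sets would carry different ones.\<close>

lemma uniquely_ergodic_invariant_const:
  fixes F :: "'a \<Rightarrow> complex"
  assumes ue: "uniquely_ergodic T H" and T: "compact_space T" "Hausdorff_space T"
    and H: "\<And>h. h \<in> H \<Longrightarrow> homeomorphic_map T T h"
    and comm: "\<And>g h x. g \<in> H \<Longrightarrow> h \<in> H \<Longrightarrow> x \<in> topspace T \<Longrightarrow> g (h x) = h (g x)"
    and F: "continuous_map T euclidean F" and inv: "\<And>h x. h \<in> H \<Longrightarrow> x \<in> topspace T \<Longrightarrow> F (h x) = F x"
    and p: "p \<in> topspace T" and q: "q \<in> topspace T"
  shows "F p = F q"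
proof (rule ccontr)
  assume ne: "F p \<noteq> F q"
  have ex: "\<exists>\<mu>. prob_space \<mu> \<and> sets \<mu> = sets (borel_of T) \<and> (\<forall>h\<in>H. distr \<mu> \<mu> h = \<mu>) \<and>
      emeasure \<mu> {x \<in> topspace T. F x \<in> - {F p}} = 0" if p: "p \<in> topspace T" for p
  proof -
    let ?Z = "{x \<in> topspace T. F x = F p}"
    have op: "openin T {x \<in> topspace T. F x \<in> - {F p}}"
      by (rule openin_continuous_map_preimage[OF F]) auto
    show ?thesis
    proof (rule invariant_measure_exists[of T H ?Z])
      show "h ` ?Z \<subseteq> ?Z" if "h \<in> H" for h
      proof (rule image_subsetI)
        fix x assume "x \<in> ?Z"
        then have x: "x \<in> topspace T" "F x = F p" by simp_all
        have "h x \<in> topspace T" using homeomorphic_imp_surjective_map[OF H[OF that]] x(1) by blast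
        then show "h x \<in> ?Z" using inv[OF that x(1)] x(2) by simp
      qed
      show "g (h x) = h (g x)" if "g \<in> H" "h \<in> H" "x \<in> topspace T" for g h x
        by (rule comm[OF that])
      show "?Z \<noteq> {}" using p by auto
      fix \<mu> assume \<mu>: "prob_space \<mu>" "sets \<mu> = sets (borel_of T)" "\<And>h. h \<in> H \<Longrightarrow> distr \<mu> \<mu> h = \<mu>"
        "\<And>W. openin T W \<Longrightarrow> W \<inter> ?Z = {} \<Longrightarrow> emeasure \<mu> W = 0"
      have "emeasure \<mu> {x \<in> topspace T. F x \<in> - {F p}} = 0" by (rule \<mu>(4)[OF op]) auto
      then show ?thesis using \<mu>(1-3) by (intro exI[of _ \<mu>]) simp
    qed (use T H in auto)
  qed
  obtain \<mu> where \<mu>: "prob_space \<mu>" "sets \<mu> = sets (borel_of T)" "\<forall>h\<in>H. distr \<mu> \<mu> h = \<mu>"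
    "emeasure \<mu> {x \<in> topspace T. F x \<in> - {F p}} = 0" using ex[OF p] by auto
  obtain \<nu> where \<nu>: "prob_space \<nu>" "sets \<nu> = sets (borel_of T)" "\<forall>h\<in>H. distr \<nu> \<nu> h = \<nu>"
    "emeasure \<nu> {x \<in> topspace T. F x \<in> - {F q}} = 0" using ex[OF q] by auto
  have "\<mu> = \<nu>" using ue \<mu>(1-3) \<nu>(1-3) unfolding uniquely_ergodic_def by (elim ex1E) metis
  have meas: "{x \<in> topspace T. F x \<in> - {F y}} \<in> sets \<mu>" for y
    unfolding \<mu>(2) by (intro sets_borel_of_openin openin_continuous_map_preimage[OF F]) auto
  have "space \<mu> = topspace T" using sets_eq_imp_space_eq[OF \<mu>(2)] by simp
  then have "space \<mu> = {x \<in> topspace T. F x \<in> - {F p}} \<union> {x \<in> topspace T. F x \<in> - {F q}}"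
    using ne by auto
  then have "emeasure \<mu> (space \<mu>) \<le> 0"
    using emeasure_subadditive[OF meas meas, of p q] \<mu>(4) \<nu>(4) \<open>\<mu> = \<nu>\<close> by simp
  then show False using prob_space.emeasure_space_1[OF \<mu>(1)] by simp
qed

context nilspace_action
begin

abbreviation cube_space :: "nat \<Rightarrow> ((nat \<Rightarrow> int) \<Rightarrow> 'a) topology"
  where "cube_space n \<equiv> subtopology (cube_topology T n) (C n)"

lemma topspace_cube_space [simp]: "topspace (cube_space n) = C n"
  using cubes_subset[of n] by auto

lemma compact_cube_space: "compact_space (cube_space n)"
proof -
  have "compact_space (cube_topology T n)"
    using compact by (simp add: compact_space_product_topology)
  then show ?thesis using closed_cubes closedin_compact_space compact_space_subtopology by blast
qed

lemma Hausdorff_cube_space: "Hausdorff_space (cube_space n)"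
  using Hausdorff by (intro Hausdorff_space_subtopology) (simp add: Hausdorff_space_product_topology)

text \<open>The first \<open>j\<close> directions of a cube in the group; for \<open>j = n\<close> these are all of \<^const>\<open>action_cubes\<close>.
  Increasing \<open>j\<close> by one amounts to a translation on one face.\<close>

definition group_cube :: "'g \<Rightarrow> (nat \<Rightarrow> 'g) \<Rightarrow> nat \<Rightarrow> (nat \<Rightarrow> int) \<Rightarrow> 'g"
  where "group_cube x h j v = x \<otimes>\<^bsub>G\<^esub> finprod G (\<lambda>i. h i [^]\<^bsub>G\<^esub> v i) {..<j}"

lemma group_cube_closed:
  assumes "x \<in> carrier G" "h \<in> {..<n} \<rightarrow> carrier G" "j \<le> n"
  shows "group_cube x h j v \<in> carrier G"
  unfolding group_cube_def using assms
  by (intro G.m_closed G.finprod_closed) (auto intro!: G.int_pow_closed)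

lemma group_cube_0: "x \<in> carrier G \<Longrightarrow> group_cube x h 0 v = x"
  by (simp add: group_cube_def)

lemma group_cube_Suc:
  assumes x: "x \<in> carrier G" and h: "h \<in> {..<n} \<rightarrow> carrier G" and j: "j < n" and v: "v \<in> vertices n"
  shows "group_cube x h (Suc j) v = (if v j = 1 then h j \<otimes>\<^bsub>G\<^esub> group_cube x h j v else group_cube x h j v)"
proof -
  let ?p = "finprod G (\<lambda>i. h i [^]\<^bsub>G\<^esub> v i) {..<j}"
  have hj: "h j \<in> carrier G" using h j by auto
  have p: "?p \<in> carrier G"
    using h j by (intro G.finprod_closed) (auto intro!: G.int_pow_closed)
  have "finprod G (\<lambda>i. h i [^]\<^bsub>G\<^esub> v i) {..<Suc j} = h j [^]\<^bsub>G\<^esub> v j \<otimes>\<^bsub>G\<^esub> ?p"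
    unfolding lessThan_Suc using h j
    by (intro G.finprod_insert) (auto intro!: G.int_pow_closed)
  moreover have "v j = 0 \<or> v j = 1" by (rule vertices_D[OF v j])
  ultimately show ?thesis
    unfolding group_cube_def using hj p x by (auto simp: G.int_pow_1 G.m_lcomm)
qed

lemma group_cube_inv:
  assumes x: "x \<in> carrier G" and h: "h \<in> {..<n} \<rightarrow> carrier G" and v: "v \<in> vertices n" and j: "j \<le> n"
  shows "group_cube (inv\<^bsub>G\<^esub> x) (\<lambda>i. inv\<^bsub>G\<^esub> h i) j v = inv\<^bsub>G\<^esub> (group_cube x h j v)"
  using j
proof (induction j)
  case 0
  then show ?case using x by (simp add: group_cube_0)
next
  case (Suc j)
  have h': "(\<lambda>i. inv\<^bsub>G\<^esub> h i) \<in> {..<n} \<rightarrow> carrier G" using h by auto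
  have "h j \<in> carrier G" using h Suc.prems by auto
  then show ?case
    using Suc group_cube_Suc[OF x h _ v, of j] group_cube_Suc[OF G.inv_closed[OF x] h' _ v, of j]
      group_cube_closed[OF x h, of j v] by (simp add: G.inv_mult)
qed

lemma partial_group_cube_action:
  assumes x: "x \<in> carrier G" and h: "h \<in> {..<n} \<rightarrow> carrier G" and q: "q \<in> C n" and j: "j < n"
  shows "(\<lambda>v\<in>vertices n. \<phi> (group_cube x h (Suc j) v) (q v)) =
    apply_on_face n {v \<in> vertices n. v j = 1} (\<phi> (h j)) (\<lambda>v\<in>vertices n. \<phi> (group_cube x h j v) (q v))"
  unfolding apply_on_face_def
proof (rule restrict_ext)
  fix v assume v: "v \<in> vertices n"
  have "h j \<in> carrier G" "group_cube x h j v \<in> carrier G"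
    using h j group_cube_closed[OF x h] by auto
  then show "\<phi> (group_cube x h (Suc j) v) (q v) =
      (if v \<in> {v \<in> vertices n. v j = 1} then \<phi> (h j) ((\<lambda>v\<in>vertices n. \<phi> (group_cube x h j v) (q v)) v)
       else (\<lambda>v\<in>vertices n. \<phi> (group_cube x h j v) (q v)) v)"
    using v cube_in_space[OF q v] by (simp add: group_cube_Suc[OF x h j v] action_mult)
qed

lemma group_cube_action_closed:
  assumes x: "x \<in> carrier G" and h: "h \<in> {..<n} \<rightarrow> carrier G" and q: "q \<in> C n" and j: "j \<le> n"
  shows "(\<lambda>v\<in>vertices n. \<phi> (group_cube x h j v) (q v)) \<in> C n"
  using j
proof (induction j)
  case 0
  show ?case unfolding group_cube_0[OF x] by (rule translated_cube[OF q x])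
next
  case (Suc j)
  have IH: "(\<lambda>v\<in>vertices n. \<phi> (group_cube x h j v) (q v)) \<in> C n"
    by (rule Suc.IH[OF Suc_leD[OF Suc.prems]])
  show ?case
    unfolding partial_group_cube_action[OF x h q Suc_le_lessD[OF Suc.prems]]
    by (rule translated_face_cube[OF IH]) (use h Suc.prems in auto)
qed

lemma action_cubes_eq:
  "action_cubes G n = {\<lambda>v\<in>vertices n. group_cube x h n v | x h. x \<in> carrier G \<and> h \<in> {..<n} \<rightarrow> carrier G}"
  unfolding action_cubes_def group_cube_def by simp

lemma cube_action_closed:
  assumes "\<gamma> \<in> action_cubes G n" "q \<in> C n"
  shows "cube_action \<phi> n \<gamma> q \<in> C n"
proof -
  obtain x h where xh: "x \<in> carrier G" "h \<in> {..<n} \<rightarrow> carrier G" and \<gamma>: "\<gamma> = (\<lambda>v\<in>vertices n. group_cube x h n v)"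
    using assms(1) by (auto simp: action_cubes_eq)
  have "cube_action \<phi> n \<gamma> q = (\<lambda>v\<in>vertices n. \<phi> (group_cube x h n v) (q v))"
    unfolding cube_action_def \<gamma> by (rule restrict_ext) simp
  then show ?thesis using group_cube_action_closed[OF xh assms(2)] by simp
qed

lemma action_cubes_closed: "\<gamma> \<in> action_cubes G n \<Longrightarrow> v \<in> vertices n \<Longrightarrow> \<gamma> v \<in> carrier G"
  using group_cube_closed by (auto simp: action_cubes_eq)

lemma cube_action_commute:
  assumes "\<gamma> \<in> action_cubes G n" "\<delta> \<in> action_cubes G n" "q \<in> C n"
  shows "cube_action \<phi> n \<gamma> (cube_action \<phi> n \<delta> q) = cube_action \<phi> n \<delta> (cube_action \<phi> n \<gamma> q)"
  unfolding cube_action_def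
  by (rule restrict_ext) (use assms in \<open>auto intro!: action_commute action_cubes_closed cube_in_space\<close>)

lemma continuous_cube_action:
  assumes "\<gamma> \<in> action_cubes G n"
  shows "continuous_map (cube_space n) (cube_space n) (cube_action \<phi> n \<gamma>)"
  unfolding continuous_map_in_subtopology
proof
  show "continuous_map (cube_space n) (cube_topology T n) (cube_action \<phi> n \<gamma>)"
    unfolding continuous_map_componentwise
  proof (intro conjI ballI)
    show "cube_action \<phi> n \<gamma> ` topspace (cube_space n) \<subseteq> extensional (vertices n)"
      by (auto simp: cube_action_def)
    fix v assume v: "v \<in> vertices n"
    have "continuous_map (cube_space n) T (\<lambda>q. q v)"
      using v by (intro continuous_map_from_subtopology continuous_map_product_projection)
    moreover have "continuous_map T T (\<phi> (\<gamma> v))"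
      using action_homeomorphic[OF action_cubes_closed[OF assms v]] by (rule homeomorphic_imp_continuous_map)
    ultimately have "continuous_map (cube_space n) T (\<lambda>q. \<phi> (\<gamma> v) (q v))"
      using continuous_map_compose by (force simp: comp_def)
    then show "continuous_map (cube_space n) T (\<lambda>q. cube_action \<phi> n \<gamma> q v)"
      using v by (simp add: cube_action_def)
  qed
  show "cube_action \<phi> n \<gamma> \<in> topspace (cube_space n) \<rightarrow> C n"
    using cube_action_closed[OF assms] by simp
qed

lemma homeomorphic_cube_action:
  assumes "\<gamma> \<in> action_cubes G n"
  shows "homeomorphic_map (cube_space n) (cube_space n) (cube_action \<phi> n \<gamma>)"
proof -
  obtain x h where xh: "x \<in> carrier G" "h \<in> {..<n} \<rightarrow> carrier G" and \<gamma>: "\<gamma> = (\<lambda>v\<in>vertices n. group_cube x h n v)"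
    using assms by (auto simp: action_cubes_eq)
  define \<delta> where "\<delta> = (\<lambda>v\<in>vertices n. group_cube (inv\<^bsub>G\<^esub> x) (\<lambda>i. inv\<^bsub>G\<^esub> h i) n v)"
  have \<delta>: "\<delta> \<in> action_cubes G n"
  proof -
    have "inv\<^bsub>G\<^esub> x \<in> carrier G" "(\<lambda>i. inv\<^bsub>G\<^esub> h i) \<in> {..<n} \<rightarrow> carrier G" using xh by auto
    then show ?thesis unfolding action_cubes_eq \<delta>_def by blast
  qed
  have \<delta>v: "\<delta> v = inv\<^bsub>G\<^esub> (\<gamma> v)" if "v \<in> vertices n" for v
    using that group_cube_inv[OF xh that, of n] by (simp add: \<delta>_def \<gamma>)
  have cancel: "cube_action \<phi> n \<alpha> (cube_action \<phi> n \<beta> q) = q"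
    if "\<alpha> \<in> action_cubes G n" "\<beta> \<in> action_cubes G n" "\<And>v. v \<in> vertices n \<Longrightarrow> \<alpha> v \<otimes>\<^bsub>G\<^esub> \<beta> v = \<one>\<^bsub>G\<^esub>" "q \<in> C n"
    for \<alpha> \<beta> q
  proof -
    have "cube_action \<phi> n \<alpha> (cube_action \<phi> n \<beta> q) = restrict q (vertices n)"
      unfolding cube_action_def
    proof (rule restrict_ext)
      fix v assume v: "v \<in> vertices n"
      have "\<phi> (\<alpha> v) (\<phi> (\<beta> v) (q v)) = \<phi> (\<alpha> v \<otimes>\<^bsub>G\<^esub> \<beta> v) (q v)"
        using action_cubes_closed[OF that(1) v] action_cubes_closed[OF that(2) v] cube_in_space[OF that(4) v]
        by (simp add: action_mult)
      then show "\<phi> (\<alpha> v) ((\<lambda>v\<in>vertices n. \<phi> (\<beta> v) (q v)) v) = q v"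
        using v that(3)[OF v] cube_in_space[OF that(4) v] by (simp add: action_one)
    qed
    also have "\<dots> = q" using cubes_subset that(4) by (intro extensional_restrict) (auto simp: PiE_def)
    finally show ?thesis .
  qed
  have "\<delta> v \<otimes>\<^bsub>G\<^esub> \<gamma> v = \<one>\<^bsub>G\<^esub>" "\<gamma> v \<otimes>\<^bsub>G\<^esub> \<delta> v = \<one>\<^bsub>G\<^esub>" if "v \<in> vertices n" for v
    using \<delta>v[OF that] action_cubes_closed[OF assms that] by simp_all
  then show ?thesis
    unfolding homeomorphic_map_maps homeomorphic_maps_def
    using continuous_cube_action[OF assms] continuous_cube_action[OF \<delta>] cancel[OF assms \<delta>] cancel[OF \<delta> assms]
    by (intro exI[of _ "cube_action \<phi> n \<delta>"]) simp
qed

lemma continuous_alternating_prod: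
  assumes f: "continuous_map T euclidean f"
  shows "continuous_map (cube_space n) euclidean (alternating_prod n f)"
proof -
  have "continuous_map (cube_space n) euclidean (\<lambda>q. f (q v))" if "v \<in> vertices n" for v
  proof -
    have "continuous_map (cube_space n) T (\<lambda>q. q v)"
      using that by (intro continuous_map_from_subtopology continuous_map_product_projection)
    from continuous_map_compose[OF this f] show ?thesis by (simp add: comp_def)
  qed
  then show ?thesis
    unfolding alternating_prod_def continuous_map_atin limitin_canonical_iff
    by (auto intro!: tendsto_prod tendsto_cnj)
qed

text \<open>The hypothesis on \<open>mult_derivative\<close> is the induction hypothesis of the theorem below: derivatives of
  \<open>f\<close> have trivial alternating products over cubes of dimension one less.\<close>

lemma alternating_prod_cube_action:
  assumes f: "\<And>x. x \<in> topspace T \<Longrightarrow> cmod (f x) = 1"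
    and d: "\<And>m g c. \<lbrakk>d \<le> m; g \<in> carrier G; c \<in> C m\<rbrakk> \<Longrightarrow> alternating_prod m (mult_derivative \<phi> g f) c = 1"
    and n: "d < n" and \<gamma>: "\<gamma> \<in> action_cubes G n" and q: "q \<in> C n"
  shows "alternating_prod n f (cube_action \<phi> n \<gamma> q) = alternating_prod n f q"
proof -
  obtain x h where xh: "x \<in> carrier G" "h \<in> {..<n} \<rightarrow> carrier G" and \<gamma>': "\<gamma> = (\<lambda>v\<in>vertices n. group_cube x h n v)"
    using \<gamma> by (auto simp: action_cubes_eq)
  obtain m where m: "n = Suc m" "d \<le> m" using n by (cases n) auto
  have "alternating_prod n f (\<lambda>v\<in>vertices n. \<phi> (group_cube x h j v) (q v)) = alternating_prod n f q" if "j \<le> n" for j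
    using that
  proof (induction j)
    case 0
    have "alternating_prod n f (\<lambda>v\<in>vertices n. \<phi> (group_cube x h 0 v) (q v)) = alternating_prod n f (\<lambda>v. \<phi> x (q v))"
      by (rule alternating_prod_cong) (simp add: group_cube_0 xh)
    also have "\<dots> = alternating_prod n f q"
      by (rule alternating_prod_translate[OF f d[OF less_imp_le[OF n] xh(1)] q])
    finally show ?case .
  next
    case (Suc j)
    have hj: "h j \<in> carrier G" using xh Suc.prems by auto
    have j: "j \<le> m" using Suc.prems m by simp
    have c: "(\<lambda>v\<in>vertices n. \<phi> (group_cube x h j v) (q v)) \<in> C (Suc m)"
      unfolding m(1)[symmetric] by (rule group_cube_action_closed[OF xh q Suc_leD[OF Suc.prems]])
    have IH: "alternating_prod n f (\<lambda>v\<in>vertices n. \<phi> (group_cube x h j v) (q v)) = alternating_prod n f q"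
      by (rule Suc.IH[OF Suc_leD[OF Suc.prems]])
    show ?case
      unfolding partial_group_cube_action[OF xh q Suc_le_lessD[OF Suc.prems]]
      using alternating_prod_translate_face[OF f d[OF m(2) hj] c j, folded m(1)] IH by (rule trans)
  qed
  from this[of n] show ?thesis
    unfolding cube_action_def \<gamma>' by (simp cong: restrict_cong)
qed

text \<open>Induction on the number of derivatives shows that the alternating product is a continuous invariant
  function on the space of cubes, so full ergodicity makes it constant; on constant cubes it is one.\<close>

theorem alternating_prod_of_phase_polynomial:
  assumes fe: "fully_ergodic T C G \<phi>" and "derivatives_trivial d f" "continuous_map T euclidean f"
    and "d \<le> n" "c \<in> C n"
  shows "alternating_prod n f c = 1"
  using assms(2-)
proof (induction d arbitrary: f n c)
  case 0
  then show ?case by (intro alternating_prod_one) (auto simp: derivatives_trivial_0 cube_in_space)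
next
  case (Suc d)
  have norm: "cmod (f x) = 1" if "x \<in> topspace T" for x
    by (rule derivatives_trivial_norm[OF Suc.prems(1) that])
  have der: "alternating_prod m (mult_derivative \<phi> g f) c = 1" if "d \<le> m" "g \<in> carrier G" "c \<in> C m" for m g c
  proof (rule Suc.IH[OF _ _ that(1,3)])
    show "derivatives_trivial d (mult_derivative \<phi> g f)" using Suc.prems(1) that(2) by (simp add: derivatives_trivial_Suc)
    have "continuous_map T T (\<phi> g)" using action_homeomorphic[OF that(2)] by (rule homeomorphic_imp_continuous_map)
    then have "continuous_map T euclidean (\<lambda>x. f (\<phi> g x))"
      using continuous_map_compose[OF _ Suc.prems(2)] by (force simp: comp_def)
    then show "continuous_map T euclidean (mult_derivative \<phi> g f)"
      using Suc.prems(2) unfolding mult_derivative_def continuous_map_atin limitin_canonical_iff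
      by (auto intro!: tendsto_intros)
  qed
  obtain x where x: "x \<in> topspace T" using nonempty by blast
  obtain m where m: "n = Suc m" using Suc.prems(3) by (cases n) auto
  have q: "(\<lambda>v\<in>vertices n. x) \<in> C n"
  proof -
    have "(\<lambda>v\<in>vertices 0. x) \<in> C 0" using x by (simp add: cubes_0)
    moreover have "(\<lambda>v. \<lambda>_. undefined) \<in> affine_maps n 0"
      by (auto simp: affine_maps_def vertices_0)
    ultimately have "compose (vertices n) (\<lambda>v\<in>vertices 0. x) (\<lambda>v. \<lambda>_. undefined) \<in> C n" by (rule composition)
    then show ?thesis by (simp add: compose_def vertices_0 cong: restrict_cong)
  qed
  have "alternating_prod n f c = alternating_prod n f (\<lambda>v\<in>vertices n. x)"
  proof (rule uniquely_ergodic_invariant_const[of "cube_space n" "cube_action \<phi> n ` action_cubes G n"])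
    show "uniquely_ergodic (cube_space n) (cube_action \<phi> n ` action_cubes G n)"
      using fe by (simp add: fully_ergodic_def)
    show "continuous_map (cube_space n) euclidean (alternating_prod n f)"
      by (rule continuous_alternating_prod[OF Suc.prems(2)])
    show "alternating_prod n f (h y) = alternating_prod n f y"
      if h: "h \<in> cube_action \<phi> n ` action_cubes G n" and y: "y \<in> topspace (cube_space n)" for h y
    proof -
      obtain \<gamma> where \<gamma>: "\<gamma> \<in> action_cubes G n" and h: "h = cube_action \<phi> n \<gamma>" using h by auto
      show ?thesis
        unfolding h
        by (rule alternating_prod_cube_action[OF norm der]) (use Suc.prems(3) y \<gamma> in auto)
    qed
    show "homeomorphic_map (cube_space n) (cube_space n) h" if "h \<in> cube_action \<phi> n ` action_cubes G n" for h
      using that homeomorphic_cube_action by blast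
    show "g (h y) = h (g y)" if "g \<in> cube_action \<phi> n ` action_cubes G n" "h \<in> cube_action \<phi> n ` action_cubes G n"
      "y \<in> topspace (cube_space n)" for g h y
      using that cube_action_commute[of _ n _ y] by auto
    show "compact_space (cube_space n)" "Hausdorff_space (cube_space n)"
      by (rule compact_cube_space Hausdorff_cube_space)+
    show "c \<in> topspace (cube_space n)" unfolding topspace_cube_space by (rule Suc.prems(4))
    show "(\<lambda>v\<in>vertices n. x) \<in> topspace (cube_space n)" unfolding topspace_cube_space by (rule q)
  qed
  also have "\<dots> = 1"
  proof -
    let ?k = "alternating_prod m f (\<lambda>_. x)"
    have "alternating_prod n f (\<lambda>v\<in>vertices n. x) = alternating_prod (Suc m) f (\<lambda>_. x)"
      unfolding m by (rule alternating_prod_cong) simp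
    also have "\<dots> = ?k * cnj ?k" using alternating_prod_split[of m m f "\<lambda>_. x"] by simp
    also have "\<dots> = 1" using norm_alternating_prod[of m f "\<lambda>_. x"] norm[OF x] by (simp add: complex_norm_square[symmetric])
    finally show ?thesis .
  qed
  finally show ?case .
qed

end

section \<open>Density of generated algebras and separation of points\<close>

lemma mspace_C_complex:
  assumes "compact_space T"
  shows "f \<in> mspace (C_complex T) \<longleftrightarrow> f \<in> extensional (topspace T) \<and> continuous_map T euclidean f"
proof -
  have "bounded (f ` topspace T)" if "continuous_map T euclidean f"
  proof -
    have "compactin euclidean (f ` topspace T)"
      using assms that unfolding compact_space_def by (rule image_compactin)
    then show ?thesis by (simp add: compact_imp_bounded)
  qed
  then show ?thesis by (auto simp: euclidean_metric_def)
qed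

lemma continuous_map_restrict:
  "continuous_map T euclidean f \<Longrightarrow> continuous_map T euclidean (\<lambda>x\<in>topspace T. f x)"
  by (rule continuous_map_eq[of T euclidean f]) auto

text \<open>Functions that agree at \<open>x\<close> and \<open>y\<close> generate an algebra of functions that agree there, and uniform
  limits inherit this; a Urysohn function does not agree there.\<close>

lemma separates_points_if_dense:
  assumes T: "compact_space T" "Hausdorff_space T" and S: "S \<subseteq> mspace (C_complex T)"
    and dense: "mtopology_of (C_complex T) closure_of generated_algebra (topspace T) S = mspace (C_complex T)"
    and x: "x \<in> topspace T" and y: "y \<in> topspace T" and "x \<noteq> y"
  shows "\<exists>f\<in>S. f x \<noteq> f y"
proof (rule ccontr)
  assume "\<not> ?thesis"
  then have eqS: "\<And>f. f \<in> S \<Longrightarrow> f x = f y" by blast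
  have eq: "f x = f y" if "f \<in> generated_algebra (topspace T) S" for f
    using that by induction (use eqS x y in auto)
  have normal: "normal_space T" using T compact_Hausdorff_or_regular_imp_normal_space by blast
  have t1: "closedin T {z}" if "z \<in> topspace T" for z
    using T that by (simp add: Hausdorff_imp_t1_space closedin_t1_singleton)
  obtain u :: "'a \<Rightarrow> real" where u: "continuous_map T (top_of_set {0..1}) u" "u ` {x} \<subseteq> {0}" "u ` {y} \<subseteq> {1}"
    using Urysohn_lemma[OF normal t1[OF x] t1[OF y], of 0 1] \<open>x \<noteq> y\<close> by (auto simp: disjnt_def)
  have "continuous_map T euclidean u" using u(1) by (simp add: continuous_map_in_subtopology)
  then have "continuous_map T euclidean (\<lambda>x. complex_of_real (u x))"
    unfolding continuous_map_atin limitin_canonical_iff by (auto intro!: tendsto_intros)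
  then have F: "(\<lambda>x\<in>topspace T. complex_of_real (u x)) \<in> mspace (C_complex T)" (is "?F \<in> _")
    unfolding mspace_C_complex[OF T(1)] by (simp add: continuous_map_restrict)
  interpret Metric_space "mspace (C_complex T)" "mdist (C_complex T)" by (rule Metric_space_mspace_mdist)
  have "?F \<in> mtopology closure_of generated_algebra (topspace T) S"
    using F dense by (simp add: mtopology_of_def del: mspace_cfunspace)
  then have "\<exists>g\<in>generated_algebra (topspace T) S. g \<in> mball ?F (1/3)"
    unfolding metric_closure_of by (elim CollectE conjE allE[of _ "1/3"]) simp
  then obtain g where g: "g \<in> generated_algebra (topspace T) S" "g \<in> mball ?F (1/3)" by blast
  then have gm: "g \<in> mspace (C_complex T)" and d: "mdist (C_complex T) ?F g \<le> 1/3"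
    by (auto simp del: mspace_cfunspace)
  have "dist (?F z) (g z) \<le> 1/3" if "z \<in> topspace T" for z
    using mdist_cfunspace_imp_mdist_le[OF F gm d that] by simp
  from this[OF x] this[OF y] have "cmod (g x) \<le> 1/3" "cmod (1 - g x) \<le> 1/3"
    using u x y eq[OF g(1)] by (simp_all add: dist_norm)
  then show False using norm_triangle_ineq[of "1 - g x" "g x"] by simp
qed

text \<open>For each pair of basic open sets pick one function with disjoint images on them, if there is one.\<close>

lemma countable_separating_family:
  fixes S :: "('a \<Rightarrow> complex) set"
  assumes sc: "second_countable T" and ne: "S \<noteq> {}"
    and cont: "\<And>f. f \<in> S \<Longrightarrow> continuous_map T euclidean f"
    and sep: "\<And>x y. x \<in> topspace T \<Longrightarrow> y \<in> topspace T \<Longrightarrow> x \<noteq> y \<Longrightarrow> \<exists>f\<in>S. f x \<noteq> f y"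
  obtains F :: "nat \<Rightarrow> 'a \<Rightarrow> complex" where "range F \<subseteq> S"
    "\<And>x y. x \<in> topspace T \<Longrightarrow> y \<in> topspace T \<Longrightarrow> x \<noteq> y \<Longrightarrow> \<exists>i. F i x \<noteq> F i y"
proof -
  obtain \<B> where B: "countable \<B>" "\<And>U x. openin T U \<Longrightarrow> x \<in> U \<Longrightarrow> \<exists>V\<in>\<B>. x \<in> V \<and> V \<subseteq> U"
    using sc unfolding second_countable_def by metis
  obtain f0 where f0: "f0 \<in> S" using ne by blast
  \<comment> \<open>The default \<open>f0\<close> keeps the selected functions inside \<open>S\<close>.\<close>
  define sel where "sel = (\<lambda>(V, W). if \<exists>f\<in>S. f ` V \<inter> f ` W = {} then SOME f. f \<in> S \<and> f ` V \<inter> f ` W = {} else f0)"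
  have sel_S: "sel p \<in> S" for p
  proof -
    obtain V W where p: "p = (V, W)" by (cases p)
    show ?thesis
      using someI_ex[of "\<lambda>f. f \<in> S \<and> f ` V \<inter> f ` W = {}"] f0 unfolding sel_def p by (auto split: if_splits)
  qed
  have sel_disj: "sel (V, W) ` V \<inter> sel (V, W) ` W = {}" if "f \<in> S" "f ` V \<inter> f ` W = {}" for f V W
    using someI_ex[of "\<lambda>f. f \<in> S \<and> f ` V \<inter> f ` W = {}"] that unfolding sel_def by auto
  define D where "D = insert f0 (sel ` (\<B> \<times> \<B>))"
  have D: "countable D" "D \<noteq> {}" "D \<subseteq> S" using B(1) sel_S f0 by (auto simp: D_def)
  define F where "F = from_nat_into D"
  have F: "range F = D" unfolding F_def by (rule range_from_nat_into[OF D(2,1)])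
  show thesis
  proof
    show "range F \<subseteq> S" using F D by simp
    fix x y assume x: "x \<in> topspace T" and y: "y \<in> topspace T" and "x \<noteq> y"
    obtain f where f: "f \<in> S" "f x \<noteq> f y" using sep[OF x y \<open>x \<noteq> y\<close>] by blast
    obtain U V where UV: "open U" "open V" "f x \<in> U" "f y \<in> V" "U \<inter> V = {}"
      using hausdorff[OF f(2)] by blast
    have op: "openin T {z \<in> topspace T. f z \<in> U}" "openin T {z \<in> topspace T. f z \<in> V}"
      using UV(1,2) by (auto intro!: openin_continuous_map_preimage[OF cont[OF f(1)]])
    have "x \<in> {z \<in> topspace T. f z \<in> U}" "y \<in> {z \<in> topspace T. f z \<in> V}" using x y UV(3,4) by simp_all
    from B(2)[OF op(1) this(1)] B(2)[OF op(2) this(2)]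
    obtain U' V' where *: "U' \<in> \<B>" "x \<in> U'" "U' \<subseteq> {z \<in> topspace T. f z \<in> U}"
      "V' \<in> \<B>" "y \<in> V'" "V' \<subseteq> {z \<in> topspace T. f z \<in> V}" by (elim bexE conjE)
    have fU: "f z \<in> U" if "z \<in> U'" for z using subsetD[OF *(3) that] by simp
    have fV: "f z \<in> V" if "z \<in> V'" for z using subsetD[OF *(6) that] by simp
    have "f ` U' \<inter> f ` V' \<subseteq> U \<inter> V" by (intro Int_mono image_subsetI fU fV)
    then have "f ` U' \<inter> f ` V' = {}" using UV(5) by simp
    then have "sel (U', V') ` U' \<inter> sel (U', V') ` V' = {}" by (rule sel_disj[OF f(1)])
    then have "sel (U', V') x \<noteq> sel (U', V') y" using imageI[OF *(2)] imageI[OF *(5)] by (metis IntI empty_iff)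
    moreover have "sel (U', V') \<in> range F" unfolding F D_def using *(1,4) by simp
    then obtain i where "sel (U', V') = F i" by (rule rangeE)
    ultimately show "\<exists>i. F i x \<noteq> F i y" by (intro exI[of _ i]) simp
  qed
qed

lemma generated_algebra_mspace:
  assumes T: "compact_space T" and S: "S \<subseteq> mspace (C_complex T)" and f: "f \<in> generated_algebra (topspace T) S"
  shows "f \<in> mspace (C_complex T)"
  using f
proof induction
  case (incl f)
  then show ?case using S by blast
next
  case (add f g)
  then show ?case unfolding mspace_C_complex[OF T]
    by (auto intro!: continuous_map_restrict continuous_map_add)
next
  case (mult f g)
  then have "continuous_map T euclidean (\<lambda>x. f x * g x)"
    unfolding mspace_C_complex[OF T] continuous_map_atin limitin_canonical_iff by (auto intro!: tendsto_intros)
  then show ?case unfolding mspace_C_complex[OF T] by (simp add: continuous_map_restrict)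
next
  case (scale f a)
  then have "continuous_map T euclidean (\<lambda>x. a * f x)"
    unfolding mspace_C_complex[OF T] continuous_map_atin limitin_canonical_iff by (auto intro!: tendsto_intros)
  then show ?case unfolding mspace_C_complex[OF T] by (simp add: continuous_map_restrict)
qed

text \<open>A countable separating family identifies the space with a compact subset of the Hausdorff type
  \<^typ>\<open>nat \<Rightarrow> complex\<close>, where the real Stone-Weierstrass theorem applies.\<close>

lemma real_approximation:
  fixes u :: "'a \<Rightarrow> real"
  assumes T: "compact_space T" "second_countable T" "Hausdorff_space T"
    and S: "S \<subseteq> mspace (C_complex T)" and one: "(\<lambda>x\<in>topspace T. 1) \<in> S"
    and cnj: "\<And>f. f \<in> S \<Longrightarrow> (\<lambda>x\<in>topspace T. cnj (f x)) \<in> S"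
    and sep: "\<And>x y. x \<in> topspace T \<Longrightarrow> y \<in> topspace T \<Longrightarrow> x \<noteq> y \<Longrightarrow> \<exists>f\<in>S. f x \<noteq> f y"
    and u: "continuous_map T euclidean u" and "e > 0"
  obtains w :: "'a \<Rightarrow> real" where "(\<lambda>x\<in>topspace T. of_real (w x)) \<in> generated_algebra (topspace T) S"
    "\<And>x. x \<in> topspace T \<Longrightarrow> \<bar>u x - w x\<bar> < e"
proof -
  let ?X = "topspace T" and ?A = "generated_algebra (topspace T) S"
  have contS: "continuous_map T euclidean f" if "f \<in> S" for f
    using S that mspace_C_complex[OF T(1)] by blast
  obtain F :: "nat \<Rightarrow> 'a \<Rightarrow> complex" where F: "range F \<subseteq> S"
    "\<And>x y. x \<in> ?X \<Longrightarrow> y \<in> ?X \<Longrightarrow> x \<noteq> y \<Longrightarrow> \<exists>i. F i x \<noteq> F i y"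
    by (rule countable_separating_family[OF T(2) _ contS sep]) (use one in auto)
  define emb where "emb = (\<lambda>x i. F i x)"
  have "continuous_map T (product_topology (\<lambda>_. euclidean) UNIV) emb"
    unfolding continuous_map_componentwise_UNIV using contS F(1) by (auto simp: emb_def)
  then have emb: "continuous_map T euclidean emb" by (simp add: euclidean_product_topology)
  have inj: "inj_on emb ?X"
  proof (rule inj_onI, rule ccontr)
    fix x y assume "x \<in> ?X" "y \<in> ?X" and eq: "emb x = emb y" and "x \<noteq> y"
    have "F i x = F i y" for i using fun_cong[OF eq, of i] by (simp add: emb_def)
    then show False using F(2)[OF \<open>x \<in> ?X\<close> \<open>y \<in> ?X\<close> \<open>x \<noteq> y\<close>] by simp
  qed
  let ?E = "emb ` ?X"
  have compE: "compact ?E"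
    using image_compactin[OF _ emb] T(1) unfolding compact_space_def by simp
  have embE: "continuous_map T (top_of_set ?E) emb" using emb by (simp add: continuous_map_in_subtopology)
  have quot: "quotient_map T (top_of_set ?E) emb"
  proof (rule continuous_closed_imp_quotient_map[OF embE])
    show "closed_map T (top_of_set ?E) emb"
      by (rule continuous_imp_closed_map[OF embE T(1)]) (simp add: Hausdorff_space_subtopology)
    show "emb ` ?X = topspace (top_of_set ?E)" by simp
  qed
  define dec where "dec = inv_into ?X emb"
  have dec: "dec (emb x) = x" if "x \<in> ?X" for x unfolding dec_def using inj that by simp
  have cont_dec: "continuous_on ?E (\<lambda>z. f (dec z))" if "continuous_map T euclidean f" for f :: "'a \<Rightarrow> real"
  proof -
    have "continuous_map T euclidean ((\<lambda>z. f (dec z)) \<circ> emb)"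
      by (rule continuous_map_eq[OF that]) (simp add: dec)
    then have "continuous_map (top_of_set ?E) euclidean (\<lambda>z. f (dec z))"
      by (rule continuous_compose_quotient_map[OF quot])
    then show ?thesis by simp
  qed
  define P where "P = (\<lambda>w. continuous_on ?E w \<and> (\<lambda>x\<in>?X. complex_of_real (w (emb x))) \<in> ?A)"
  have one_A: "(\<lambda>x\<in>?X. 1) \<in> ?A" by (rule generated_algebra.incl[OF one])
  have "\<exists>w. P w \<and> (\<forall>z\<in>?E. \<bar>u (dec z) - w z\<bar> < e)"
  proof (rule Stone_Weierstrass_HOL[OF compE])
    show "P (\<lambda>z. c)" for c
    proof -
      have "(\<lambda>x\<in>?X. complex_of_real c) = (\<lambda>x\<in>?X. complex_of_real c * (\<lambda>x\<in>?X. 1) x)"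
        by (rule restrict_ext) simp
      then show ?thesis unfolding P_def using generated_algebra.scale[OF one_A, of "complex_of_real c"] by simp
    qed
    show "continuous_on ?E w" if "P w" for w using that by (simp add: P_def)
    show "P (\<lambda>z. w z + w' z)" if "P w \<and> P w'" for w w'
    proof -
      have "(\<lambda>x\<in>?X. complex_of_real (w (emb x) + w' (emb x)))
        = (\<lambda>x\<in>?X. (\<lambda>x\<in>?X. complex_of_real (w (emb x))) x + (\<lambda>x\<in>?X. complex_of_real (w' (emb x))) x)"
        by (rule restrict_ext) simp
      then show ?thesis
        using that generated_algebra.add[of "\<lambda>x\<in>?X. complex_of_real (w (emb x))" ?X S "\<lambda>x\<in>?X. complex_of_real (w' (emb x))"]
        unfolding P_def by (simp only:) (blast intro: continuous_on_add)
    qed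
    show "P (\<lambda>z. w z * w' z)" if "P w \<and> P w'" for w w'
    proof -
      have "(\<lambda>x\<in>?X. complex_of_real (w (emb x) * w' (emb x)))
        = (\<lambda>x\<in>?X. (\<lambda>x\<in>?X. complex_of_real (w (emb x))) x * (\<lambda>x\<in>?X. complex_of_real (w' (emb x))) x)"
        by (rule restrict_ext) simp
      then show ?thesis
        using that generated_algebra.mult[of "\<lambda>x\<in>?X. complex_of_real (w (emb x))" ?X S "\<lambda>x\<in>?X. complex_of_real (w' (emb x))"]
        unfolding P_def by (simp only:) (blast intro: continuous_on_mult)
    qed
    show "\<exists>w. P w \<and> w z \<noteq> w z'" if zz: "z \<in> ?E \<and> z' \<in> ?E \<and> z \<noteq> z'" for z z'
    proof -
      obtain x y where xy: "x \<in> ?X" "y \<in> ?X" "z = emb x" "z' = emb y" using zz by auto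
      then have "x \<noteq> y" using zz by auto
      then obtain f where f: "f \<in> S" "f x \<noteq> f y" using sep xy by blast
      have fA: "f \<in> ?A" "(\<lambda>x\<in>?X. cnj (f x)) \<in> ?A"
        using f(1) cnj by (auto intro: generated_algebra.incl)
      have cf: "continuous_map T euclidean f" by (rule contS[OF f(1)])
      have R: "P (\<lambda>z. Re (f (dec z)))"
      proof -
        have "(\<lambda>x\<in>?X. complex_of_real (Re (f (dec (emb x))))) = (\<lambda>x\<in>?X. (1/2) * (\<lambda>x\<in>?X. f x + (\<lambda>x\<in>?X. cnj (f x)) x) x)"
          by (rule restrict_ext) (simp add: dec complex_add_cnj)
        moreover have "continuous_map T euclidean (\<lambda>x. Re (f x))"
          using cf unfolding continuous_map_atin limitin_canonical_iff by (auto intro!: tendsto_intros)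
        ultimately show ?thesis
          unfolding P_def using cont_dec[of "\<lambda>x. Re (f x)"]
            generated_algebra.scale[OF generated_algebra.add[OF fA], of "1/2"] by (simp only:)
      qed
      have I: "P (\<lambda>z. Im (f (dec z)))"
      proof -
        have "(\<lambda>x\<in>?X. complex_of_real (Im (f (dec (emb x)))))
          = (\<lambda>x\<in>?X. (- \<i>/2) * (\<lambda>x\<in>?X. f x + (\<lambda>x\<in>?X. (-1) * (\<lambda>x\<in>?X. cnj (f x)) x) x) x)"
          by (rule restrict_ext) (simp add: dec complex_eq_iff)
        moreover have "continuous_map T euclidean (\<lambda>x. Im (f x))"
          using cf unfolding continuous_map_atin limitin_canonical_iff by (auto intro!: tendsto_intros)
        ultimately show ?thesis
          unfolding P_def using cont_dec[of "\<lambda>x. Im (f x)"]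
            generated_algebra.scale[OF generated_algebra.add[OF fA(1) generated_algebra.scale[OF fA(2), of "-1"]], of "-\<i>/2"]
          by (simp only:)
      qed
      have "Re (f x) \<noteq> Re (f y) \<or> Im (f x) \<noteq> Im (f y)" using f(2) complex_eqI by blast
      then show ?thesis
      proof
        assume "Re (f x) \<noteq> Re (f y)"
        then show ?thesis using R xy by (intro exI[of _ "\<lambda>z. Re (f (dec z))"]) (simp add: dec)
      next
        assume "Im (f x) \<noteq> Im (f y)"
        then show ?thesis using I xy by (intro exI[of _ "\<lambda>z. Im (f (dec z))"]) (simp add: dec)
      qed
    qed
    show "continuous_on ?E (\<lambda>z. u (dec z))" by (rule cont_dec[OF u])
    show "e > 0" by fact
  qed
  then obtain w where w: "P w" "\<And>z. z \<in> ?E \<Longrightarrow> \<bar>u (dec z) - w z\<bar> < e" by auto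
  show thesis
  proof
    show "(\<lambda>x\<in>?X. complex_of_real (w (emb x))) \<in> ?A" using w(1) by (simp add: P_def)
    show "\<bar>u x - w (emb x)\<bar> < e" if "x \<in> ?X" for x using w(2)[of "emb x"] that by (simp add: dec)
  qed
qed

theorem complex_Stone_Weierstrass:
  assumes T: "compact_space T" "second_countable T" "Hausdorff_space T"
    and S: "S \<subseteq> mspace (C_complex T)" and one: "(\<lambda>x\<in>topspace T. 1) \<in> S"
    and cnj: "\<And>f. f \<in> S \<Longrightarrow> (\<lambda>x\<in>topspace T. cnj (f x)) \<in> S"
    and sep: "\<And>x y. x \<in> topspace T \<Longrightarrow> y \<in> topspace T \<Longrightarrow> x \<noteq> y \<Longrightarrow> \<exists>f\<in>S. f x \<noteq> f y"
  shows "mtopology_of (C_complex T) closure_of generated_algebra (topspace T) S = mspace (C_complex T)"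
proof -
  let ?X = "topspace T" and ?A = "generated_algebra (topspace T) S"
  interpret Metric_space "mspace (C_complex T)" "mdist (C_complex T)" by (rule Metric_space_mspace_mdist)
  have "\<exists>g\<in>?A. g \<in> mcball F r" if F: "F \<in> mspace (C_complex T)" and r: "r > 0" for F r
  proof -
    have cF: "continuous_map T euclidean F" using F mspace_C_complex[OF T(1)] by blast
    have cR: "continuous_map T euclidean (\<lambda>x. Re (F x))" and cI: "continuous_map T euclidean (\<lambda>x. Im (F x))"
      using cF unfolding continuous_map_atin limitin_canonical_iff by (auto intro!: tendsto_intros)
    have "r / 2 > 0" using r by simp
    obtain a where a: "(\<lambda>x\<in>?X. complex_of_real (a x)) \<in> ?A" "\<And>x. x \<in> ?X \<Longrightarrow> \<bar>Re (F x) - a x\<bar> < r / 2"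
      using real_approximation[OF T S one cnj sep cR \<open>r / 2 > 0\<close>] by metis
    obtain b where b: "(\<lambda>x\<in>?X. complex_of_real (b x)) \<in> ?A" "\<And>x. x \<in> ?X \<Longrightarrow> \<bar>Im (F x) - b x\<bar> < r / 2"
      using real_approximation[OF T S one cnj sep cI \<open>r / 2 > 0\<close>] by metis
    define g where "g = (\<lambda>x\<in>?X. (\<lambda>x\<in>?X. complex_of_real (a x)) x + (\<lambda>x\<in>?X. \<i> * (\<lambda>x\<in>?X. complex_of_real (b x)) x) x)"
    have g: "g \<in> ?A" unfolding g_def by (intro generated_algebra.add generated_algebra.scale a b)
    have "mdist (C_complex T) F g \<le> r"
    proof (rule mdist_cfunspace_le)
      fix x assume x: "x \<in> ?X"
      have "cmod (F x - g x) \<le> \<bar>Re (F x - g x)\<bar> + \<bar>Im (F x - g x)\<bar>" by (rule cmod_le)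
      also have "\<dots> \<le> r" using a(2)[OF x] b(2)[OF x] x by (simp add: g_def)
      finally show "mdist euclidean_metric (F x) (g x) \<le> r" by (simp add: dist_norm)
    qed (use r in simp)
    then show ?thesis using g F generated_algebra_mspace[OF T(1) S g] by (intro bexI[of _ g]) (auto simp del: mspace_cfunspace)
  qed
  then show ?thesis
    unfolding mtopology_of_def metric_closure_of_alt by blast
qed

section \<open>Sub-abelian nilspaces are topologically Abramov\<close>

text \<open>A face of codimension less than \<open>n\<close> is free in some direction \<open>j\<close>, and the two faces orthogonal to
  \<open>j\<close> contribute inverse factors.\<close>

lemma alternating_prod_face_generator:
  assumes P: "P \<in> codim_faces n i" and i: "i < n" and z: "cmod z = 1"
  shows "alternating_prod n (\<lambda>x. x) (\<lambda>v\<in>vertices n. if v \<in> P then z else 1) = 1"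
proof -
  obtain J e where J: "J \<subseteq> {..<n}" "card J = i" and P: "P = {v \<in> vertices n. \<forall>j\<in>J. v j = e j}"
    using P unfolding codim_faces_def by auto
  obtain m where m: "n = Suc m" using i by (cases n) auto
  have "J \<noteq> {..<n}" using J i by auto
  then obtain j where j: "j < n" "j \<notin> J" using J(1) by auto
  let ?u = "\<lambda>v\<in>vertices n. if v \<in> P then z else 1"
  have jm: "j \<le> m" using j m by simp
  have "insert_coord m j 1 w \<in> P \<longleftrightarrow> insert_coord m j 0 w \<in> P" if "w \<in> vertices m" for w
  proof -
    have "insert_coord m j 1 w l = insert_coord m j 0 w l" if "l \<in> J" for l
      using that j(2) J(1) by (auto simp: insert_coord_def)
    then show ?thesis
      using insert_coord_vertices[OF jm _ that] unfolding P m by simp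
  qed
  then have "alternating_prod m (\<lambda>x. x) (\<lambda>w. ?u (insert_coord m j 1 w)) = alternating_prod m (\<lambda>x. x) (\<lambda>w. ?u (insert_coord m j 0 w))"
    using insert_coord_vertices[OF jm] by (intro alternating_prod_cong) (simp add: m)
  moreover have "cmod (alternating_prod m (\<lambda>x. x) (\<lambda>w. ?u (insert_coord m j 0 w))) = 1"
    using insert_coord_vertices[OF jm] z by (intro norm_alternating_prod) (simp add: m)
  ultimately show ?thesis
    unfolding m alternating_prod_split[OF jm]
    by (simp add: complex_norm_square[symmetric])
qed

text \<open>Generators on faces of codimension at most \<open>k\<close> contribute trivially, and those of larger codimension
  are trivial because the filtration has ended.\<close>

lemma alternating_prod_group_cube:
  assumes A: "comm_group A" and F: "F (k + 1) = {\<one>\<^bsub>A\<^esub>}" "\<And>i. subgroup (F i) A" "\<And>i. F (i + 1) \<subseteq> F i"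
    and \<psi>: "\<And>x y. x \<in> carrier A \<Longrightarrow> y \<in> carrier A \<Longrightarrow> \<psi> (x \<otimes>\<^bsub>A\<^esub> y) = \<psi> x * \<psi> y"
      "\<And>x. x \<in> carrier A \<Longrightarrow> cmod (\<psi> x) = 1"
    and u: "u \<in> group_cubes A F (k + 1)"
  shows "alternating_prod (k + 1) \<psi> u = 1"
proof -
  interpret A: comm_group A by (rule A)
  let ?V = "vertices (k + 1)"
  let ?Pr = "product_group ?V (\<lambda>_. A)"
  let ?gens = "{(\<lambda>v\<in>?V. if v \<in> P then g else \<one>\<^bsub>A\<^esub>) | P g i. P \<in> codim_faces (k + 1) i \<and> g \<in> F i}"
  have FA: "F i \<subseteq> carrier A" for i using F(2) subgroup.subset by blast
  have "\<psi> \<one>\<^bsub>A\<^esub> * \<psi> \<one>\<^bsub>A\<^esub> = \<psi> \<one>\<^bsub>A\<^esub>" using \<psi>(1)[of "\<one>\<^bsub>A\<^esub>" "\<one>\<^bsub>A\<^esub>"] by simp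
  moreover have "\<psi> \<one>\<^bsub>A\<^esub> \<noteq> 0" using \<psi>(2)[of "\<one>\<^bsub>A\<^esub>"] by auto
  ultimately have \<psi>1: "\<psi> \<one>\<^bsub>A\<^esub> = 1" by simp
  have anti: "F j \<subseteq> F i" if "i \<le> j" for i j
    using lift_Suc_antimono_le[of F] F(3) that by simp
  have gens: "h \<in> ?V \<rightarrow>\<^sub>E carrier A \<and> alternating_prod (k + 1) \<psi> h = 1" if hg: "h \<in> ?gens" for h
  proof -
    obtain P g i where h: "h = (\<lambda>v\<in>?V. if v \<in> P then g else \<one>\<^bsub>A\<^esub>)" and P: "P \<in> codim_faces (k + 1) i" and g: "g \<in> F i"
      using hg unfolding mem_Collect_eq by (elim exE conjE) (rule that)
    have gA: "g \<in> carrier A" using g FA by blast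
    have "alternating_prod (k + 1) \<psi> h = alternating_prod (k + 1) (\<lambda>x. x) (\<lambda>v\<in>?V. if v \<in> P then \<psi> g else 1)"
      by (rule alternating_prod_cong) (simp add: h \<psi>1)
    also have "\<dots> = 1"
    proof (cases "i < k + 1")
      case True
      then show ?thesis using alternating_prod_face_generator[OF P True \<psi>(2)[OF gA]] by simp
    next
      case False
      then have "g = \<one>\<^bsub>A\<^esub>" using g anti[of "k + 1" i] F(1) by auto
      then show ?thesis by (intro alternating_prod_one) (simp add: \<psi>1)
    qed
    finally show ?thesis using gA by (auto simp: h)
  qed
  have "u \<in> ?V \<rightarrow>\<^sub>E carrier A \<and> alternating_prod (k + 1) \<psi> u = 1"
    using u unfolding group_cubes_def
  proof (induction rule: generate.induct)
    case one
    show ?case by (auto simp: \<psi>1 intro!: alternating_prod_one)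
  next
    case (incl h)
    then show ?case by (rule gens)
  next
    case (inv h)
    have h: "h \<in> ?V \<rightarrow>\<^sub>E carrier A" "alternating_prod (k + 1) \<psi> h = 1" using gens[OF inv] by auto
    have ih: "inv\<^bsub>?Pr\<^esub> h = (\<lambda>v\<in>?V. inv\<^bsub>A\<^esub> h v)"
      by (rule inv_product_group) (rule h(1), rule A.is_group)
    have inv_cnj: "\<psi> (inv\<^bsub>A\<^esub> x) = cnj (\<psi> x)" if "x \<in> carrier A" for x
    proof -
      have "\<psi> x * \<psi> (inv\<^bsub>A\<^esub> x) = 1" using \<psi>(1)[of x "inv\<^bsub>A\<^esub> x"] that \<psi>1 by simp
      moreover have "\<psi> x * cnj (\<psi> x) = 1" using \<psi>(2)[OF that] by (simp add: complex_norm_square[symmetric])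
      moreover have "\<psi> x \<noteq> 0" using \<psi>(2)[OF that] by auto
      ultimately show ?thesis by (metis mult_left_cancel)
    qed
    have "alternating_prod (k + 1) \<psi> (\<lambda>v\<in>?V. inv\<^bsub>A\<^esub> h v) = alternating_prod (k + 1) (\<lambda>x. cnj (\<psi> x)) h"
      by (rule alternating_prod_cong) (simp del: add_Suc_right One_nat_def add: inv_cnj[OF PiE_mem[OF h(1)]])
    then have "alternating_prod (k + 1) \<psi> (\<lambda>v\<in>?V. inv\<^bsub>A\<^esub> h v) = 1"
      using h(2) by (simp only: alternating_prod_cnj complex_cnj_one)
    moreover have "(\<lambda>v\<in>?V. inv\<^bsub>A\<^esub> h v) \<in> ?V \<rightarrow>\<^sub>E carrier A"
      by (rule restrict_PiE_iff[THEN iffD2], rule ballI, rule A.inv_closed, rule PiE_mem[OF h(1)])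
    ultimately show ?case unfolding ih by (rule conjI[rotated])
  next
    case (eng h1 h2)
    have mem: "h1 \<in> ?V \<rightarrow>\<^sub>E carrier A" "h2 \<in> ?V \<rightarrow>\<^sub>E carrier A" using eng.IH by blast+
    have "alternating_prod (k + 1) \<psi> (h1 \<otimes>\<^bsub>?Pr\<^esub> h2)
        = alternating_prod (k + 1) (\<lambda>p. \<psi> (fst p) * \<psi> (snd p)) (\<lambda>v. (h1 v, h2 v))"
      by (rule alternating_prod_cong) (simp del: add_Suc_right One_nat_def
          add: \<psi>(1)[OF PiE_mem[OF mem(1)] PiE_mem[OF mem(2)]])
    also have "\<dots> = alternating_prod (k + 1) \<psi> h1 * alternating_prod (k + 1) \<psi> h2"
      unfolding alternating_prod_mult
      by (intro arg_cong2[of _ _ _ _ "(*)"] alternating_prod_cong) simp_all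
    also have "\<dots> = 1" using eng.IH by (simp only: mult_1_left)
    finally have "alternating_prod (k + 1) \<psi> (h1 \<otimes>\<^bsub>?Pr\<^esub> h2) = 1" .
    moreover have "h1 \<otimes>\<^bsub>?Pr\<^esub> h2 \<in> ?V \<rightarrow>\<^sub>E carrier A"
      unfolding mult_product_group
      by (rule restrict_PiE_iff[THEN iffD2], rule ballI, rule A.m_closed)
        (rule PiE_mem[OF mem(1)], assumption, rule PiE_mem[OF mem(2)])
    ultimately show ?case by (rule conjI[rotated])
  qed
  then show ?thesis by simp
qed

context nilspace_action
begin

lemma phase_polynomials_iff:
  "f \<in> phase_polynomials T G \<phi> k \<longleftrightarrow> f \<in> mspace (C_complex T) \<and> derivatives_trivial (k + 1) f"
  by (simp add: phase_polynomials_def derivatives_trivial_def del: mspace_cfunspace)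

lemma one_phase_polynomial: "(\<lambda>x\<in>topspace T. 1) \<in> phase_polynomials T G \<phi> k"
proof -
  have "derivatives_trivial (k + 1) (\<lambda>x\<in>topspace T. 1)"
    by (intro derivatives_trivial_if_cubes alternating_prod_one) (simp add: cube_in_space)
  then show ?thesis
    unfolding phase_polynomials_iff mspace_C_complex[OF compact] by (simp add: continuous_map_restrict)
qed

lemma cnj_phase_polynomial:
  assumes "f \<in> phase_polynomials T G \<phi> k"
  shows "(\<lambda>x\<in>topspace T. cnj (f x)) \<in> phase_polynomials T G \<phi> k"
proof -
  have f: "continuous_map T euclidean f" "derivatives_trivial (k + 1) f"
    using assms by (simp_all add: phase_polynomials_iff mspace_C_complex[OF compact])
  have "continuous_map T euclidean (\<lambda>x. cnj (f x))"
    using f(1) unfolding continuous_map_atin limitin_canonical_iff by (auto intro!: tendsto_intros)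
  moreover have "derivatives_trivial (k + 1) (\<lambda>x\<in>topspace T. cnj (f x))"
    by (rule derivatives_trivial_cong[OF _ derivatives_trivial_cnj[OF f(2)]]) simp
  ultimately show ?thesis
    unfolding phase_polynomials_iff mspace_C_complex[OF compact] by (simp add: continuous_map_restrict)
qed

text \<open>Characters composed with the embedding are phase polynomials, and they separate points.\<close>

theorem topological_Abramov_if_sub_abelian:
  assumes "sub_abelian TYPE('b) k T C"
  shows "topological_Abramov k T G \<phi>"
proof -
  obtain A :: "'b monoid" and S F f where A: "compact_abelian_group A S" and F: "closed_filtration k A S F"
    and f: "nilspace_morphism (topspace T) C (carrier A) (group_cubes A F) f" "continuous_map T S f" "inj_on f (topspace T)"
    using assms unfolding sub_abelian_def by blast
  interpret A: compact_abelian_group A S by (rule A)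
  let ?S = "phase_polynomials T G \<phi> k"
  have fA: "f x \<in> carrier A" if "x \<in> topspace T" for x
    using f(1) that by (auto simp: nilspace_morphism_def)
  show ?thesis
    unfolding topological_Abramov_def
  proof (rule complex_Stone_Weierstrass[OF compact second_countable Hausdorff])
    show "?S \<subseteq> mspace (C_complex T)" by (auto simp: phase_polynomials_iff simp del: mspace_cfunspace)
    show "(\<lambda>x\<in>topspace T. 1) \<in> ?S" by (rule one_phase_polynomial)
    show "(\<lambda>x\<in>topspace T. cnj (h x)) \<in> ?S" if "h \<in> ?S" for h by (rule cnj_phase_polynomial[OF that])
    fix x y assume x: "x \<in> topspace T" and y: "y \<in> topspace T" and "x \<noteq> y"
    have "f x \<noteq> f y" using inj_onD[OF f(3) _ x y] \<open>x \<noteq> y\<close> by blast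
    obtain \<psi> where \<psi>: "continuous_map S euclidean \<psi>"
      "\<And>x y. x \<in> carrier A \<Longrightarrow> y \<in> carrier A \<Longrightarrow> \<psi> (x \<otimes>\<^bsub>A\<^esub> y) = \<psi> x * \<psi> y"
      "\<And>x. x \<in> carrier A \<Longrightarrow> cmod (\<psi> x) = 1" "\<psi> (f x) \<noteq> \<psi> (f y)"
      by (rule A.characters_separate_points[OF fA[OF x] fA[OF y] \<open>f x \<noteq> f y\<close>]) (rule that)
    define h where "h = (\<lambda>x\<in>topspace T. \<psi> (f x))"
    have "derivatives_trivial (k + 1) h"
    proof (rule derivatives_trivial_if_cubes)
      fix c assume c: "c \<in> C (k + 1)"
      have "compose (vertices (k + 1)) f c \<in> group_cubes A F (k + 1)"
        using f(1) c by (simp add: nilspace_morphism_def)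
      then have "alternating_prod (k + 1) \<psi> (compose (vertices (k + 1)) f c) = 1"
        by (intro alternating_prod_group_cube[OF A.comm_group_axioms _ _ _ \<psi>(2,3)])
          (use F in \<open>auto simp: closed_filtration_def\<close>)
      moreover have "alternating_prod (k + 1) h c = alternating_prod (k + 1) \<psi> (compose (vertices (k + 1)) f c)"
        by (rule alternating_prod_cong) (simp add: h_def compose_def cube_in_space[OF c])
      ultimately show "alternating_prod (k + 1) h c = 1" by simp
    qed
    moreover have "continuous_map T euclidean (\<lambda>x. \<psi> (f x))"
      using continuous_map_compose[OF f(2) \<psi>(1)] by (simp add: comp_def)
    ultimately have "h \<in> ?S"
      unfolding phase_polynomials_iff mspace_C_complex[OF compact] h_def by (simp add: continuous_map_restrict)
    moreover have "h x \<noteq> h y" using \<psi>(4) x y by (simp add: h_def)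
    ultimately show "\<exists>f\<in>?S. f x \<noteq> f y" by blast
  qed
qed

end

section \<open>Torus-valued polynomial maps on cubes\<close>

lemma affine_maps_vertices: "\<psi> \<in> affine_maps m n \<Longrightarrow> v \<in> vertices m \<Longrightarrow> \<psi> v \<in> vertices n"
  by (auto simp: affine_maps_def)

lemma affine_maps_insert_const:
  assumes \<psi>: "\<psi> \<in> affine_maps m n" and b: "b = 0 \<or> b = 1"
  shows "(\<lambda>v. insert_coord n n b (\<psi> v)) \<in> affine_maps m (Suc n)"
proof -
  obtain a c where ac: "\<forall>v\<in>vertices m. \<forall>j<n. \<psi> v j = c j + (\<Sum>i<m. a j i * v i)"
    using \<psi> unfolding affine_maps_def by blast
  define a' :: "nat \<Rightarrow> nat \<Rightarrow> int" where "a' j i = (if j < n then a j i else 0)" for j i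
  define c' where "c' j = (if j < n then c j else b)" for j
  have "insert_coord n n b (\<psi> v) j = c' j + (\<Sum>i<m. a' j i * v i)" if "v \<in> vertices m" "j < Suc n" for v j
    using ac that by (cases "j = n") (simp_all add: insert_coord_def a'_def c'_def)
  then show ?thesis
    unfolding affine_maps_def using insert_coord_vertices[OF order_refl b affine_maps_vertices[OF \<psi>]] by blast
qed

lemma affine_maps_insert_var:
  assumes \<psi>: "\<psi> \<in> affine_maps m n"
  shows "(\<lambda>v. insert_coord n n (v m) (\<psi> (restrict v {..<m}))) \<in> affine_maps (Suc m) (Suc n)"
proof -
  obtain a c where ac: "\<forall>v\<in>vertices m. \<forall>j<n. \<psi> v j = c j + (\<Sum>i<m. a j i * v i)"
    using \<psi> unfolding affine_maps_def by blast
  define a' :: "nat \<Rightarrow> nat \<Rightarrow> int" where "a' j i = (if j < n then (if i < m then a j i else 0) else of_bool (i = m))" for j i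
  define c' where "c' j = (if j < n then c j else 0)" for j
  have res: "restrict v {..<m} \<in> vertices m" if "v \<in> vertices (Suc m)" for v
    using affine_maps_vertices[OF drop_last_coord_affine that] by simp
  have "insert_coord n n (v m) (\<psi> (restrict v {..<m})) j = c' j + (\<Sum>i<Suc m. a' j i * v i)"
    if "v \<in> vertices (Suc m)" "j < Suc n" for v j
  proof (cases "j = n")
    case True
    then show ?thesis by (simp add: insert_coord_def a'_def c'_def)
  next
    case False
    then show ?thesis using ac res[OF that(1)] that(2) by (simp add: insert_coord_def a'_def c'_def)
  qed
  moreover have "insert_coord n n (v m) (\<psi> (restrict v {..<m})) \<in> vertices (Suc n)" if "v \<in> vertices (Suc m)" for v
    by (rule insert_coord_vertices[OF order_refl vertices_D[OF that] affine_maps_vertices[OF \<psi> res[OF that]]]) simp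
  ultimately show ?thesis unfolding affine_maps_def by blast
qed

definition torus :: "(nat \<Rightarrow> complex) set"
  where "torus = {z. \<forall>i. cmod (z i) = 1}"

text \<open>The same operations serve the infinite torus and the trivial group.\<close>

definition pointwise_group :: "(nat \<Rightarrow> complex) set \<Rightarrow> (nat \<Rightarrow> complex) monoid"
  where "pointwise_group W = \<lparr>carrier = W, monoid.mult = (\<lambda>z w i. z i * w i), one = (\<lambda>_. 1)\<rparr>"

lemma pointwise_group_simps [simp]:
  "carrier (pointwise_group W) = W" "z \<otimes>\<^bsub>pointwise_group W\<^esub> w = (\<lambda>i. z i * w i)"
  "\<one>\<^bsub>pointwise_group W\<^esub> = (\<lambda>_. 1)"
  by (simp_all add: pointwise_group_def)

lemma torus_cnj: "z \<in> torus \<Longrightarrow> z i * cnj (z i) = 1"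
  by (simp add: torus_def complex_norm_square[symmetric])

lemma pointwise_comm_group:
  assumes "W \<subseteq> torus" "(\<lambda>_. 1) \<in> W" "\<And>z w. z \<in> W \<Longrightarrow> w \<in> W \<Longrightarrow> (\<lambda>i. z i * w i) \<in> W"
    "\<And>z. z \<in> W \<Longrightarrow> (\<lambda>i. cnj (z i)) \<in> W"
  shows "comm_group (pointwise_group W)"
    and "z \<in> W \<Longrightarrow> inv\<^bsub>pointwise_group W\<^esub> z = (\<lambda>i. cnj (z i))"
proof -
  show g: "comm_group (pointwise_group W)"
  proof (rule comm_groupI)
    fix z assume z: "z \<in> carrier (pointwise_group W)"
    then have "(\<lambda>i. cnj (z i)) \<otimes>\<^bsub>pointwise_group W\<^esub> z = \<one>\<^bsub>pointwise_group W\<^esub>"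
      using assms(1) torus_cnj[of z] by (auto simp: fun_eq_iff mult.commute)
    then show "\<exists>y\<in>carrier (pointwise_group W). y \<otimes>\<^bsub>pointwise_group W\<^esub> z = \<one>\<^bsub>pointwise_group W\<^esub>"
      using assms(4) z by (intro bexI[of _ "\<lambda>i. cnj (z i)"]) auto
  qed (use assms in \<open>auto simp: ac_simps\<close>)
  interpret comm_group "pointwise_group W" by (rule g)
  show "inv\<^bsub>pointwise_group W\<^esub> z = (\<lambda>i. cnj (z i))" if "z \<in> W"
    by (rule inv_equality) (use that assms torus_cnj[of z] in \<open>auto simp: fun_eq_iff mult.commute\<close>)
qed

lemma compact_torus: "compact torus"
proof -
  have "torus = PiE UNIV (\<lambda>_. sphere 0 1)" by (auto simp: torus_def)
  moreover have "compact (PiE UNIV (\<lambda>_ :: nat. sphere (0 :: complex) 1))"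
    unfolding compactin_euclidean_iff[symmetric] euclidean_product_topology[symmetric] compactin_PiE by auto
  ultimately show ?thesis by simp
qed

lemma continuous_map_pointwise:
  fixes f :: "'x \<Rightarrow> nat \<Rightarrow> complex"
  shows "continuous_map X euclidean f \<longleftrightarrow> (\<forall>i. continuous_map X euclidean (\<lambda>x. f x i))"
  unfolding euclidean_product_topology[symmetric] continuous_map_componentwise_UNIV ..

lemma second_countable_euclidean: "second_countable (euclidean :: 'x::second_countable_topology topology)"
proof -
  obtain B :: "'x set set" where B: "countable B" "topological_basis B" using ex_countable_basis by blast
  then show ?thesis
    unfolding second_countable_def
  proof (intro exI conjI ballI allI impI)
    show "countable B" by (rule B(1))
    show "openin euclidean V" if "V \<in> B" for V using topological_basis_open[OF B(2) that] by simp
    fix U :: "'x set" and x assume "openin euclidean U \<and> x \<in> U"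
    then have "open U" "x \<in> U" by simp_all
    then show "\<exists>V\<in>B. x \<in> V \<and> V \<subseteq> U" using topological_basisE[OF B(2)] by metis
  qed
qed

lemma pointwise_compact_abelian_group:
  assumes "W \<subseteq> torus" "(\<lambda>_. 1) \<in> W" "\<And>z w. z \<in> W \<Longrightarrow> w \<in> W \<Longrightarrow> (\<lambda>i. z i * w i) \<in> W"
    "\<And>z. z \<in> W \<Longrightarrow> (\<lambda>i. cnj (z i)) \<in> W" "compact W"
  shows "compact_abelian_group (pointwise_group W) (top_of_set W)"
proof -
  interpret comm_group "pointwise_group W" by (rule pointwise_comm_group(1)[OF assms(1-4)])
  have id: "continuous_map (top_of_set W) euclidean (\<lambda>z. z)" by (simp add: continuous_map_from_subtopology)
  then have coord: "continuous_map (top_of_set W) euclidean (\<lambda>z. z i)" for i by (simp add: continuous_map_pointwise)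
  show ?thesis
  proof unfold_locales
    show "topspace (top_of_set W) = carrier (pointwise_group W)" by simp
    show "compact_space (top_of_set W)" using assms(5) by (simp add: compact_space_subtopology)
    show "second_countable (top_of_set W)" by (intro second_countable_subtopology second_countable_euclidean)
    show "Hausdorff_space (top_of_set W)" by (simp add: Hausdorff_space_subtopology)
    have "continuous_map (prod_topology (top_of_set W) (top_of_set W)) euclidean (\<lambda>p. fst p i * snd p i)" for i
    proof -
      have "continuous_map (prod_topology (top_of_set W) (top_of_set W)) euclidean (\<lambda>p. fst p i)"
        by (rule continuous_map_compose[OF continuous_map_fst coord, unfolded comp_def])
      moreover have "continuous_map (prod_topology (top_of_set W) (top_of_set W)) euclidean (\<lambda>p. snd p i)"
        by (rule continuous_map_compose[OF continuous_map_snd coord, unfolded comp_def])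
      ultimately show ?thesis
        unfolding continuous_map_atin limitin_canonical_iff by (auto intro!: tendsto_intros)
    qed
    then show "continuous_map (prod_topology (top_of_set W) (top_of_set W)) (top_of_set W)
        (\<lambda>(x, y). x \<otimes>\<^bsub>pointwise_group W\<^esub> y)"
      unfolding continuous_map_in_subtopology continuous_map_pointwise using assms(3)
      by (auto simp: case_prod_unfold)
    have "continuous_map (top_of_set W) euclidean (\<lambda>z. cnj (z i))" for i
      using coord[of i] unfolding continuous_map_atin limitin_canonical_iff by (auto intro!: tendsto_intros)
    then have "continuous_map (top_of_set W) (top_of_set W) (\<lambda>z i. cnj (z i))"
      unfolding continuous_map_in_subtopology continuous_map_pointwise using assms(4) by auto
    then show "continuous_map (top_of_set W) (top_of_set W) (\<lambda>x. inv\<^bsub>pointwise_group W\<^esub> x)"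
      by (rule continuous_map_eq) (simp add: pointwise_comm_group(2)[OF assms(1-4)])
  qed
qed

lemma torus_closed:
  "(\<lambda>_. 1) \<in> torus" "z \<in> torus \<Longrightarrow> w \<in> torus \<Longrightarrow> (\<lambda>i. z i * w i) \<in> torus"
  "z \<in> torus \<Longrightarrow> (\<lambda>i. cnj (z i)) \<in> torus"
  by (simp_all add: torus_def norm_mult)

definition face_generators :: "nat \<Rightarrow> nat \<Rightarrow> ((nat \<Rightarrow> int) \<Rightarrow> nat \<Rightarrow> complex) set"
  where "face_generators n d =
    {(\<lambda>v\<in>vertices n. if v \<in> P then g else (\<lambda>_. 1)) | P g i. P \<in> codim_faces n i \<and> g \<in> torus \<and> i < d}"

abbreviation torus_power :: "nat \<Rightarrow> ((nat \<Rightarrow> int) \<Rightarrow> nat \<Rightarrow> complex) monoid"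
  where "torus_power n \<equiv> product_group (vertices n) (\<lambda>_. pointwise_group torus)"

lemma face_generators_carrier: "h \<in> face_generators n d \<Longrightarrow> h \<in> vertices n \<rightarrow>\<^sub>E torus"
  by (auto simp: face_generators_def torus_closed)

lemma group_torus_power: "group (torus_power n)"
  by (rule product_group, rule comm_group.axioms(2), rule pointwise_comm_group(1)[OF order_refl torus_closed])

lemma torus_power_inv:
  assumes "h \<in> vertices n \<rightarrow>\<^sub>E torus"
  shows "inv\<^bsub>torus_power n\<^esub> h = (\<lambda>v\<in>vertices n. \<lambda>i. cnj (h v i))"
proof -
  have T: "torus \<subseteq> torus" by simp
  have g1: "comm_group (pointwise_group torus)" by (rule pointwise_comm_group(1)[OF T torus_closed])
  have g2: "inv\<^bsub>pointwise_group torus\<^esub> z = (\<lambda>i. cnj (z i))" if "z \<in> torus" for z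
    by (rule pointwise_comm_group(2)[OF T torus_closed that])
  have "inv\<^bsub>torus_power n\<^esub> h = (\<lambda>v\<in>vertices n. inv\<^bsub>pointwise_group torus\<^esub> (h v))"
  proof (rule inv_product_group)
    show "h \<in> vertices n \<rightarrow>\<^sub>E carrier (pointwise_group torus)" using assms by simp
    show "group (pointwise_group torus)" by (rule comm_group.axioms(2)[OF g1])
  qed
  also have "\<dots> = (\<lambda>v\<in>vertices n. \<lambda>i. cnj (h v i))"
    by (rule restrict_ext, rule g2) (rule PiE_mem[OF assms])
  finally show ?thesis .
qed

text \<open>With \<open>p\<close> constantly true this extends \<open>u\<close> constantly along the new last coordinate; with
  \<open>p v \<longleftrightarrow> v n = 1\<close> it places \<open>u\<close> on the upper face.\<close>

definition extend_cube :: "nat \<Rightarrow> ((nat \<Rightarrow> int) \<Rightarrow> bool) \<Rightarrow> ((nat \<Rightarrow> int) \<Rightarrow> nat \<Rightarrow> complex) \<Rightarrow> (nat \<Rightarrow> int) \<Rightarrow> nat \<Rightarrow> complex"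
  where "extend_cube n p u = (\<lambda>v\<in>vertices (Suc n). if p v then u (restrict v {..<n}) else (\<lambda>_. 1))"

lemma drop_last_coord_vertices: "v \<in> vertices (Suc n) \<Longrightarrow> restrict v {..<n} \<in> vertices n"
  using affine_maps_vertices[OF drop_last_coord_affine] by simp

lemma extend_cube_generate:
  assumes gens: "\<And>h. h \<in> face_generators n d \<Longrightarrow> extend_cube n p h \<in> face_generators (Suc n) d'"
    and u: "u \<in> generate (torus_power n) (face_generators n d)"
  shows "extend_cube n p u \<in> generate (torus_power (Suc n)) (face_generators (Suc n) d')"
  using u
proof (induction rule: generate.induct)
  case one
  have "extend_cube n p \<one>\<^bsub>torus_power n\<^esub> = \<one>\<^bsub>torus_power (Suc n)\<^esub>"
    unfolding extend_cube_def one_product_group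
    by (rule restrict_ext) (simp add: drop_last_coord_vertices)
  then show ?case by (simp only: generate.one)
next
  case (incl h)
  then show ?case by (intro generate.incl gens)
next
  case (inv h)
  have "extend_cube n p (inv\<^bsub>torus_power n\<^esub> h) = inv\<^bsub>torus_power (Suc n)\<^esub> (extend_cube n p h)"
    unfolding torus_power_inv[OF face_generators_carrier[OF inv]]
      torus_power_inv[OF face_generators_carrier[OF gens[OF inv]]]
    unfolding extend_cube_def by (rule restrict_ext) (simp add: drop_last_coord_vertices)
  then show ?case using generate.inv[OF gens[OF inv]] by (simp only:)
next
  case (eng h1 h2)
  have "extend_cube n p (h1 \<otimes>\<^bsub>torus_power n\<^esub> h2) = extend_cube n p h1 \<otimes>\<^bsub>torus_power (Suc n)\<^esub> extend_cube n p h2"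
    unfolding mult_product_group unfolding extend_cube_def
    by (rule restrict_ext) (simp add: drop_last_coord_vertices)
  then show ?case using generate.eng[OF eng.IH] by (simp only:)
qed

lemma extend_face_generator:
  assumes "h \<in> face_generators n d"
  shows "extend_cube n (\<lambda>_. True) h \<in> face_generators (Suc n) d"
proof -
  obtain P g i where h: "h = (\<lambda>v\<in>vertices n. if v \<in> P then g else (\<lambda>_. 1))"
    and P: "P \<in> codim_faces n i" and g: "g \<in> torus" "i < d"
    using assms unfolding face_generators_def by blast
  obtain J e where J: "J \<subseteq> {..<n}" "card J = i" "e \<in> J \<rightarrow> {0, 1}" and P': "P = {v \<in> vertices n. \<forall>j\<in>J. v j = e j}"
    using P unfolding codim_faces_def by blast
  let ?P = "{v \<in> vertices (Suc n). \<forall>j\<in>J. v j = e j}"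
  have "?P \<in> codim_faces (Suc n) i" unfolding codim_faces_def using J by fastforce
  moreover have "extend_cube n (\<lambda>_. True) h = (\<lambda>v\<in>vertices (Suc n). if v \<in> ?P then g else (\<lambda>_. 1))"
    unfolding extend_cube_def
  proof (rule restrict_ext)
    fix v assume v: "v \<in> vertices (Suc n)"
    have "restrict v {..<n} \<in> P \<longleftrightarrow> v \<in> ?P"
      using drop_last_coord_vertices[OF v] v J(1) unfolding P' by auto
    then show "(if True then h (restrict v {..<n}) else (\<lambda>_. 1)) = (if v \<in> ?P then g else (\<lambda>_. 1))"
      using drop_last_coord_vertices[OF v] by (simp add: h)
  qed
  ultimately show ?thesis unfolding face_generators_def using g by blast
qed

lemma extend_face_generator_top:
  assumes "h \<in> face_generators n d"
  shows "extend_cube n (\<lambda>v. v n = 1) h \<in> face_generators (Suc n) (Suc d)"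
proof -
  obtain P g i where h: "h = (\<lambda>v\<in>vertices n. if v \<in> P then g else (\<lambda>_. 1))"
    and P: "P \<in> codim_faces n i" and g: "g \<in> torus" "i < d"
    using assms unfolding face_generators_def by blast
  obtain J e where J: "J \<subseteq> {..<n}" "card J = i" "e \<in> J \<rightarrow> {0, 1}" and P': "P = {v \<in> vertices n. \<forall>j\<in>J. v j = e j}"
    using P unfolding codim_faces_def by blast
  let ?P = "{v \<in> vertices (Suc n). \<forall>j\<in>insert n J. v j = (e(n := 1)) j}"
  have "finite J" "n \<notin> J" using J(1) finite_subset by auto
  then have "insert n J \<subseteq> {..<Suc n}" "card (insert n J) = Suc i" "e(n := 1) \<in> insert n J \<rightarrow> {0, 1}"
    using J by auto
  then have "?P \<in> codim_faces (Suc n) (Suc i)" unfolding codim_faces_def by blast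
  moreover have "extend_cube n (\<lambda>v. v n = 1) h = (\<lambda>v\<in>vertices (Suc n). if v \<in> ?P then g else (\<lambda>_. 1))"
    unfolding extend_cube_def
  proof (rule restrict_ext)
    fix v assume v: "v \<in> vertices (Suc n)"
    have "v n = 1 \<and> restrict v {..<n} \<in> P \<longleftrightarrow> v \<in> ?P"
      using drop_last_coord_vertices[OF v] v J(1) \<open>n \<notin> J\<close> unfolding P' by auto
    then show "(if v n = 1 then h (restrict v {..<n}) else (\<lambda>_. 1)) = (if v \<in> ?P then g else (\<lambda>_. 1))"
      using drop_last_coord_vertices[OF v] by (auto simp: h)
  qed
  ultimately show ?thesis unfolding face_generators_def using g by blast
qed

text \<open>Split \<open>u\<close> into the constant extension of its lower face and, on the upper face, the quotient \<open>r\<close> of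
  the two faces. The quotient needs one derivative less, and placing it on the upper face raises the
  codimension of its generators by one, so both factors have generators of admissible codimension.
  Quantifying over all affine maps makes the hypothesis inherited by both parts.\<close>

lemma generated_if_alternating_prods_trivial:
  assumes "u \<in> vertices n \<rightarrow>\<^sub>E torus"
    and "\<And>m \<psi> i. \<lbrakk>d \<le> m; \<psi> \<in> affine_maps m n\<rbrakk> \<Longrightarrow> alternating_prod m (\<lambda>z. z i) (\<lambda>v. u (\<psi> v)) = 1"
  shows "u \<in> generate (torus_power n) (face_generators n d)"
  using assms
proof (induction n arbitrary: d u)
  case 0
  have u: "u = (\<lambda>v\<in>vertices 0. u (\<lambda>_. undefined))"
  proof (rule extensionalityI[of _ "vertices 0"])
    show "u \<in> extensional (vertices 0)" using 0(1) by (simp add: PiE_def)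
  qed (simp_all add: vertices_0)
  show ?case
  proof (cases d)
    case 0
    have "u (\<lambda>_. undefined) = (\<lambda>_. 1)"
    proof
      fix i
      have "(\<lambda>v. v) \<in> affine_maps 0 0" by (simp add: affine_maps_def)
      from "0.prems"(2)[OF _ this, of i] show "u (\<lambda>_. undefined) i = 1"
        using 0 by (simp add: alternating_prod_0)
    qed
    then have "u = \<one>\<^bsub>torus_power 0\<^esub>" using u by simp
    then show ?thesis by (simp only: generate.one)
  next
    case (Suc d')
    have "vertices 0 \<in> codim_faces 0 0" unfolding codim_faces_def by auto
    moreover have "u (\<lambda>_. undefined) \<in> torus" using 0(1) by (auto simp: vertices_0)
    moreover have "u = (\<lambda>v\<in>vertices 0. if v \<in> vertices 0 then u (\<lambda>_. undefined) else (\<lambda>_. 1))"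
      by (rule trans[OF u restrict_ext]) simp
    ultimately have "u \<in> face_generators 0 d" unfolding face_generators_def Suc by blast
    then show ?thesis by (rule generate.incl)
  qed
next
  case (Suc n)
  note ins = insert_coord_vertices[OF order_refl]
  have uT: "u v \<in> torus" if "v \<in> vertices (Suc n)" for v using Suc.prems(1) that by auto
  show ?case
  proof (cases d)
    case 0
    have "u v = (\<lambda>_. 1)" if v: "v \<in> vertices (Suc n)" for v
    proof
      fix i
      have "(\<lambda>_. v) \<in> affine_maps 0 (Suc n)"
        using v unfolding affine_maps_def by (auto intro!: exI[of _ "v"])
      from Suc.prems(2)[OF _ this, of i] show "u v i = 1" using 0 by (simp add: alternating_prod_0)
    qed
    then have "u = \<one>\<^bsub>torus_power (Suc n)\<^esub>"
      using Suc.prems(1) by (auto simp: fun_eq_iff PiE_iff extensional_def)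
    then show ?thesis by (simp only: generate.one)
  next
    case (Suc d')
    define u0 where "u0 = (\<lambda>w\<in>vertices n. u (insert_coord n n 0 w))"
    define r where "r = (\<lambda>w\<in>vertices n. \<lambda>i. u (insert_coord n n 1 w) i * cnj (u (insert_coord n n 0 w) i))"
    have u0: "u0 \<in> generate (torus_power n) (face_generators n d)"
    proof (rule Suc.IH)
      show "u0 \<in> vertices n \<rightarrow>\<^sub>E torus" using uT ins by (auto simp: u0_def)
      fix m \<psi> i assume m: "d \<le> m" and \<psi>: "\<psi> \<in> affine_maps m n"
      have "alternating_prod m (\<lambda>z. z i) (\<lambda>v. u0 (\<psi> v)) = alternating_prod m (\<lambda>z. z i) (\<lambda>v. u (insert_coord n n 0 (\<psi> v)))"
        by (rule alternating_prod_cong) (simp add: u0_def affine_maps_vertices[OF \<psi>])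
      also have "\<dots> = 1" by (rule Suc.prems(2)[OF m affine_maps_insert_const[OF \<psi>]]) simp
      finally show "alternating_prod m (\<lambda>z. z i) (\<lambda>v. u0 (\<psi> v)) = 1" .
    qed
    have g0: "extend_cube n (\<lambda>_. True) u0 \<in> generate (torus_power (Suc n)) (face_generators (Suc n) d)"
      by (rule extend_cube_generate[OF _ u0]) (rule extend_face_generator)
    have r: "r \<in> generate (torus_power n) (face_generators n d')"
    proof (rule Suc.IH)
      show "r \<in> vertices n \<rightarrow>\<^sub>E torus" using uT ins by (auto simp: r_def intro!: torus_closed)
      fix m \<psi> i assume m: "d' \<le> m" and \<psi>: "\<psi> \<in> affine_maps m n"
      let ?\<psi>' = "\<lambda>v. insert_coord n n (v m) (\<psi> (restrict v {..<m}))"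
      have "1 = alternating_prod (Suc m) (\<lambda>z. z i) (\<lambda>v. u (?\<psi>' v))"
        by (rule Suc.prems(2)[OF _ affine_maps_insert_var[OF \<psi>], symmetric]) (use m Suc in simp)
      also have "\<dots> = alternating_prod m (\<lambda>z. z i) (\<lambda>w. u (?\<psi>' (insert_coord m m 1 w)))
          * cnj (alternating_prod m (\<lambda>z. z i) (\<lambda>w. u (?\<psi>' (insert_coord m m 0 w))))"
        by (rule alternating_prod_split) simp
      also have "alternating_prod m (\<lambda>z. z i) (\<lambda>w. u (?\<psi>' (insert_coord m m 1 w)))
          = alternating_prod m (\<lambda>w. u (insert_coord n n 1 (\<psi> w)) i) (\<lambda>w. w)"
        by (rule alternating_prod_cong) (simp add: insert_last_coord)
      also have "alternating_prod m (\<lambda>z. z i) (\<lambda>w. u (?\<psi>' (insert_coord m m 0 w)))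
          = alternating_prod m (\<lambda>w. u (insert_coord n n 0 (\<psi> w)) i) (\<lambda>w. w)"
        by (rule alternating_prod_cong) (simp add: insert_last_coord)
      also have "alternating_prod m (\<lambda>w. u (insert_coord n n 1 (\<psi> w)) i) (\<lambda>w. w)
          * cnj (alternating_prod m (\<lambda>w. u (insert_coord n n 0 (\<psi> w)) i) (\<lambda>w. w))
          = alternating_prod m (\<lambda>z. z i) (\<lambda>v. r (\<psi> v))"
        unfolding alternating_prod_cnj[symmetric] alternating_prod_mult[symmetric]
        by (rule alternating_prod_cong) (simp add: r_def affine_maps_vertices[OF \<psi>])
      finally show "alternating_prod m (\<lambda>z. z i) (\<lambda>v. r (\<psi> v)) = 1" by simp
    qed
    have g1: "extend_cube n (\<lambda>v. v n = 1) r \<in> generate (torus_power (Suc n)) (face_generators (Suc n) d)"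
      unfolding Suc by (rule extend_cube_generate[OF _ r]) (rule extend_face_generator_top)
    have "u = extend_cube n (\<lambda>_. True) u0 \<otimes>\<^bsub>torus_power (Suc n)\<^esub> extend_cube n (\<lambda>v. v n = 1) r"
    proof (rule PiE_ext[OF Suc.prems(1)])
      show "extend_cube n (\<lambda>_. True) u0 \<otimes>\<^bsub>torus_power (Suc n)\<^esub> extend_cube n (\<lambda>v. v n = 1) r \<in> vertices (Suc n) \<rightarrow>\<^sub>E torus"
        using uT ins drop_last_coord_vertices
        by (auto simp: extend_cube_def u0_def r_def intro!: torus_closed)
      fix v assume v: "v \<in> vertices (Suc n)"
      let ?w = "restrict v {..<n}"
      have w: "?w \<in> vertices n" by (rule drop_last_coord_vertices[OF v])
      have vn: "v n = 0 \<or> v n = 1" by (rule vertices_D[OF v]) simp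
      have vi: "v = insert_coord n n (v n) ?w"
        by (rule vertices_eqI[OF v ins[OF vn w]]) (auto simp: insert_coord_def)
      have t: "u (insert_coord n n 0 ?w) i * cnj (u (insert_coord n n 0 ?w) i) = 1" for i
        by (rule torus_cnj[OF uT[OF ins[OF _ w]]]) simp
      show "u v = (extend_cube n (\<lambda>_. True) u0 \<otimes>\<^bsub>torus_power (Suc n)\<^esub> extend_cube n (\<lambda>v. v n = 1) r) v"
      proof (cases "v n = 1")
        case True
        then have "u v i = u (insert_coord n n 0 ?w) i * (u (insert_coord n n 1 ?w) i * cnj (u (insert_coord n n 0 ?w) i))" for i
          using vi t[of i] by (metis mult.left_commute mult.right_neutral)
        then show ?thesis using v w True by (simp add: extend_cube_def u0_def r_def fun_eq_iff)
      next
        case False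
        then have "u v = u (insert_coord n n 0 ?w)" using vi vn by metis
        then show ?thesis using v w False by (simp add: extend_cube_def u0_def fun_eq_iff)
      qed
    qed
    then show ?thesis using generate.eng[OF g0 g1] by (simp only:)
  qed
qed

section \<open>Fully ergodic Abramov systems are sub-abelian\<close>

context nilspace_action
begin

text \<open>In degree zero the filtration forces the group to be trivial, so the infinite torus cannot be used.\<close>

lemma sub_abelian_singleton:
  assumes "topspace T = {x}"
  shows "sub_abelian TYPE(nat \<Rightarrow> complex) k T C"
proof -
  let ?W = "{\<lambda>_ :: nat. 1 :: complex}"
  let ?f = "\<lambda>_ :: 'a. \<lambda>_ :: nat. 1 :: complex"
  have "compact_abelian_group (pointwise_group ?W) (top_of_set ?W)"
    by (rule pointwise_compact_abelian_group) (auto simp: torus_def)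
  moreover then interpret A: compact_abelian_group "pointwise_group ?W" "top_of_set ?W" .
  have "closed_filtration k (pointwise_group ?W) (top_of_set ?W) (\<lambda>_. ?W)"
    using A.triv_subgroup by (simp add: closed_filtration_def)
  moreover have "nilspace_morphism (topspace T) C (carrier (pointwise_group ?W)) (group_cubes (pointwise_group ?W) (\<lambda>_. ?W)) ?f"
    unfolding nilspace_morphism_def
  proof (intro conjI allI ballI)
    fix n c
    have "compose (vertices n) ?f c = \<one>\<^bsub>product_group (vertices n) (\<lambda>_. pointwise_group ?W)\<^esub>"
      by (simp add: compose_def)
    then show "compose (vertices n) ?f c \<in> group_cubes (pointwise_group ?W) (\<lambda>_. ?W) n"
      unfolding group_cubes_def by (simp only: generate.one)
  qed simp
  moreover have "continuous_map T (top_of_set ?W) ?f" by (simp add: continuous_map_in_subtopology)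
  moreover have "inj_on ?f (topspace T)" using assms by simp
  ultimately show ?thesis unfolding sub_abelian_def by blast
qed

text \<open>This needs \<open>k \<ge> 1\<close>: the term of index one has to be the whole group.\<close>

lemma torus_closed_filtration:
  assumes "k \<ge> 1"
  shows "closed_filtration k (pointwise_group torus) (top_of_set torus) (\<lambda>i. if i < k + 1 then torus else {\<lambda>_. 1})"
proof -
  interpret A: compact_abelian_group "pointwise_group torus" "top_of_set torus"
    by (rule pointwise_compact_abelian_group[OF order_refl torus_closed compact_torus])
  have "closedin (top_of_set torus) {\<lambda>_. 1}"
    using torus_closed(1) by (simp add: closedin_subset_topspace closed_subset)
  moreover have "subgroup torus (pointwise_group torus)" using A.subgroup_self by simp
  moreover have "subgroup {\<lambda>_. 1} (pointwise_group torus)" using A.triv_subgroup by simp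
  moreover have "closedin (top_of_set torus) torus" using closedin_topspace[of "top_of_set torus"] by simp
  ultimately show ?thesis using assms torus_closed(1) by (auto simp: closed_filtration_def)
qed

text \<open>A countable separating family of phase polynomials is an embedding into the infinite torus, and the
  triviality of its alternating products is exactly what makes it a morphism for the filtration that is
  constant up to index \<open>k\<close>. For \<open>k = 0\<close> phase polynomials are constant, and the nilspace is a point.\<close>

theorem sub_abelian_if_topological_Abramov:
  assumes ab: "topological_Abramov k T G \<phi>" and fe: "fully_ergodic T C G \<phi>"
  shows "sub_abelian TYPE(nat \<Rightarrow> complex) k T C"
proof -
  let ?S = "phase_polynomials T G \<phi> k" and ?X = "topspace T"
  have Sm: "?S \<subseteq> mspace (C_complex T)" by (auto simp: phase_polynomials_iff simp del: mspace_cfunspace)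
  have cont: "continuous_map T euclidean f" if "f \<in> ?S" for f
    using that by (simp add: phase_polynomials_iff mspace_C_complex[OF compact])
  have triv: "derivatives_trivial (k + 1) f" if "f \<in> ?S" for f using that by (simp add: phase_polynomials_iff)
  have sep: "\<exists>f\<in>?S. f x \<noteq> f y" if "x \<in> ?X" "y \<in> ?X" "x \<noteq> y" for x y
    using separates_points_if_dense[OF compact Hausdorff Sm _ that] ab unfolding topological_Abramov_def by blast
  obtain F :: "nat \<Rightarrow> 'a \<Rightarrow> complex" where F: "range F \<subseteq> ?S"
    "\<And>x y. x \<in> ?X \<Longrightarrow> y \<in> ?X \<Longrightarrow> x \<noteq> y \<Longrightarrow> \<exists>i. F i x \<noteq> F i y"
    by (rule countable_separating_family[OF second_countable _ cont sep]) (use one_phase_polynomial in auto)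
  have Fi: "F i \<in> ?S" for i using F(1) by auto
  have alt: "alternating_prod m (F i) c = 1" if "k + 1 \<le> m" "c \<in> C m" for m c i
    by (rule alternating_prod_of_phase_polynomial[OF fe triv[OF Fi] cont[OF Fi] that])
  have norm: "cmod (F i x) = 1" if "x \<in> ?X" for i x by (rule derivatives_trivial_norm[OF triv[OF Fi] that])
  show ?thesis
  proof (cases "k = 0")
    case True
    obtain x where x: "x \<in> ?X" using nonempty by blast
    have uniq: "y = x" if y: "y \<in> ?X" for y
    proof (rule ccontr)
      assume "y \<noteq> x"
      then obtain i where i: "F i y \<noteq> F i x" using F(2)[OF y x] by blast
      define c where "c = (\<lambda>v\<in>vertices 1. if v 0 = 1 then y else x)"
      have "c \<in> C 1" unfolding ergodicity c_def using x y by auto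
      then have "1 = alternating_prod (Suc 0) (F i) c" using alt[of 1 c i] True by simp
      also have "\<dots> = F i y * cnj (F i x)"
        using insert_coord_vertices[of 0 0 1 "\<lambda>_. undefined"] insert_coord_vertices[of 0 0 0 "\<lambda>_. undefined"]
        by (simp add: alternating_prod_split[of 0 0] alternating_prod_0 c_def vertices_0)
      finally have "F i y * cnj (F i x) = 1" by simp
      moreover have "F i x * cnj (F i x) = 1" using norm[OF x] by (simp add: complex_norm_square[symmetric])
      moreover have "cnj (F i x) \<noteq> 0" using norm[OF x, of i] by auto
      ultimately show False using i by (metis mult_right_cancel)
    qed
    have "?X \<subseteq> {x}" by (rule subsetI, rule singleton_iff[THEN iffD2], rule uniq)
    then have "?X = {x}" using x by (intro equalityI) simp_all
    then show ?thesis by (rule sub_abelian_singleton)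
  next
    case False
    define e where "e = (\<lambda>x i. F i x)"
    let ?Fil = "\<lambda>i. if i < k + 1 then torus else {\<lambda>_. 1}"
    have eT: "e x \<in> torus" if "x \<in> ?X" for x using norm[OF that] by (simp add: e_def torus_def)
    have "compact_abelian_group (pointwise_group torus) (top_of_set torus)"
      by (rule pointwise_compact_abelian_group[OF order_refl torus_closed compact_torus])
    moreover have "closed_filtration k (pointwise_group torus) (top_of_set torus) ?Fil"
      by (rule torus_closed_filtration) (use False in simp)
    moreover have "nilspace_morphism ?X C (carrier (pointwise_group torus)) (group_cubes (pointwise_group torus) ?Fil) e"
      unfolding nilspace_morphism_def
    proof (intro conjI allI ballI)
      show "e \<in> ?X \<rightarrow> carrier (pointwise_group torus)" using eT by simp
      fix n c assume c: "c \<in> C n"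
      have "compose (vertices n) e c \<in> generate (torus_power n) (face_generators n (k + 1))"
      proof (rule generated_if_alternating_prods_trivial)
        show "compose (vertices n) e c \<in> vertices n \<rightarrow>\<^sub>E torus"
          using eT cube_in_space[OF c] by (auto simp: compose_def)
        fix m \<psi> i assume m: "k + 1 \<le> m" and \<psi>: "\<psi> \<in> affine_maps m n"
        have "alternating_prod m (\<lambda>z. z i) (\<lambda>v. compose (vertices n) e c (\<psi> v)) = alternating_prod m (F i) (compose (vertices m) c \<psi>)"
          by (rule alternating_prod_cong) (simp add: compose_def e_def affine_maps_vertices[OF \<psi>])
        also have "\<dots> = 1" by (rule alt[OF m composition[OF c \<psi>]])
        finally show "alternating_prod m (\<lambda>z. z i) (\<lambda>v. compose (vertices n) e c (\<psi> v)) = 1" .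
      qed
      moreover have "face_generators n (k + 1) \<subseteq>
          {(\<lambda>v\<in>vertices n. if v \<in> P then g else \<one>\<^bsub>pointwise_group torus\<^esub>) | P g i. P \<in> codim_faces n i \<and> g \<in> ?Fil i}"
      proof
        fix h assume "h \<in> face_generators n (k + 1)"
        then obtain P g i where h: "h = (\<lambda>v\<in>vertices n. if v \<in> P then g else (\<lambda>_. 1))"
          and "P \<in> codim_faces n i" "g \<in> torus" "i < k + 1" unfolding face_generators_def by blast
        then show "h \<in> {(\<lambda>v\<in>vertices n. if v \<in> P then g else \<one>\<^bsub>pointwise_group torus\<^esub>) | P g i.
            P \<in> codim_faces n i \<and> g \<in> ?Fil i}"
          unfolding pointwise_group_simps by (intro CollectI exI[of _ P] exI[of _ g] exI[of _ i]) simp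
      qed
      ultimately show "compose (vertices n) e c \<in> group_cubes (pointwise_group torus) ?Fil n"
        unfolding group_cubes_def using group.mono_generate[OF group_torus_power] by blast
    qed
    moreover have "continuous_map T (top_of_set torus) e"
      unfolding continuous_map_in_subtopology continuous_map_pointwise
      using eT cont[OF Fi] by (auto simp: e_def)
    moreover have "inj_on e ?X"
    proof (rule inj_onI, rule ccontr)
      fix x y assume "x \<in> ?X" "y \<in> ?X" and eq: "e x = e y" and "x \<noteq> y"
      have "F i x = F i y" for i using fun_cong[OF eq, of i] by (simp add: e_def)
      then show False using F(2)[OF \<open>x \<in> ?X\<close> \<open>y \<in> ?X\<close> \<open>x \<noteq> y\<close>] by simp
    qed
    ultimately show ?thesis unfolding sub_abelian_def by blast
  qed
qed

end

theorem proposition5p14: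
  fixes T :: "'a topology" and C :: "'a cubes"
    and G :: "('g, 'r) monoid_scheme" and \<phi> :: "'g \<Rightarrow> 'a \<Rightarrow> 'a" and k :: nat
  assumes "compact_nilspace T C"
    and "k_step k (topspace T) C"
    and "comm_group G"
    and "countable (carrier G)"
    and "\<phi> \<in> hom G (Theta T C)"
  shows "(sub_abelian TYPE('b) k T C \<longrightarrow> topological_Abramov k T G \<phi>) \<and>
         (topological_Abramov k T G \<phi> \<and> fully_ergodic T C G \<phi> \<longrightarrow>
            sub_abelian TYPE(nat \<Rightarrow> complex) k T C)"
proof -
  interpret nilspace_action T C G \<phi>
    using assms(1,3,5) by (simp add: nilspace_action_def nilspace_action_axioms_def)
  show ?thesis
    using topological_Abramov_if_sub_abelian sub_abelian_if_topological_Abramov by blast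
qed

end
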